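(* Let $U\cong\mathbb R^2$ be a Euclidean plane with scalar product $\langle\cdot,\cdot\rangle$ and let $\Omega\subset U$ be a convex compact set with $0\in\operatorname{int}\Omega$. For initial data $q_0=(x_0,y_0)\in U\oplus U$ consider the optimal control problem $$J(x)=\tfrac12\int_0^{+\infty}\langle x(t),x(t)\rangle\,dt\to\inf,\qquad \ddot x=u(t),\ u(t)\in\Omega \text{ measurable},\qquad x(0)=x_0,\ \dot x(0)=y_0 .$$ Then for every $q_0=(x_0,y_0)$: 1. There exists a unique optimal trajectory $\hat q(t,q_0)=(\hat x(t,q_0),\hat y(t,q_0))$ (with $\hat y=\dot{\hat x}$) of this problem, and the adjoint function $\hat p(t,q_0)=(\hat\phi(t,q_0),\hat\psi(t,q_0))$ along it is also unique, i.e. there is exactly one pair of absolutely continuous functions $(\phi,\psi)$ on $[0,\infty)$ such that $\dot\psi=-\phi$, $\dot\phi=\hat x$, and $\langle\psi(t),\hat u(t)\rangle=\max_{u\in\Omega}\langle\psi(t),u\rangle$ for a.e. $t$, where $\hat u=\ddot{\hat x}$ is the optimal control. 2. There exists $T(q_0)\ge0$ such that $\hat q(t,q_0)=0$ and $\hat p(t,q_0)=0$ for all $t\ge T(q_0)$, while $\hat q(t,q_0)\neq0$ and $\hat p(t,q_0)\ne0$ for $t<T(q_0)$. The function $T(\cdot)$ is continuous and there are constants $C_1,C_2>0$ with $$C_1\max\{\sqrt{|x_0|},|y_0|\}\le T(q_0)\le C_2\max\{\sqrt{|x_0|},|y_0|\}.$$ 3. The map $E:q_0\mapsto \hat p(0,q_0)=(\phi_0,\psi_0)$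 from $U\oplus U$ to $U\oplus U$ is locally Lipschitz and bijective, and there are constants $C_3,C_4>0$ with $$C_3\max\{\sqrt{|x_0|},|y_0|\}\le \max\{\sqrt[3]{|\phi_0|},\sqrt[4]{|\psi_0|}\}\le C_4\max\{\sqrt{|x_0|},|y_0|\}.$$
   Context: The adjoint function is the one given by the Pontryagin maximum principle in normal form ($\lambda_0=1$): with Pontryagin function $\mathcal H=-\tfrac12\langle x,x\rangle+\langle\phi,y\rangle+\langle\psi,u\rangle$, the extremals satisfy $\dot\psi=-\phi$, $\dot\phi=x$, $\dot x=y$, $\dot y=u$, $\langle\psi,u\rangle\to\max_{u\in\Omega}$. *)

theory Defs
  imports "HOL-Analysis.Analysis"
begin

type_synonym U = "real^2"

text \<open>Admissible process on [0,+oo): measurable control u with values in Omega,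
  y(t) = y0 + int_0^t u, x(t) = x0 + int_0^t y (so x(0)=x0, x'(0)=y0, x''=u a.e.).\<close>
definition admissible :: "U set \<Rightarrow> U \<Rightarrow> U \<Rightarrow> (real \<Rightarrow> U) \<Rightarrow> (real \<Rightarrow> U) \<Rightarrow> (real \<Rightarrow> U) \<Rightarrow> bool" where
  "admissible \<Omega> x0 y0 x y u \<longleftrightarrow>
     u \<in> borel_measurable (lebesgue_on {0..}) \<and>
     (\<forall>t\<ge>0. u t \<in> \<Omega>) \<and>
     (\<forall>t\<ge>0. y t = y0 + integral {0..t} u) \<and>
     (\<forall>t\<ge>0. x t = x0 + integral {0..t} y)"

definition cost :: "(real \<Rightarrow> U) \<Rightarrow> ennreal" where
  "cost x = (\<integral>\<^sup>+ t. ennreal (x t \<bullet> x t / 2) * indicator {0..} t \<partial>lborel)"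

definition optimal :: "U set \<Rightarrow> U \<Rightarrow> U \<Rightarrow> (real \<Rightarrow> U) \<Rightarrow> (real \<Rightarrow> U) \<Rightarrow> bool" where
  "optimal \<Omega> x0 y0 x y \<longleftrightarrow>
     (\<exists>u. admissible \<Omega> x0 y0 x y u) \<and>
     (\<forall>x' y' u'. admissible \<Omega> x0 y0 x' y' u' \<longrightarrow> cost x \<le> cost x')"

text \<open>Adjoint (PMP, normal form): absolutely continuous phi, psi on [0,oo) with
  psi' = -phi, phi' = x (a.e.; written in integral form), and the maximum condition a.e.\<close>
definition adjoint :: "U set \<Rightarrow> (real \<Rightarrow> U) \<Rightarrow> (real \<Rightarrow> U) \<Rightarrow> (real \<Rightarrow> U) \<Rightarrow> (real \<Rightarrow> U) \<Rightarrow> bool" where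
  "adjoint \<Omega> x u \<phi> \<psi> \<longleftrightarrow>
     (\<forall>t\<ge>0. \<phi> t = \<phi> 0 + integral {0..t} x) \<and>
     (\<forall>t\<ge>0. \<psi> t = \<psi> 0 - integral {0..t} \<phi>) \<and>
     (AE t in lebesgue_on {0..}. \<forall>v\<in>\<Omega>. \<psi> t \<bullet> v \<le> \<psi> t \<bullet> u t)"

definition locally_lipschitz :: "('a::metric_space \<Rightarrow> 'b::metric_space) \<Rightarrow> bool" where
  "locally_lipschitz f \<longleftrightarrow> (\<forall>z. \<exists>r>0. \<exists>L. L-lipschitz_on (ball z r) f)"

end

(*
  The optimal trajectory satisfies a Bellman-type sandwich: with N = max (sqrt |x|) |y|, the remaining
  cost V at a point of the trajectory lies between c N^5 (any trajectory with bounded acceleration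
  pays that much during a time of order N) and C N^5 (steer to the origin with a control that is
  affine in time). Hence V^(1/5) loses a fixed proportion during a time proportional to itself, and
  the trajectory reaches the origin in finite time, bounded by a multiple of N.

  Once the trajectory is extinct, phi and psi are forced to be the integrals from the extinction time
  backwards, and the maximum condition is the first-order optimality condition, in which no
  multipliers for an endpoint are needed since one can always steer back to the origin afterwards.

  For two extremals, integration by parts together with the maximum condition gives
    int |x - x'|^2 <= - <p(0) - p'(0), q(0) - q'(0)>.
  As psi is a double integral of x backwards from the extinction time, |p(0) - p'(0)|^2 is at most a
  constant times the left-hand side, so q(0) |-> p(0) is locally Lipschitz; it is injective because
  the left-hand side controls the state. It is coercive by the same inequality applied to the zero
  extremal, and then surjective by invariance of domain.
*)
theory Submission
  imports Defs
begin

subsection \<open>Curves with Lipschitz derivative\<close>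

text \<open>All exponents come from one scaling. Give \<open>t\<close> and \<open>y\<close> weight 1
  and \<open>x\<close> weight 2, with \<open>u\<close> of weight 0. The dynamics with a fixed
  control set respects this; \<open>\<phi>\<close>, \<open>\<psi>\<close> then have weights 3 and 4
  and the cost weight 5. The invariance is never invoked as such; the estimates simply carry
  matching exponents.

  The lower bound for the cost uses only that the velocity is Lipschitz, not which control produced
  it. So it is stated for plain curves, and it also covers the difference of two trajectories, with
  constant \<open>R + R\<close>.

  The obstacle is the infinite horizon, where the maximum principle supplies no transversality
  condition. Extinction is therefore derived from cost comparison alone, before any adjoint function
  appears. From then on all estimates live on bounded intervals, and the zero final values of the
  adjoint are proved from the ball around 0 in the control set.

  Existence of an optimal process is a separate matter: among controls of nearly minimal cost one
  selects those of nearly minimal norm in a weighted square-integrable space, which gives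
  convergence almost everywhere.\<close>

definition lip_deriv_path :: "real \<Rightarrow> (real \<Rightarrow> 'a::euclidean_space) \<Rightarrow> (real \<Rightarrow> 'a) \<Rightarrow> bool" where
  "lip_deriv_path R x y \<longleftrightarrow>
     (\<forall>s\<ge>0. \<forall>t\<ge>0. norm (y t - y s) \<le> R * \<bar>t - s\<bar>) \<and>
     (\<forall>t\<ge>0. (x has_vector_derivative y t) (at t within {0..}))"

lemma bounded_measurable_integrable_on:
  fixes f :: "real \<Rightarrow> 'a::euclidean_space"
  assumes "f \<in> borel_measurable (lebesgue_on {a..b})" "\<And>t. t \<in> {a..b} \<Longrightarrow> norm (f t) \<le> B"
  shows "f integrable_on {a..b}"
  by (rule measurable_bounded_by_integrable_imp_integrable[where g="\<lambda>_. B"]) (use assms in auto)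

lemma integral_split_interval:
  fixes f :: "real \<Rightarrow> 'a::euclidean_space"
  assumes "f integrable_on {a..c}" "a \<le> b" "b \<le> c"
  shows "integral {a..c} f - integral {a..b} f = integral {b..c} f"
  using Henstock_Kurzweil_Integration.integral_combine[OF assms(2,3,1)] by (simp add: algebra_simps)

lemma lip_deriv_path_lipschitz:
  assumes "lip_deriv_path R x y" "0 \<le> s" "0 \<le> t"
  shows "norm (y t - y s) \<le> R * \<bar>t - s\<bar>"
  using assms unfolding lip_deriv_path_def by blast

lemma lip_deriv_path_nonneg:
  assumes "lip_deriv_path R x y"
  shows "0 \<le> R"
  using order_trans[OF norm_ge_zero lip_deriv_path_lipschitz[OF assms, of 0 1]] by simp

lemma lip_deriv_path_diff:
  assumes "lip_deriv_path R x y" "lip_deriv_path R' x' y'"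
  shows "lip_deriv_path (R + R') (\<lambda>t. x t - x' t) (\<lambda>t. y t - y' t)"
  unfolding lip_deriv_path_def
proof (intro conjI allI impI)
  fix s t :: real assume st: "s \<ge> 0" "t \<ge> 0"
  have "norm (y t - y' t - (y s - y' s)) = norm ((y t - y s) - (y' t - y' s))"
    by (simp add: algebra_simps)
  also have "\<dots> \<le> norm (y t - y s) + norm (y' t - y' s)" by (rule norm_triangle_ineq4)
  also have "\<dots> \<le> R * \<bar>t - s\<bar> + R' * \<bar>t - s\<bar>"
    using assms st unfolding lip_deriv_path_def by (intro add_mono) auto
  finally show "norm (y t - y' t - (y s - y' s)) \<le> (R + R') * \<bar>t - s\<bar>" by (simp add: algebra_simps)
next
  fix t :: real assume "t \<ge> 0"
  then show "((\<lambda>t. x t - x' t) has_vector_derivative y t - y' t) (at t within {0..})"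
    using assms unfolding lip_deriv_path_def by (intro has_vector_derivative_diff) auto
qed

lemma lip_deriv_path_continuous:
  assumes "lip_deriv_path R x y" "0 \<le> a"
  shows "continuous_on {a..} x" "continuous_on {a..b} x" "continuous_on {a..} y" "continuous_on {a..b} y"
proof -
  have "continuous_on {0..} x"
    using assms unfolding lip_deriv_path_def
    by (meson atLeast_iff continuous_on_vector_derivative)
  then show "continuous_on {a..} x" "continuous_on {a..b} x"
    using assms(2) by (auto elim!: continuous_on_subset)
  have "R \<ge> 0" by (rule lip_deriv_path_nonneg[OF assms(1)])
  then have "R-lipschitz_on {0..} y"
    using assms(1) unfolding lip_deriv_path_def lipschitz_on_def by (auto simp: dist_norm)
  then have "continuous_on {0..} y" by (rule lipschitz_on_continuous_on)
  then show "continuous_on {a..} y" "continuous_on {a..b} y"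
    using assms(2) by (auto elim!: continuous_on_subset)
qed

text \<open>Mean value inequality for \<open>x\<close> minus its tangent line at \<open>a\<close>,
  whose derivative \<open>y s - y a\<close> is at most \<open>R * (t - a)\<close> in norm. This
  crude argument gives \<open>R\<close> in place of the sharp \<open>R / 2\<close>.\<close>

lemma lip_deriv_path_taylor:
  assumes "lip_deriv_path R x y" "0 \<le> a" "a \<le> t"
  shows "norm (x t - x a - (t - a) *\<^sub>R y a) \<le> R * (t - a)\<^sup>2"
proof -
  define g where "g s = x s - (s - a) *\<^sub>R y a" for s
  have "R \<ge> 0" by (rule lip_deriv_path_nonneg[OF assms(1)])
  have "norm (g t - g a) \<le> (R * (t - a)) * norm (t - a)"
  proof (rule differentiable_bound[where S="{a..t}" and f'="\<lambda>s h. h *\<^sub>R (y s - y a)"])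
    fix s assume s: "s \<in> {a..t}"
    have "(x has_vector_derivative y s) (at s within {a..t})"
      using assms s unfolding lip_deriv_path_def
      by (intro has_vector_derivative_within_subset[where S="{0..}" and T="{a..t}"]) auto
    then have "(g has_vector_derivative (y s - y a)) (at s within {a..t})"
      unfolding g_def by (auto intro!: derivative_eq_intros)
    then show "(g has_derivative (\<lambda>h. h *\<^sub>R (y s - y a))) (at s within {a..t})"
      by (simp add: has_vector_derivative_def)
    have "norm (y s - y a) \<le> R * (t - a)"
    proof -
      have "norm (y s - y a) \<le> R * \<bar>s - a\<bar>"
        using assms s by (intro lip_deriv_path_lipschitz[OF assms(1)]) auto
      also have "\<dots> \<le> R * (t - a)" using s \<open>R \<ge> 0\<close> by (intro mult_left_mono) auto
      finally show ?thesis .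
    qed
    then show "onorm (\<lambda>h. h *\<^sub>R (y s - y a)) \<le> R * (t - a)"
      by (intro onorm_bound) (use assms(3) \<open>R \<ge> 0\<close> in \<open>auto simp: mult.commute intro: mult_left_mono\<close>)
  qed (use assms in auto)
  then show ?thesis using assms(3) by (simp add: g_def power2_eq_square algebra_simps)
qed

text \<open>The size of a state that is homogeneous of degree 1 when \<open>x\<close> has weight 2
  and \<open>y\<close> weight 1. It is not a norm.\<close>

definition hnorm :: "'a::real_normed_vector \<Rightarrow> 'a \<Rightarrow> real" where
  "hnorm x y = max (sqrt (norm x)) (norm y)"

lemma hnorm_nonneg [simp]: "0 \<le> hnorm x y"
  by (simp add: hnorm_def max_def)

lemma hnorm_eq_0_iff [simp]: "hnorm x y = 0 \<longleftrightarrow> x = 0 \<and> y = 0"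
  by (auto simp: hnorm_def max_def)

lemma norm_le_hnorm: "norm y \<le> hnorm x y" "norm x \<le> (hnorm x y)\<^sup>2"
proof -
  show "norm y \<le> hnorm x y" by (simp add: hnorm_def)
  have "norm x = (sqrt (norm x))\<^sup>2" by simp
  also have "\<dots> \<le> (hnorm x y)\<^sup>2" by (intro power_mono) (auto simp: hnorm_def)
  finally show "norm x \<le> (hnorm x y)\<^sup>2" .
qed

text \<open>The weights \<open>4 - 6 t / s\<close> and \<open>12 t / s - 6\<close> on \<open>[0, s]\<close> are dual to the Taylor
  polynomials \<open>1\<close> and \<open>t / s\<close>, so moments of the curve recover its initial position and velocity.\<close>

lemma moment_bound:
  fixes x y :: "real \<Rightarrow> 'a::euclidean_space"
  assumes tr: "lip_deriv_path R x y" and a: "0 \<le> a" and s: "0 < s"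
    and k: "\<And>t. t \<in> {a..a+s} \<Longrightarrow> \<bar>k t\<bar> \<le> 6" "continuous_on {a..a+s} k"
    and v: "((\<lambda>t. k t *\<^sub>R (x a + (t - a) *\<^sub>R y a)) has_integral (s *\<^sub>R v)) {a..a+s}"
  shows "s * norm v \<le> 6 * integral {a..a+s} (\<lambda>t. norm (x t)) + 6 * R * s ^ 3"
proof -
  have R: "R \<ge> 0" by (rule lip_deriv_path_nonneg[OF tr])
  note cx = lip_deriv_path_continuous(2)[OF tr a, of "a+s"]
  have kn: "(\<lambda>t. k t *\<^sub>R (x a + (t - a) *\<^sub>R y a)) integrable_on {a..a+s}"
    by (intro integrable_continuous_real continuous_intros k)
  have "norm (integral {a..a+s} (\<lambda>t. k t *\<^sub>R (x a + (t - a) *\<^sub>R y a)))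
      \<le> integral {a..a+s} (\<lambda>t. 6 * norm (x t) + 6 * R * s\<^sup>2)"
  proof (rule Henstock_Kurzweil_Integration.integral_norm_bound_integral)
    show "(\<lambda>t. 6 * norm (x t) + 6 * R * s\<^sup>2) integrable_on {a..a+s}"
      by (intro integrable_continuous_real continuous_intros cx)
    fix t assume t: "t \<in> {a..a+s}"
    have "norm (x a + (t - a) *\<^sub>R y a) = norm (x t - (x t - x a - (t - a) *\<^sub>R y a))"
      by (simp add: add.commute)
    also have "\<dots> \<le> norm (x t) + norm (x t - x a - (t - a) *\<^sub>R y a)" by (rule norm_triangle_ineq4)
    also have "\<dots> \<le> norm (x t) + R * (t - a)\<^sup>2"
      using lip_deriv_path_taylor[OF tr a, of t] t by auto
    also have "\<dots> \<le> norm (x t) + R * s\<^sup>2"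
      using t R by (intro add_mono mult_left_mono power_mono) auto
    finally have *: "norm (x a + (t - a) *\<^sub>R y a) \<le> norm (x t) + R * s\<^sup>2" .
    have "norm (k t *\<^sub>R (x a + (t - a) *\<^sub>R y a)) \<le> 6 * (norm (x t) + R * s\<^sup>2)"
      unfolding norm_scaleR using k(1)[OF t] * by (intro mult_mono) auto
    then show "norm (k t *\<^sub>R (x a + (t - a) *\<^sub>R y a)) \<le> 6 * norm (x t) + 6 * R * s\<^sup>2"
      by (simp add: algebra_simps)
  qed (rule kn)
  also have "\<dots> = 6 * integral {a..a+s} (\<lambda>t. norm (x t)) + 6 * R * s\<^sup>2 * s"
    by (subst Henstock_Kurzweil_Integration.integral_add)
       (use s in \<open>auto intro!: integrable_continuous_real continuous_intros cx\<close>)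
  finally show ?thesis
    using integral_unique[OF v] s by (simp add: power2_eq_square power3_eq_cube algebra_simps)
qed

lemma scaleR_comb_has_integral:
  fixes v w :: "'a::euclidean_space"
  assumes "a \<le> b"
    and "\<And>t. t \<in> {a..b} \<Longrightarrow> (p has_real_derivative p' t) (at t within {a..b})"
    and "\<And>t. t \<in> {a..b} \<Longrightarrow> (q has_real_derivative q' t) (at t within {a..b})"
  shows "((\<lambda>t. p' t *\<^sub>R v + q' t *\<^sub>R w) has_integral ((p b - p a) *\<^sub>R v + (q b - q a) *\<^sub>R w)) {a..b}"
  using assms
  by (intro has_integral_add has_integral_scaleR_left fundamental_theorem_of_calculus)
     (auto simp: has_real_derivative_iff_has_vector_derivative)

lemma position_velocity_bound:
  fixes x y :: "real \<Rightarrow> 'a::euclidean_space"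
  assumes tr: "lip_deriv_path R x y" and a: "0 \<le> a" and s: "0 < s"
  shows "s * norm (x a) \<le> 6 * integral {a..a+s} (\<lambda>t. norm (x t)) + 6 * R * s ^ 3"
    and "s * (s * norm (y a)) \<le> 6 * integral {a..a+s} (\<lambda>t. norm (x t)) + 6 * R * s ^ 3"
proof -
  have kb: "0 \<le> (t - a) / s \<and> (t - a) / s \<le> 1" if "t \<in> {a..a+s}" for t
    using that s by (auto simp: field_simps)
  have ab: "\<bar>4 - 6 * c\<bar> \<le> 6" "\<bar>12 * c - 6\<bar> \<le> 6" if "0 \<le> c \<and> c \<le> 1" for c :: real
    using that by linarith+
  \<comment> \<open>The scalar factors written out below are antiderivatives of the weight and of
    the weight times \<open>t - a\<close>. Over the window they grow by \<open>s\<close> and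
    \<open>0\<close>; for the second weight, by \<open>0\<close> and \<open>s^2\<close>.\<close>
  show "s * norm (x a) \<le> 6 * integral {a..a+s} (\<lambda>t. norm (x t)) + 6 * R * s ^ 3"
  proof (rule moment_bound[OF tr a s, where k="\<lambda>t. 4 - 6 * ((t - a) / s)"])
    have "((\<lambda>t. (4 - 6 * ((t - a) / s)) *\<^sub>R x a + ((4 - 6 * ((t - a) / s)) * (t - a)) *\<^sub>R y a) has_integral
       ((4 * ((a + s) - a) - 3 * ((a + s) - a)^2 / s) - (4 * (a - a) - 3 * (a - a)^2 / s)) *\<^sub>R x a
     + ((2 * ((a + s) - a)^2 - 2 * ((a + s) - a)^3 / s) - (2 * (a - a)^2 - 2 * (a - a)^3 / s)) *\<^sub>R y a) {a..a+s}"
      by (rule scaleR_comb_has_integral)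
         (use s in \<open>auto intro!: derivative_eq_intros simp: field_simps power2_eq_square\<close>)
    then show "((\<lambda>t. (4 - 6 * ((t - a) / s)) *\<^sub>R (x a + (t - a) *\<^sub>R y a)) has_integral s *\<^sub>R x a) {a..a+s}"
      using s by (simp add: scaleR_add_right power2_eq_square power3_eq_cube)
next
    show "\<bar>4 - 6 * ((t - a) / s)\<bar> \<le> 6" if "t \<in> {a..a+s}" for t
      by (rule ab(1)[OF kb[OF that]])
  qed (use s in \<open>auto intro!: continuous_intros\<close>)
  have "s * norm (s *\<^sub>R y a) \<le> 6 * integral {a..a+s} (\<lambda>t. norm (x t)) + 6 * R * s ^ 3"
  proof (rule moment_bound[OF tr a s, where k="\<lambda>t. 12 * ((t - a) / s) - 6"])
    have "((\<lambda>t. (12 * ((t - a) / s) - 6) *\<^sub>R x a + ((12 * ((t - a) / s) - 6) * (t - a)) *\<^sub>R y a) has_integral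
       ((6 * ((a + s) - a)^2 / s - 6 * ((a + s) - a)) - (6 * (a - a)^2 / s - 6 * (a - a))) *\<^sub>R x a
     + ((4 * ((a + s) - a)^3 / s - 3 * ((a + s) - a)^2) - (4 * (a - a)^3 / s - 3 * (a - a)^2)) *\<^sub>R y a) {a..a+s}"
      by (rule scaleR_comb_has_integral)
         (use s in \<open>auto intro!: derivative_eq_intros simp: field_simps power2_eq_square\<close>)
    then show "((\<lambda>t. (12 * ((t - a) / s) - 6) *\<^sub>R (x a + (t - a) *\<^sub>R y a)) has_integral s *\<^sub>R (s *\<^sub>R y a)) {a..a+s}"
      using s by (simp add: scaleR_add_right power2_eq_square power3_eq_cube)
next
    show "\<bar>12 * ((t - a) / s) - 6\<bar> \<le> 6" if "t \<in> {a..a+s}" for t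
      by (rule ab(2)[OF kb[OF that]])
  qed (use s in \<open>auto intro!: continuous_intros\<close>)
  then show "s * (s * norm (y a)) \<le> 6 * integral {a..a+s} (\<lambda>t. norm (x t)) + 6 * R * s ^ 3"
    using s by simp
qed

text \<open>Window length per unit of \<open>hnorm\<close>. With \<open>k = obs_time R\<close> and
  \<open>s = k * N\<close>, the identity \<open>24 * R * k = 1\<close> makes the Taylor error
  \<open>6 * R * s^3\<close> exactly a quarter of the main term \<open>s * (k * N^2)\<close>. The 72
  in \<open>obs_const\<close> is 36 from Young's inequality times 2, because only half of the main
  term survives.\<close>

definition obs_time :: "real \<Rightarrow> real" where "obs_time R = 1 / (24 * R)"
definition obs_const :: "real \<Rightarrow> real" where "obs_const R = obs_time R ^ 3 / 72"

lemma obs_pos: "R \<ge> 1 \<Longrightarrow> obs_time R > 0" "R \<ge> 1 \<Longrightarrow> obs_const R > 0" "R \<ge> 1 \<Longrightarrow> obs_time R \<le> 1"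
  by (simp_all add: obs_time_def obs_const_def field_simps)

text \<open>The moment bounds recover position and velocity from the integral of \<open>|x|\<close>
  over a window of length proportional to \<open>N\<close>, and Young's inequality passes from
  \<open>|x|\<close> to \<open>|x|^2\<close>.\<close>

lemma observability:
  fixes x y :: "real \<Rightarrow> 'a::euclidean_space"
  assumes tr: "lip_deriv_path R x y" and R: "R \<ge> 1" and a: "0 \<le> a"
    and b: "b \<ge> a + obs_time R * hnorm (x a) (y a)"
  shows "obs_const R * hnorm (x a) (y a) ^ 5 \<le> integral {a..b} (\<lambda>t. x t \<bullet> x t)"
proof -
  define N where "N = hnorm (x a) (y a)"
  define k where "k = obs_time R"
  define s where "s = k * N"
  define I where "I = integral {a..a+s} (\<lambda>t. x t \<bullet> x t)"
  have N0: "N \<ge> 0" by (simp add: N_def)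
  have k0: "k > 0" "k \<le> 1" using obs_pos[OF R] by (auto simp: k_def)
  have cx: "continuous_on {a..c} x" for c by (rule lip_deriv_path_continuous(2)[OF tr a])
  have int: "(\<lambda>t. x t \<bullet> x t) integrable_on {a..c}" for c
    by (intro integrable_continuous_real continuous_intros cx)
  have Ib: "I \<le> integral {a..b} (\<lambda>t. x t \<bullet> x t)"
    unfolding I_def using b by (intro integral_subset_le int) (auto simp: s_def k_def N_def)
  show ?thesis
  proof (cases "N = 0")
    case True
    then have "hnorm (x a) (y a) = 0" by (simp add: N_def)
    then have "obs_const R * hnorm (x a) (y a) ^ 5 = 0" by (simp only:) simp
    also have "0 \<le> integral {a..b} (\<lambda>t. x t \<bullet> x t)"
      by (rule Henstock_Kurzweil_Integration.integral_nonneg[OF int]) auto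
    finally show ?thesis .
  next
    case False
    then have N: "N > 0" using N0 by simp
    then have s: "s > 0" using k0 by (simp add: s_def)
    \<comment> \<open>Parameter of Young's inequality \<open>2 d |x| <= |x|^2 + d^2\<close>, chosen
      so that the resulting constant term also costs a quarter of the main term.\<close>
    define d where "d = k * N\<^sup>2 / 12"
    have d: "d > 0" using k0 N by (simp add: d_def)
    have L: "integral {a..a+s} (\<lambda>t. norm (x t)) \<le> I / (2 * d) + d / 2 * s"
    proof -
      have "integral {a..a+s} (\<lambda>t. norm (x t)) \<le> integral {a..a+s} (\<lambda>t. (x t \<bullet> x t) / (2 * d) + d / 2)"
      proof (rule integral_le)
        fix t
        have "0 \<le> (norm (x t) - d)\<^sup>2" by simp
        then have "2 * d * norm (x t) \<le> x t \<bullet> x t + d * d"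
          by (simp add: power2_eq_square algebra_simps dot_square_norm)
        then show "norm (x t) \<le> (x t \<bullet> x t) / (2 * d) + d / 2"
          using d by (simp add: field_simps)
      qed (use d in \<open>auto intro!: integrable_continuous_real continuous_intros cx\<close>)
      also have "\<dots> = I / (2 * d) + d / 2 * s"
        unfolding I_def
        by (subst Henstock_Kurzweil_Integration.integral_add)
           (use s d in \<open>auto intro!: integrable_continuous_real continuous_intros cx\<close>)
      finally show ?thesis .
    qed
    \<comment> \<open>One of the two entries of the maximum equals \<open>N\<close>. For the
      velocity \<open>s * |y a|\<close> is exactly \<open>k * N^2\<close>; for the position
      \<open>|x a| = N^2\<close>, and \<open>k <= 1\<close> is used.\<close>
    have big: "s * (k * N\<^sup>2) \<le> 6 * integral {a..a+s} (\<lambda>t. norm (x t)) + 6 * R * s ^ 3"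
    proof (cases "norm (y a) \<ge> sqrt (norm (x a))")
      case True
      then have "N = norm (y a)" by (simp add: N_def hnorm_def)
      then have "s * (k * N\<^sup>2) = s * (s * norm (y a))" by (simp add: s_def power2_eq_square)
      then show ?thesis using position_velocity_bound(2)[OF tr a s] by linarith
    next
      case False
      then have "N = sqrt (norm (x a))" by (simp add: N_def hnorm_def)
      then have "N\<^sup>2 = norm (x a)" by simp
      then have "s * (k * N\<^sup>2) \<le> s * norm (x a)" using s k0 by (simp add: mult_left_le_one_le)
      then show ?thesis using position_velocity_bound(1)[OF tr a s] by linarith
    qed
    have kR: "24 * R * k = 1" using R by (simp add: k_def obs_time_def)
    have "6 * R * s ^ 3 = (24 * R * k) * (s * (k * N\<^sup>2)) / 4"
      by (simp add: s_def power2_eq_square power3_eq_cube)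
    then have "6 * R * s ^ 3 = s * (k * N\<^sup>2) / 4" using kR by simp
    moreover have "6 * (d / 2 * s) = s * (k * N\<^sup>2) / 4" by (simp add: d_def)
    ultimately have "s * (k * N\<^sup>2) / 2 \<le> 6 * (I / (2 * d))" using big L by argo
    also have "\<dots> = 36 * I / (k * N\<^sup>2)" using k0 N by (simp add: d_def field_simps)
    finally have "s * (k * N\<^sup>2) / 2 * (k * N\<^sup>2) \<le> 36 * I" using k0 N by (simp add: field_simps)
    then have "k ^ 3 / 72 * N ^ 5 \<le> I"
      by (simp add: s_def power2_eq_square eval_nat_numeral algebra_simps)
    then show ?thesis using Ib by (simp add: obs_const_def k_def N_def)
  qed
qed

subsection \<open>Integration by parts against an indefinite integral\<close>

text \<open>Cutting the interval into \<open>n + 1\<close> equal pieces bounds the total increment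
  by \<open>K * (b - a)^2 / (n + 1)\<close>, which tends to 0.\<close>

lemma quadratic_increments_imp_const:
  fixes G :: "real \<Rightarrow> real"
  assumes ab: "a \<le> b"
    and G: "\<And>s t. a \<le> s \<Longrightarrow> s \<le> t \<Longrightarrow> t \<le> b \<Longrightarrow> \<bar>G t - G s\<bar> \<le> K * (t - s)\<^sup>2"
  shows "G b = G a"
proof -
  have bd: "\<bar>G b - G a\<bar> \<le> K * (b - a)\<^sup>2 * inverse (real (Suc n))" for n
  proof -
    define c where "c = (b - a) / Suc n"
    define p where "p i = a + real i * c" for i
    have "c \<ge> 0" using ab by (simp add: c_def)
    then have p: "a \<le> p i" "p i \<le> p (Suc i)" for i
      by (auto simp: p_def distrib_right)
    have pb: "p i \<le> b" if "i \<le> Suc n" for i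
    proof -
      have "real i / Suc n * (b - a) \<le> 1 * (b - a)"
        using that ab by (intro mult_right_mono) auto
      then show ?thesis by (simp add: p_def c_def)
    qed
    have "G b - G a = G (p (Suc n)) - G (p 0)" by (simp add: p_def c_def)
    also have "\<dots> = (\<Sum>i<Suc n. G (p (Suc i)) - G (p i))" by (rule sum_lessThan_telescope[symmetric])
    also have "\<bar>\<dots>\<bar> \<le> (\<Sum>i<Suc n. \<bar>G (p (Suc i)) - G (p i)\<bar>)" by (rule sum_abs)
    also have "\<dots> \<le> (\<Sum>i<Suc n. K * (p (Suc i) - p i)\<^sup>2)"
      by (intro sum_mono G p pb) auto
    also have "\<dots> = (\<Sum>i<Suc n. K * ((b - a) / Suc n)\<^sup>2)"
      unfolding c_def[symmetric] by (simp add: p_def distrib_right)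
    also have "\<dots> = K * (b - a)\<^sup>2 * inverse (real (Suc n))"
      by (simp add: power2_eq_square field_simps del: of_nat_Suc)
    finally show ?thesis .
  qed
  have "(\<lambda>n. K * (b - a)\<^sup>2 * inverse (real (Suc n))) \<longlonglongrightarrow> K * (b - a)\<^sup>2 * 0"
    by (intro tendsto_mult tendsto_const LIMSEQ_inverse_real_of_nat)
  then have "\<bar>G b - G a\<bar> \<le> K * (b - a)\<^sup>2 * 0"
    by (rule LIMSEQ_le_const) (use bd in auto)
  then show ?thesis by simp
qed

lemma norm_integral_le_const:
  fixes f :: "real \<Rightarrow> 'a::euclidean_space"
  assumes "f integrable_on {a..b}" "a \<le> b" "\<And>t. t \<in> {a..b} \<Longrightarrow> norm (f t) \<le> B"
  shows "norm (integral {a..b} f) \<le> B * (b - a)"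
proof -
  have "norm (integral {a..b} f) \<le> integral {a..b} (\<lambda>_. B)"
    by (rule Henstock_Kurzweil_Integration.integral_norm_bound_integral) (use assms in auto)
  then show ?thesis using assms(2) by (simp add: mult.commute)
qed

lemma has_integral_inner_right:
  fixes f :: "real \<Rightarrow> 'a::euclidean_space"
  assumes "(f has_integral i) S"
  shows "((\<lambda>t. c \<bullet> f t) has_integral c \<bullet> i) S"
  using has_integral_linear[OF assms bounded_linear_inner_right] by (simp add: o_def)

lemma has_integral_inner_left:
  fixes f :: "real \<Rightarrow> 'a::euclidean_space"
  assumes "(f has_integral i) S"
  shows "((\<lambda>t. f t \<bullet> c) has_integral i \<bullet> c) S"
  using has_integral_inner_right[OF assms, of c] by (simp add: inner_commute)

text \<open>The map \<open>Y\<close> is differentiable only almost everywhere; instead of differentiating the product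
  one checks that the defect has quadratic increments.\<close>

lemma integration_by_parts_indefinite:
  fixes u :: "real \<Rightarrow> 'a::euclidean_space"
  assumes ab: "a \<le> b"
    and u: "u \<in> borel_measurable (lebesgue_on {a..b})" "\<And>t. t \<in> {a..b} \<Longrightarrow> norm (u t) \<le> R"
    and Y: "\<And>t. t \<in> {a..b} \<Longrightarrow> Y t = Y a + integral {a..t} u"
    and psi: "\<And>t. t \<in> {a..b} \<Longrightarrow> (\<psi> has_vector_derivative - \<phi> t) (at t within {a..b})"
    and phi: "continuous_on {a..b} \<phi>"
  shows "integral {a..b} (\<lambda>t. \<psi> t \<bullet> u t)
       = \<psi> b \<bullet> Y b - \<psi> a \<bullet> Y a + integral {a..b} (\<lambda>t. \<phi> t \<bullet> Y t)"
proof -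
  have "compact (\<phi> ` {a..b})" by (intro compact_continuous_image phi) auto
  then obtain L where L: "L > 0" "\<And>t. t \<in> {a..b} \<Longrightarrow> norm (\<phi> t) \<le> L"
    by (metis bounded_pos compact_imp_bounded imageI)
  have R: "0 \<le> R" using u(2)[of a] ab norm_ge_zero[of "u a"] by (auto simp del: norm_ge_zero intro: order_trans)
  have cpsi: "continuous_on {a..b} \<psi>"
    using psi by (meson continuous_on_vector_derivative)
  have us: "u \<in> borel_measurable (lebesgue_on {s..t})" if "a \<le> s" "t \<le> b" for s t
    by (rule measurable_restrict_mono[OF u(1)]) (use that in auto)
  have iu: "u integrable_on {s..t}" if "a \<le> s" "t \<le> b" for s t
    by (rule bounded_measurable_integrable_on[OF us[OF that], of R]) (use that u(2) in auto)
  have incY: "Y t - Y s = integral {s..t} u" if "a \<le> s" "s \<le> t" "t \<le> b" for s t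
    using Y[of t] Y[of s] that integral_split_interval[OF iu[of a t], of s] by auto
  have Ylip: "norm (Y t - Y s) \<le> R * (t - s)" if "a \<le> s" "s \<le> t" "t \<le> b" for s t
    unfolding incY[OF that] by (rule norm_integral_le_const) (use that iu u in auto)
  have cY: "continuous_on {a..b} Y"
  proof -
    have "continuous_on {a..b} (\<lambda>t. Y a + integral {a..t} u)"
      by (intro continuous_intros indefinite_integral_continuous_1 iu) auto
    then show ?thesis by (rule continuous_on_eq) (simp add: Y[symmetric])
  qed
  have inc\<psi>: "((\<lambda>t. - \<phi> t) has_integral (\<psi> t - \<psi> s)) {s..t}" if "a \<le> s" "s \<le> t" "t \<le> b" for s t
  proof (rule fundamental_theorem_of_calculus)
    fix z assume "z \<in> {s..t}"
    then show "(\<psi> has_vector_derivative - \<phi> z) (at z within {s..t})"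
      using that by (intro has_vector_derivative_within_subset[OF psi]) auto
  qed (use that in auto)
  have \<psi>lip: "norm (\<psi> t - \<psi> s) \<le> L * (t - s)" if "a \<le> s" "s \<le> t" "t \<le> b" for s t
  proof -
    have "norm (integral {s..t} (\<lambda>t. - \<phi> t)) \<le> L * (t - s)"
      by (rule norm_integral_le_const) (use that inc\<psi>[OF that] L in auto)
    then show ?thesis by (simp only: integral_unique[OF inc\<psi>[OF that]])
  qed
  have m\<psi>u: "(\<lambda>t. \<psi> t \<bullet> u t) integrable_on {s..t}" if "a \<le> s" "t \<le> b" for s t
  proof -
    have "compact (\<psi> ` {a..b})" by (intro compact_continuous_image cpsi) auto
    then obtain L' where L': "L' > 0" "\<And>t. t \<in> {a..b} \<Longrightarrow> norm (\<psi> t) \<le> L'"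
      by (metis bounded_pos compact_imp_bounded imageI)
    show ?thesis
    proof (rule bounded_measurable_integrable_on)
      have "continuous_on {s..t} \<psi>" using cpsi that by (auto elim!: continuous_on_subset)
      then show "(\<lambda>t. \<psi> t \<bullet> u t) \<in> borel_measurable (lebesgue_on {s..t})"
        by (intro borel_measurable_inner us that continuous_imp_measurable_on_sets_lebesgue) auto
      fix z assume "z \<in> {s..t}"
      then show "norm (\<psi> z \<bullet> u z) \<le> L' * R"
        using that L' u(2)[of z] R
        by (auto intro!: order_trans[OF Cauchy_Schwarz_ineq2] mult_mono)
    qed
  qed
  have i\<phi>Y: "(\<lambda>t. \<phi> t \<bullet> Y t) integrable_on {s..t}" if "a \<le> s" "t \<le> b" for s t
    by (intro integrable_continuous_real continuous_intros continuous_on_subset[OF phi] continuous_on_subset[OF cY])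
       (use that in auto)
  define G where "G t = integral {a..t} (\<lambda>t. \<psi> t \<bullet> u t) - \<psi> t \<bullet> Y t - integral {a..t} (\<lambda>t. \<phi> t \<bullet> Y t)" for t
  have "G b = G a"
  proof (rule quadratic_increments_imp_const[OF ab, where K="2 * L * R"])
    fix s t assume st: "a \<le> s" "s \<le> t" "t \<le> b"
    \<comment> \<open>The increment of the product is split as \<open>\<psi> t \<bullet> (Y t - Y s)
      + (\<psi> t - \<psi> s) \<bullet> Y s\<close>. Each of the two integrands then contains a
      difference of order \<open>t - s\<close>, so each integral is of order
      \<open>(t - s)^2\<close>.\<close>
    have A: "((\<lambda>z. \<psi> z \<bullet> u z - \<psi> t \<bullet> u z) has_integral
       (integral {s..t} (\<lambda>z. \<psi> z \<bullet> u z) - \<psi> t \<bullet> (Y t - Y s))) {s..t}"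
      unfolding incY[OF st]
      by (intro has_integral_diff integrable_integral m\<psi>u has_integral_inner_right integrable_integral[OF iu]) (use st in auto)
    have B: "((\<lambda>z. \<phi> z \<bullet> Y z + (- \<phi> z) \<bullet> Y s) has_integral
       (integral {s..t} (\<lambda>z. \<phi> z \<bullet> Y z) + (\<psi> t - \<psi> s) \<bullet> Y s)) {s..t}"
      by (intro has_integral_add integrable_integral i\<phi>Y has_integral_inner_left inc\<psi>) (use st in auto)
    have "norm (integral {s..t} (\<lambda>z. \<psi> z \<bullet> u z) - \<psi> t \<bullet> (Y t - Y s)) \<le> (L * (t - s) * R) * (t - s)"
      unfolding integral_unique[OF A, symmetric]
    proof (rule norm_integral_le_const)
      fix z assume z: "z \<in> {s..t}"
      have "norm (\<psi> z \<bullet> u z - \<psi> t \<bullet> u z) = \<bar>(\<psi> t - \<psi> z) \<bullet> u z\<bar>" by (simp add: inner_diff_left)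
      also have "\<dots> \<le> norm (\<psi> t - \<psi> z) * norm (u z)" by (rule Cauchy_Schwarz_ineq2)
      also have "\<dots> \<le> (L * (t - z)) * R" using z st \<psi>lip[of z t] u(2)[of z] L(1)
        by (intro mult_mono) auto
      also have "\<dots> \<le> (L * (t - s)) * R" using z L(1) R by (intro mult_right_mono mult_left_mono) auto
      finally show "norm (\<psi> z \<bullet> u z - \<psi> t \<bullet> u z) \<le> L * (t - s) * R" .
    qed (use A st in auto)
    moreover have "norm (integral {s..t} (\<lambda>z. \<phi> z \<bullet> Y z) + (\<psi> t - \<psi> s) \<bullet> Y s) \<le> (L * (R * (t - s))) * (t - s)"
      unfolding integral_unique[OF B, symmetric]
    proof (rule norm_integral_le_const)
      fix z assume z: "z \<in> {s..t}"
      have "norm (\<phi> z \<bullet> Y z + (- \<phi> z) \<bullet> Y s) = \<bar>\<phi> z \<bullet> (Y z - Y s)\<bar>" by (simp add: inner_diff_right)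
      also have "\<dots> \<le> norm (\<phi> z) * norm (Y z - Y s)" by (rule Cauchy_Schwarz_ineq2)
      also have "\<dots> \<le> L * (R * (z - s))" using z st Ylip[of s z] L
        by (intro mult_mono) auto
      also have "\<dots> \<le> L * (R * (t - s))" using z L(1) R by (intro mult_left_mono) auto
      finally show "norm (\<phi> z \<bullet> Y z + (- \<phi> z) \<bullet> Y s) \<le> L * (R * (t - s))" .
    qed (use B st in auto)
    moreover have "G t - G s = (integral {s..t} (\<lambda>z. \<psi> z \<bullet> u z) - \<psi> t \<bullet> (Y t - Y s))
        - (integral {s..t} (\<lambda>z. \<phi> z \<bullet> Y z) + (\<psi> t - \<psi> s) \<bullet> Y s)"
      using integral_split_interval[OF m\<psi>u[of a t], of s] integral_split_interval[OF i\<phi>Y[of a t], of s] st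
      by (simp add: G_def inner_diff_left inner_diff_right)
    ultimately show "\<bar>G t - G s\<bar> \<le> 2 * L * R * (t - s)\<^sup>2"
      by (simp add: power2_eq_square algebra_simps)
  qed
  then show ?thesis by (simp add: G_def)
qed

text \<open>The product rule for \<open>\<phi> \<bullet> x\<close> is added to integration by parts
  for \<open>\<psi> \<bullet> y\<close>; the mixed terms \<open>\<phi> \<bullet> y\<close> cancel.
  The source \<open>z\<close> is left free: it will be a trajectory when optimality is tested, and a
  difference of trajectories when two extremals are compared.\<close>

lemma adjoint_pairing:
  fixes u :: "real \<Rightarrow> 'a::euclidean_space"
  assumes ab: "a \<le> b"
    and u: "u \<in> borel_measurable (lebesgue_on {a..b})" "\<And>t. t \<in> {a..b} \<Longrightarrow> norm (u t) \<le> R"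
    and y: "\<And>t. t \<in> {a..b} \<Longrightarrow> y t = y a + integral {a..t} u"
    and x: "\<And>t. t \<in> {a..b} \<Longrightarrow> (x has_vector_derivative y t) (at t within {a..b})"
    and psi: "\<And>t. t \<in> {a..b} \<Longrightarrow> (\<psi> has_vector_derivative - \<phi> t) (at t within {a..b})"
    and phi: "\<And>t. t \<in> {a..b} \<Longrightarrow> (\<phi> has_vector_derivative z t) (at t within {a..b})"
    and z: "continuous_on {a..b} z"
  shows "integral {a..b} (\<lambda>t. z t \<bullet> x t) + integral {a..b} (\<lambda>t. \<psi> t \<bullet> u t)
       = (\<phi> b \<bullet> x b + \<psi> b \<bullet> y b) - (\<phi> a \<bullet> x a + \<psi> a \<bullet> y a)"
proof -
  have cphi: "continuous_on {a..b} \<phi>" using phi by (meson continuous_on_vector_derivative)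
  have cx: "continuous_on {a..b} x" using x by (meson continuous_on_vector_derivative)
  have iu: "u integrable_on {a..b}"
    by (rule bounded_measurable_integrable_on[OF u])
  have cy: "continuous_on {a..b} y"
  proof -
    have "continuous_on {a..b} (\<lambda>t. y a + integral {a..t} u)"
      by (intro continuous_intros indefinite_integral_continuous_1 iu)
    then show ?thesis by (rule continuous_on_eq) (simp add: y[symmetric])
  qed
  have "((\<lambda>t. \<phi> t \<bullet> y t + z t \<bullet> x t) has_integral (\<phi> b \<bullet> x b - \<phi> a \<bullet> x a)) {a..b}"
  proof (rule fundamental_theorem_of_calculus[OF ab])
    fix t assume t: "t \<in> {a..b}"
    show "((\<lambda>t. \<phi> t \<bullet> x t) has_vector_derivative \<phi> t \<bullet> y t + z t \<bullet> x t) (at t within {a..b})"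
      by (rule bounded_bilinear.has_vector_derivative[OF bounded_bilinear_inner phi[OF t] x[OF t]])
  qed
  then have "integral {a..b} (\<lambda>t. \<phi> t \<bullet> y t) + integral {a..b} (\<lambda>t. z t \<bullet> x t) = \<phi> b \<bullet> x b - \<phi> a \<bullet> x a"
    by (subst Henstock_Kurzweil_Integration.integral_add[symmetric])
       (auto intro!: integrable_continuous_real continuous_intros cphi cx cy z)
  moreover have "integral {a..b} (\<lambda>t. \<psi> t \<bullet> u t)
       = \<psi> b \<bullet> y b - \<psi> a \<bullet> y a + integral {a..b} (\<lambda>t. \<phi> t \<bullet> y t)"
    by (rule integration_by_parts_indefinite[OF ab u y psi cphi]) auto
  ultimately show ?thesis by simp
qed

subsection \<open>Admissible processes\<close>

abbreviation energy :: "(real \<Rightarrow> 'a::euclidean_space) \<Rightarrow> real \<Rightarrow> real \<Rightarrow> real" where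
  "energy x a b \<equiv> integral {a..b} (\<lambda>t. x t \<bullet> x t)"

lemma energy_integrable:
  fixes x :: "real \<Rightarrow> 'a::euclidean_space"
  assumes "continuous_on {a..b} x"
  shows "(\<lambda>t. x t \<bullet> x t) integrable_on {a..b}"
  by (intro integrable_continuous_real continuous_intros assms)

lemma energy_nonneg: "0 \<le> energy x a b"
  by (cases "(\<lambda>t. x t \<bullet> x t) integrable_on {a..b}")
     (auto intro: Henstock_Kurzweil_Integration.integral_nonneg simp: not_integrable_integral)

lemma cost_finite_horizon:
  assumes "continuous_on {0..b} x" "\<And>t. t > b \<Longrightarrow> x t = 0"
  shows "cost x = ennreal (energy x 0 b / 2)"
proof -
  have "cost x = (\<integral>\<^sup>+ t. ennreal (x t \<bullet> x t / 2) * indicator {0..b} t \<partial>lborel)"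
    unfolding cost_def by (intro nn_integral_cong) (use assms in \<open>auto simp: indicator_def not_le\<close>)
  also have "\<dots> = ennreal (energy x 0 b / 2)"
    by (intro nn_integral_has_integral_lebesgue' has_integral_divide integrable_integral
          energy_integrable assms) auto
  finally show ?thesis .
qed

lemma cost_ge:
  assumes "continuous_on {0..b} x"
  shows "ennreal (energy x 0 b / 2) \<le> cost x"
proof -
  have "ennreal (energy x 0 b / 2) = (\<integral>\<^sup>+ t. ennreal (x t \<bullet> x t / 2) * indicator {0..b} t \<partial>lborel)"
    by (intro nn_integral_has_integral_lebesgue'[symmetric] has_integral_divide integrable_integral
          energy_integrable assms) auto
  also have "\<dots> \<le> cost x"
    unfolding cost_def by (intro nn_integral_mono) (auto simp: indicator_def)
  finally show ?thesis .
qed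

lemma measurable_ident_lebesgue_on: "(\<lambda>t. t) \<in> borel_measurable (lebesgue_on {0::real..})"
  by (intro continuous_imp_measurable_on_sets_lebesgue continuous_intros) auto

lemma indefinite_integral_has_vector_derivative:
  fixes f :: "real \<Rightarrow> 'a::euclidean_space"
  assumes f: "continuous_on {0..} f" and F: "\<And>t. t \<ge> 0 \<Longrightarrow> F t = c + integral {0..t} f" and t: "t \<ge> 0"
  shows "(F has_vector_derivative f t) (at t within {0..})"
proof -
  have "((\<lambda>t. integral {0..t} f) has_vector_derivative f t) (at t within {0..t+1})"
    by (rule integral_has_vector_derivative) (use t in \<open>auto intro!: continuous_on_subset[OF f]\<close>)
  then have "((\<lambda>t. c + integral {0..t} f) has_vector_derivative f t) (at t within {0..t+1})"
    by (auto intro!: derivative_eq_intros)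
  moreover have "at t within {0..t+1} = at t within {0..}"
    by (rule at_within_nhd[where S="{..<t+1}"]) auto
  ultimately have "((\<lambda>t. c + integral {0..t} f) has_vector_derivative f t) (at t within {0..})" by simp
  then show ?thesis
    by (rule has_vector_derivative_transform[rotated 2]) (use t F in auto)
qed

text \<open>Continuing by 0 is consistent because \<open>P\<close> vanishes at the stopping time,
  and the jump of the integrand there is a single point. It serves twice: control to velocity, and
  velocity to position.\<close>

lemma stopped_has_integral:
  fixes P p :: "real \<Rightarrow> 'a::euclidean_space"
  assumes at: "a \<le> t" and s: "0 \<le> s"
    and P: "\<And>z. (P has_vector_derivative p z) (at z)" "P s = 0"
  shows "((\<lambda>z. if z < a + s then p (z - a) else 0) has_integral
      ((if t < a + s then P (t - a) else 0) - P 0)) {a..t}"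
proof -
  have der: "((\<lambda>z. P (z - a)) has_vector_derivative p (z - a)) (at z within S)" for z S
  proof -
    have "((\<lambda>z. z - a) has_vector_derivative 1) (at z within S)"
      by (auto intro!: derivative_eq_intros)
    from vector_diff_chain_within[OF this has_vector_derivative_at_within[OF P(1)]]
    show ?thesis by (simp add: o_def)
  qed
  have *: "((\<lambda>z. if z < a + s then p (z - a) else 0) has_integral (P (t - a) - P 0)) {a..t}"
    if t: "a \<le> t" "t \<le> a + s" for t
  proof (rule has_integral_spike_finite[of "{a+s}"])
    have "((\<lambda>z. p (z - a)) has_integral (P (t - a) - P (a - a))) {a..t}"
      by (rule fundamental_theorem_of_calculus[OF t(1) der])
    then show "((\<lambda>z. p (z - a)) has_integral (P (t - a) - P 0)) {a..t}" by simp
  qed (use t in auto)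
  show ?thesis
  proof (cases "t < a + s")
    case True then show ?thesis using *[OF at] by simp
  next
    case False
    have "((\<lambda>z. if z < a + s then p (z - a) else 0) has_integral 0) {a+s..t}"
      by (rule has_integral_is_0) auto
    then have "((\<lambda>z. if z < a + s then p (z - a) else 0) has_integral (P (a + s - a) - P 0 + 0)) {a..t}"
      by (intro has_integral_combine[OF _ _ *[of "a+s"]]) (use s False in auto)
    then show ?thesis using False P(2) by simp
  qed
qed

lemma concatenated_has_integral:
  fixes f g :: "real \<Rightarrow> 'a::euclidean_space"
  assumes "0 \<le> a" "a \<le> t" "(f has_integral i) {0..a}" "(g has_integral j) {a..t}"
  shows "((\<lambda>z. if z < a then f z else g z) has_integral (i + j)) {0..t}"
proof (rule has_integral_combine[of 0 a t])
  show "((\<lambda>z. if z < a then f z else g z) has_integral i) {0..a}"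
    by (rule has_integral_spike_finite[of "{a}", OF _ _ assms(3)]) auto
  show "((\<lambda>z. if z < a then f z else g z) has_integral j) {a..t}"
    using assms(4) by (rule has_integral_eq[rotated]) auto
qed (use assms in auto)

text \<open>The constants of all estimates depend on the control set only through the radii
  \<open>r\<close> and \<open>R\<close>. Since \<open>R\<close> is just an upper bound, it may be
  taken at least 1, which gives \<open>obs_time R <= 1\<close>.\<close>

locale control_set =
  fixes \<Omega> :: "U set" and r R :: real
  assumes convex: "convex \<Omega>" and closed: "closed \<Omega>"
    and r_pos: "0 < r" and ball: "cball 0 r \<subseteq> \<Omega>"
    and R_ge_1: "1 \<le> R" and bound: "\<And>v. v \<in> \<Omega> \<Longrightarrow> norm v \<le> R"
begin

lemma zero_in: "0 \<in> \<Omega>"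
  using ball r_pos by auto

lemma admissible_measurable:
  assumes "admissible \<Omega> x0 y0 x y u" "0 \<le> a"
  shows "u \<in> borel_measurable (lebesgue_on {a..b})"
  by (rule measurable_restrict_mono[of u lebesgue "{0..}"])
     (use assms in \<open>auto simp: admissible_def\<close>)

lemma admissible_bound:
  assumes "admissible \<Omega> x0 y0 x y u" "0 \<le> t"
  shows "u t \<in> \<Omega>" "norm (u t) \<le> R"
  using assms bound by (auto simp: admissible_def)

lemma admissible_integrable:
  assumes "admissible \<Omega> x0 y0 x y u" "0 \<le> a"
  shows "u integrable_on {a..b}"
  by (rule bounded_measurable_integrable_on[where B=R])
     (use assms in \<open>auto intro: admissible_measurable admissible_bound\<close>)

lemma admissible_init:
  assumes "admissible \<Omega> x0 y0 x y u"
  shows "x 0 = x0" "y 0 = y0"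
  using assms by (auto simp: admissible_def)

lemma admissible_increment:
  assumes "admissible \<Omega> x0 y0 x y u" "0 \<le> s" "s \<le> t"
  shows "y t = y s + integral {s..t} u"
proof -
  have "y s = y0 + integral {0..s} u" "y t = y0 + integral {0..t} u"
    using assms unfolding admissible_def by auto
  then show ?thesis
    using integral_split_interval[OF admissible_integrable[OF assms(1) order_refl, of t] assms(2,3)]
    by (simp add: algebra_simps)
qed

lemma lipschitz_integral_path:
  assumes u: "\<And>t. 0 \<le> t \<Longrightarrow> norm (u t) \<le> R" "\<And>t. u integrable_on {0..t}"
    and y: "\<And>t. t \<ge> 0 \<Longrightarrow> y t = y0 + integral {0..t} u"
    and x: "\<And>t. t \<ge> 0 \<Longrightarrow> x t = x0 + integral {0..t} y"
  shows "lip_deriv_path R x y"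
proof -
  have *: "norm (y t - y s) \<le> R * \<bar>t - s\<bar>" if "0 \<le> s" "s \<le> t" for s t
  proof -
    have "y t - y s = integral {s..t} u"
      using y[of s] y[of t] integral_split_interval[OF u(2)[of t] that] that by simp
    moreover have "norm (integral {s..t} u) \<le> R * (t - s)"
      by (rule norm_integral_le_const)
         (use that u in \<open>auto intro: integrable_subinterval_real[OF u(2)[of t]]\<close>)
    ultimately show ?thesis using that by simp
  qed
  have lip: "norm (y t - y s) \<le> R * \<bar>t - s\<bar>" if "0 \<le> s" "0 \<le> t" for s t
    using *[of s t] *[of t s] that by (cases "s \<le> t") (auto simp: norm_minus_commute abs_minus_commute)
  have "R-lipschitz_on {0..} y"
    using lip R_ge_1 unfolding lipschitz_on_def by (auto simp: dist_norm)
  then have "continuous_on {0..} y" by (rule lipschitz_on_continuous_on)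
  then show ?thesis
    unfolding lip_deriv_path_def using lip x
    by (auto intro: indefinite_integral_has_vector_derivative)
qed

lemma admissible_path:
  assumes "admissible \<Omega> x0 y0 x y u"
  shows "lip_deriv_path R x y"
proof (rule lipschitz_integral_path)
  show "norm (u t) \<le> R" if "0 \<le> t" for t by (rule admissible_bound(2)[OF assms that])
  show "u integrable_on {0..t}" for t by (rule admissible_integrable[OF assms order_refl])
  show "y t = y0 + integral {0..t} u" "x t = x0 + integral {0..t} y" if "0 \<le> t" for t
    using assms that by (simp_all add: admissible_def)
qed

lemmas admissible_continuous = lip_deriv_path_continuous[OF admissible_path]

lemma admissible_convex:
  assumes 1: "admissible \<Omega> x0 y0 x y u" and 2: "admissible \<Omega> x0 y0 x' y' u'" and l: "0 \<le> l" "l \<le> 1"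
  shows "admissible \<Omega> x0 y0 (\<lambda>t. (1 - l) *\<^sub>R x t + l *\<^sub>R x' t) (\<lambda>t. (1 - l) *\<^sub>R y t + l *\<^sub>R y' t)
     (\<lambda>t. (1 - l) *\<^sub>R u t + l *\<^sub>R u' t)"
proof -
  have int: "integral {0..t} (\<lambda>t. (1 - l) *\<^sub>R f t + l *\<^sub>R g t)
     = (1 - l) *\<^sub>R integral {0..t} f + l *\<^sub>R integral {0..t} g"
    if "f integrable_on {0..t}" "g integrable_on {0..t}" for t and f g :: "real \<Rightarrow> U"
    by (intro integral_unique has_integral_add has_integral_cmul integrable_integral that)
  have iy: "y integrable_on {0..t}" "y' integrable_on {0..t}" for t
    by (intro integrable_continuous_real admissible_continuous(4)[OF 1] admissible_continuous(4)[OF 2] order_refl)+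
  note iu = admissible_integrable[OF 1 order_refl] admissible_integrable[OF 2 order_refl]
  have split: "(1 - l) *\<^sub>R (c + i) + l *\<^sub>R (c + j) = c + ((1 - l) *\<^sub>R i + l *\<^sub>R j)" for c i j :: U
    by (simp add: algebra_simps)
  show ?thesis
    unfolding admissible_def
  proof (intro conjI allI impI)
    show "(\<lambda>t. (1 - l) *\<^sub>R u t + l *\<^sub>R u' t) \<in> borel_measurable (lebesgue_on {0..})"
      using 1 2 unfolding admissible_def by (intro borel_measurable_add borel_measurable_scaleR) auto
    show "(1 - l) *\<^sub>R u t + l *\<^sub>R u' t \<in> \<Omega>" if "t \<ge> 0" for t
      by (rule convexD[OF convex]) (use l that admissible_bound(1)[OF 1] admissible_bound(1)[OF 2] in auto)
    show "(1 - l) *\<^sub>R y t + l *\<^sub>R y' t = y0 + integral {0..t} (\<lambda>t. (1 - l) *\<^sub>R u t + l *\<^sub>R u' t)" if "t \<ge> 0" for t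
      unfolding int[OF iu]
      using 1 2 that split by (simp add: admissible_def)
    show "(1 - l) *\<^sub>R x t + l *\<^sub>R x' t = x0 + integral {0..t} (\<lambda>t. (1 - l) *\<^sub>R y t + l *\<^sub>R y' t)" if "t \<ge> 0" for t
      unfolding int[OF iy]
      using 1 2 that split by (simp add: admissible_def)
  qed
qed

subsection \<open>Steering to the origin\<close>

text \<open>Steering in time \<open>s = k * N\<close> takes a control of norm at most
  \<open>28 / k\<close>, where \<open>28 = (6 + 4) + (12 + 6)\<close> adds the coefficients of
  \<open>A\<close> and of \<open>s\<close> times \<open>B\<close> below. So
  \<open>k >= 28 / r\<close> keeps it in the ball of radius \<open>r\<close>; \<open>k >= 1\<close>
  allows \<open>1 / k^2\<close> to be replaced by \<open>1 / k\<close>.\<close>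

definition steer_time :: real where "steer_time = max 1 (28 / r)"
text \<open>The Taylor bound \<open>|x a| + s * |y a| + R * s^2\<close> for
  \<open>s = steer_time * N\<close>, divided by \<open>N^2\<close>.\<close>

definition steer_bound :: real where "steer_bound = 1 + steer_time + R * steer_time\<^sup>2"

lemma steer_time_ge_1: "1 \<le> steer_time"
  by (simp add: steer_time_def)

text \<open>The coefficients of the steering control are combinations of \<open>x / s^2\<close> and
  \<open>y / s\<close>, which have weight 0. Hence a duration proportional to \<open>N\<close> keeps
  the control bounded independently of \<open>N\<close>.\<close>

lemma steer:
  assumes adm: "admissible \<Omega> x0 y0 x y u" and a: "0 \<le> a"
  defines "N \<equiv> hnorm (x a) (y a)"
  obtains x' y' u' where "admissible \<Omega> x0 y0 x' y' u'"
    "\<And>t. 0 \<le> t \<Longrightarrow> t \<le> a \<Longrightarrow> x' t = x t" "\<And>t. 0 \<le> t \<Longrightarrow> t < a \<Longrightarrow> u' t = u t"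
    "\<And>t. a + steer_time * N \<le> t \<Longrightarrow> x' t = 0 \<and> y' t = 0"
    "\<And>t. a \<le> t \<Longrightarrow> t \<le> a + steer_time * N \<Longrightarrow> norm (x' t) \<le> steer_bound * N\<^sup>2"
proof -
  define k where "k = steer_time"
  have k: "k \<ge> 1" "28 \<le> r * k"
    using r_pos by (auto simp: k_def steer_time_def max_def field_simps)
  define s where "s = k * N"
  have N: "N \<ge> 0" by (simp add: N_def)
  have s0: "s \<ge> 0" using k N by (simp add: s_def)
  \<comment> \<open>\<open>P s = 0\<close> and \<open>Q s = 0\<close> are two linear equations for
    \<open>A\<close> and \<open>B\<close>, and this is their solution. If \<open>N = 0\<close>, then
    \<open>s = 0\<close> and the state at \<open>a\<close> is zero, so \<open>A\<close> and
    \<open>B\<close> vanish as well.\<close>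
  define A where "A = - (6 / s\<^sup>2) *\<^sub>R x a - (4 / s) *\<^sub>R y a"
  define B where "B = (12 / s^3) *\<^sub>R x a + (6 / s\<^sup>2) *\<^sub>R y a"
  define p where "p z = A + z *\<^sub>R B" for z
  define P where "P z = y a + z *\<^sub>R A + (z\<^sup>2 / 2) *\<^sub>R B" for z
  define Q where "Q z = x a + z *\<^sub>R y a + (z\<^sup>2 / 2) *\<^sub>R A + (z^3 / 6) *\<^sub>R B" for z
  have P': "(P has_vector_derivative p z) (at z)" for z
    unfolding P_def p_def by (auto intro!: derivative_eq_intros simp: has_real_derivative_iff_has_vector_derivative[symmetric])
  have Q': "(Q has_vector_derivative P z) (at z)" for z
    unfolding P_def Q_def by (auto intro!: derivative_eq_intros simp: has_real_derivative_iff_has_vector_derivative[symmetric])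
  have end0: "P s = 0 \<and> Q s = 0"
  proof (cases "N = 0")
    case True
    then have "x a = 0 \<and> y a = 0" by (simp add: N_def)
    then show ?thesis using True by (simp add: P_def Q_def s_def A_def B_def)
  next
    case False
    then have "s \<noteq> 0" using k by (simp add: s_def)
    have "P s = (s\<^sup>2 / 2 * (12 / s^3) - s * (6 / s\<^sup>2)) *\<^sub>R x a + (1 - s * (4 / s) + s\<^sup>2 / 2 * (6 / s\<^sup>2)) *\<^sub>R y a"
      by (simp add: P_def A_def B_def scaleR_add_left scaleR_add_right scaleR_diff_left scaleR_diff_right)
    also have "\<dots> = 0" using \<open>s \<noteq> 0\<close> by (simp add: power2_eq_square power3_eq_cube)
    finally have 1: "P s = 0" .
    have "Q s = (1 - s\<^sup>2 / 2 * (6 / s\<^sup>2) + s^3 / 6 * (12 / s^3)) *\<^sub>R x a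
        + (s - s\<^sup>2 / 2 * (4 / s) + s^3 / 6 * (6 / s\<^sup>2)) *\<^sub>R y a"
      by (simp add: Q_def A_def B_def scaleR_add_left scaleR_add_right scaleR_diff_left scaleR_diff_right)
    also have "\<dots> = 0" using \<open>s \<noteq> 0\<close> by (simp add: power2_eq_square power3_eq_cube)
    finally show ?thesis using 1 by simp
  qed
  define ug where "ug z = (if z < a + s then p (z - a) else 0)" for z
  define yg where "yg z = (if z < a + s then P (z - a) else 0)" for z
  define xg where "xg z = (if z < a + s then Q (z - a) else 0)" for z
  define u' where "u' z = (if z < a then u z else ug z)" for z
  define y' where "y' z = (if z < a then y z else yg z)" for z
  define x' where "x' z = (if z < a then x z else xg z)" for z
  have a_eq: "yg a = y a" "xg a = x a"
  proof -
    have "P 0 = y a" "Q 0 = x a" by (simp_all add: P_def Q_def)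
    then show "yg a = y a" "xg a = x a" using end0 s0 by (auto simp: yg_def xg_def)
  qed
  have ig: "(ug has_integral (yg t - y a)) {a..t}" "(yg has_integral (xg t - x a)) {a..t}" if "a \<le> t" for t
    using stopped_has_integral[OF that s0 P'] stopped_has_integral[OF that s0 Q'] end0
    by (simp_all add: ug_def[abs_def] yg_def[abs_def] xg_def P_def[of 0] Q_def[of 0])
  have "admissible \<Omega> x0 y0 x' y' u'"
    unfolding admissible_def
  proof (intro conjI allI impI)
    have [measurable]: "u \<in> borel_measurable (lebesgue_on {0..})" using adm by (simp add: admissible_def)
    note measurable_ident_lebesgue_on[measurable]
    show "u' \<in> borel_measurable (lebesgue_on {0..})"
      unfolding u'_def[abs_def] ug_def p_def by measurable
  next
    fix t :: real assume t: "t \<ge> 0"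
    show "u' t \<in> \<Omega>"
    proof (cases "t < a \<or> a + s \<le> t")
      case True then show ?thesis
        using admissible_bound(1)[OF adm t] zero_in by (auto simp: u'_def ug_def)
    next
      case False
      then have z: "0 \<le> t - a" "t - a < s" and s: "s > 0" by auto
      then have "N > 0" using N by (cases "N = 0") (auto simp: s_def)
      have xs: "norm (x a) / s\<^sup>2 \<le> 1 / k"
      proof -
        have "norm (x a) / s\<^sup>2 \<le> N\<^sup>2 / s\<^sup>2" by (intro divide_right_mono) (auto simp: N_def norm_le_hnorm)
        also have "\<dots> = 1 / k * (1 / k)" using \<open>N > 0\<close> k by (simp add: s_def power2_eq_square)
        also have "\<dots> \<le> 1 / k * 1" using k by (intro mult_left_mono) auto
        finally show ?thesis by simp
      qed
      have ys: "norm (y a) / s \<le> 1 / k"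
      proof -
        have "norm (y a) / s \<le> N / s" using s by (intro divide_right_mono) (auto simp: N_def norm_le_hnorm)
        also have "\<dots> = 1 / k" using \<open>N > 0\<close> k by (simp add: s_def)
        finally show ?thesis .
      qed
      have "norm A \<le> 6 * (norm (x a) / s\<^sup>2) + 4 * (norm (y a) / s)"
        unfolding A_def by (rule order_trans[OF norm_triangle_ineq4]) (use s in simp)
      moreover have "norm ((t - a) *\<^sub>R B) \<le> 12 * (norm (x a) / s\<^sup>2) + 6 * (norm (y a) / s)"
      proof -
        have "norm ((t - a) *\<^sub>R B) \<le> s * norm B" using z by (auto intro: mult_right_mono)
        also have "\<dots> \<le> s * (12 / s^3 * norm (x a) + 6 / s\<^sup>2 * norm (y a))"
          unfolding B_def by (intro mult_left_mono order_trans[OF norm_triangle_ineq]) (use s in auto)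
        also have "\<dots> = 12 * (norm (x a) / s\<^sup>2) + 6 * (norm (y a) / s)"
          using s by (simp add: distrib_left power2_eq_square power3_eq_cube)
        finally show ?thesis .
      qed
      ultimately have "norm (p (t - a)) \<le> 28 * (1 / k)"
        unfolding p_def using xs ys norm_triangle_ineq[of A "(t - a) *\<^sub>R B"] by argo
      also have "\<dots> \<le> r" using k by (simp add: field_simps)
      finally have "p (t - a) \<in> \<Omega>" using ball by auto
      then show ?thesis using False by (simp add: u'_def ug_def)
    qed
    show "y' t = y0 + integral {0..t} u'"
    proof (cases "t < a")
      case True
      then have "integral {0..t} u' = integral {0..t} u"
        by (intro Henstock_Kurzweil_Integration.integral_cong) (auto simp: u'_def)
      then show ?thesis using True adm t by (simp add: y'_def admissible_def)
    next
      case False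
      have "(u' has_integral (integral {0..a} u + (yg t - y a))) {0..t}"
        unfolding u'_def[abs_def] using False
        by (intro concatenated_has_integral a ig integrable_integral admissible_integrable[OF adm]) auto
      then show ?thesis using False adm a by (auto simp: y'_def admissible_def dest!: integral_unique)
    qed
    show "x' t = x0 + integral {0..t} y'"
    proof (cases "t < a")
      case True
      then have "integral {0..t} y' = integral {0..t} y"
        by (intro Henstock_Kurzweil_Integration.integral_cong) (auto simp: y'_def)
      then show ?thesis using True adm t by (simp add: x'_def admissible_def)
    next
      case False
      have "(y' has_integral (integral {0..a} y + (xg t - x a))) {0..t}"
        unfolding y'_def[abs_def] using False
        by (intro concatenated_has_integral a ig integrable_integral integrable_continuous_real
             admissible_continuous[OF adm]) auto
      then show ?thesis using False adm a by (auto simp: x'_def admissible_def dest!: integral_unique)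
    qed
  qed
  moreover have "x' t = x t" if "0 \<le> t" "t \<le> a" for t
    using that a_eq by (cases "t = a") (auto simp: x'_def)
  moreover have "u' t = u t" if "t < a" for t using that by (simp add: u'_def)
  moreover have "x' t = 0 \<and> y' t = 0" if "a + steer_time * N \<le> t" for t
    using that s0 by (auto simp: x'_def y'_def xg_def yg_def s_def k_def)
  moreover have "norm (x' t) \<le> steer_bound * N\<^sup>2" if t: "a \<le> t" "t \<le> a + steer_time * N" for t
  proof -
    have xa: "x' a = x a" "y' a = y a" using a_eq by (auto simp: x'_def y'_def)
    have ts: "0 \<le> t - a" "t - a \<le> k * N" using t by (auto simp: k_def)
    have "norm (x' t) = norm (x a + (t - a) *\<^sub>R y a + (x' t - x a - (t - a) *\<^sub>R y a))" by simp
    also have "\<dots> \<le> norm (x a) + norm ((t - a) *\<^sub>R y a) + norm (x' t - x a - (t - a) *\<^sub>R y a)"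
      by (intro order_trans[OF norm_triangle_ineq] add_right_mono norm_triangle_ineq)
    also have "norm (x' t - x a - (t - a) *\<^sub>R y a) \<le> R * (t - a)\<^sup>2"
      using lip_deriv_path_taylor[OF admissible_path[OF \<open>admissible \<Omega> x0 y0 x' y' u'\<close>] a t(1)] by (simp add: xa)
    also have "R * (t - a)\<^sup>2 \<le> R * (k * N)\<^sup>2"
      using ts R_ge_1 by (intro mult_left_mono power_mono) auto
    also have "norm ((t - a) *\<^sub>R y a) \<le> (k * N) * N"
      using ts k N by (auto simp: N_def intro!: mult_mono norm_le_hnorm)
    also have "norm (x a) \<le> N\<^sup>2" by (simp add: N_def norm_le_hnorm)
    finally show ?thesis by (simp add: steer_bound_def k_def power2_eq_square algebra_simps)
  qed
  ultimately show ?thesis using that by blast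
qed

end

subsection \<open>Finite extinction\<close>

text \<open>Laps of length \<open>k * W\<close> form a geometric series with sum at most
  \<open>k * W a / (1 - \<rho>)\<close>. The times \<open>s n\<close> are fixed beforehand, with
  \<open>\<rho> ^ n * W a\<close> in place of the actual value of \<open>W\<close>; monotonicity
  absorbs the difference.\<close>

lemma geometric_extinction:
  fixes W :: "real \<Rightarrow> real"
  assumes W0: "\<And>t. a \<le> t \<Longrightarrow> 0 \<le> W t"
    and mono: "\<And>s t. a \<le> s \<Longrightarrow> s \<le> t \<Longrightarrow> W t \<le> W s"
    and step: "\<And>t. a \<le> t \<Longrightarrow> W (t + k * W t) \<le> \<rho> * W t"
    and k: "0 \<le> k" and \<rho>: "0 \<le> \<rho>" "\<rho> < 1" and t: "a + k * W a / (1 - \<rho>) \<le> t"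
  shows "W t = 0"
proof -
  define s where "s n = a + k * W a * (1 - \<rho> ^ n) / (1 - \<rho>)" for n
  have \<rho>n: "0 \<le> \<rho> ^ n" "\<rho> ^ n \<le> 1" for n using \<rho> by (auto simp: power_le_one)
  have sa: "a \<le> s n" for n
    using \<rho> \<rho>n[of n] k W0[of a] by (auto simp: s_def)
  have Wn: "W (s n) \<le> \<rho> ^ n * W a" for n
  proof (induction n)
    case 0 then show ?case by (simp add: s_def)
  next
    case (Suc n)
    have "s (Suc n) = s n + k * (\<rho> ^ n * W a)"
    proof -
      have "(1 - \<rho> ^ Suc n) / (1 - \<rho>) = (1 - \<rho> ^ n) / (1 - \<rho>) + \<rho> ^ n"
        using \<rho> by (simp add: field_simps)
      then show ?thesis unfolding s_def
        by (simp only: times_divide_eq_right[symmetric] distrib_left) (simp add: mult_ac)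
    qed
    then have "s n + k * W (s n) \<le> s (Suc n)" using Suc k by (simp add: mult_left_mono)
    then have "W (s (Suc n)) \<le> W (s n + k * W (s n))"
      using add_increasing2[OF mult_nonneg_nonneg[OF k W0[OF sa[of n]]] sa[of n]] by (intro mono) auto
    also have "\<dots> \<le> \<rho> * W (s n)" by (rule step[OF sa])
    also have "\<dots> \<le> \<rho> * (\<rho> ^ n * W a)" using Suc \<rho> by (intro mult_left_mono) auto
    finally show ?case by simp
  qed
  have "W t \<le> \<rho> ^ n * W a" for n
  proof -
    have "s n \<le> a + k * W a / (1 - \<rho>)"
      unfolding s_def using \<rho> \<rho>n[of n] k W0[of a]
      by (intro add_left_mono divide_right_mono) (auto intro!: mult_left_le)
    then have "W t \<le> W (s n)" using t sa by (intro mono) auto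
    then show ?thesis using Wn[of n] by simp
  qed
  moreover have "(\<lambda>n. \<rho> ^ n * W a) \<longlonglongrightarrow> 0 * W a"
    by (intro tendsto_mult LIMSEQ_realpow_zero tendsto_const) (use \<rho> in auto)
  ultimately have "W t \<le> 0 * W a" by (intro LIMSEQ_le_const) auto
  moreover have "0 \<le> W t"
  proof (rule W0)
    have "0 \<le> k * W a / (1 - \<rho>)" using \<rho> k W0[of a] by simp
    then show "a \<le> t" using t by linarith
  qed
  ultimately show ?thesis by simp
qed

context control_set
begin

text \<open>\<open>cost_const\<close> is duration times squared size of the steering phase. A lap
  multiplies the remaining cost by at most \<open>1 - obs_const R / cost_const\<close>, and
  \<open>decay\<close> is the fifth root of that factor; its \<open>max 0\<close> spares a
  comparison of the two constants. \<open>extinction_const\<close> sums the geometric series of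
  laps.\<close>

definition cost_const :: real where "cost_const = steer_time * steer_bound\<^sup>2"
definition decay :: real where "decay = root 5 (max 0 (1 - obs_const R / cost_const))"
definition extinction_const :: real where
  "extinction_const = obs_time R * root 5 (cost_const / obs_const R) / (1 - decay)"

lemma steer_bound_pos: "0 < steer_bound"
proof -
  have "0 \<le> R * steer_time\<^sup>2" using R_ge_1 by simp
  then show ?thesis using steer_time_ge_1 by (simp add: steer_bound_def)
qed

lemma cost_const_pos: "0 < cost_const"
  using steer_bound_pos steer_time_ge_1 by (simp add: cost_const_def)

lemma decay_bounds: "0 \<le> decay" "decay < 1"
proof -
  have "0 < obs_const R / cost_const" using obs_pos[OF R_ge_1] cost_const_pos by simp
  then have m: "max 0 (1 - obs_const R / cost_const) < 1" by simp
  show "0 \<le> decay" unfolding decay_def by (rule real_root_ge_zero) simp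
  show "decay < 1"
    unfolding decay_def using real_root_less_mono[OF _ m, of 5] by simp
qed

lemma extinction_const_pos: "0 < extinction_const"
  unfolding extinction_const_def
  by (intro divide_pos_pos mult_pos_pos real_root_gt_zero)
     (use obs_pos[OF R_ge_1] cost_const_pos decay_bounds in auto)

text \<open>The competitor follows the trajectory up to \<open>a\<close> and is steered to the
  origin from there. Keeping the total cost on the left avoids a separate dynamic programming
  principle for the tail.\<close>

lemma optimal_cost_bound:
  assumes adm: "admissible \<Omega> x0 y0 x y u" and opt: "optimal \<Omega> x0 y0 x y" and a: "0 \<le> a"
  shows "cost x \<le> ennreal ((energy x 0 a + cost_const * hnorm (x a) (y a) ^ 5) / 2)"
proof -
  define N where "N = hnorm (x a) (y a)"
  obtain x' y' u' where adm': "admissible \<Omega> x0 y0 x' y' u'"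
    and eq: "\<And>t. 0 \<le> t \<Longrightarrow> t \<le> a \<Longrightarrow> x' t = x t"
    and z: "\<And>t. a + steer_time * N \<le> t \<Longrightarrow> x' t = 0 \<and> y' t = 0"
    and bd: "\<And>t. a \<le> t \<Longrightarrow> t \<le> a + steer_time * N \<Longrightarrow> norm (x' t) \<le> steer_bound * N\<^sup>2"
    by (rule steer[OF adm a, folded N_def]) (rule that)
  define b where "b = a + steer_time * N"
  have ab: "a \<le> b" using steer_time_ge_1 by (simp add: b_def N_def)
  have c': "continuous_on {c..b} x'" if "c \<ge> 0" for c by (rule admissible_continuous(2)[OF adm' that])
  have "energy x' 0 b = energy x' 0 a + energy x' a b"
    using integral_split_interval[OF energy_integrable[OF c'] a ab] by simp
  also have "energy x' 0 a = energy x 0 a"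
    by (rule Henstock_Kurzweil_Integration.integral_cong) (simp add: eq)
  also have "energy x' a b \<le> (steer_bound * N\<^sup>2)\<^sup>2 * (b - a)"
  proof -
    have "norm (energy x' a b) \<le> (steer_bound * N\<^sup>2)\<^sup>2 * (b - a)"
    proof (rule norm_integral_le_const[OF energy_integrable[OF c'[OF a]] ab])
      fix t assume "t \<in> {a..b}"
      then have "(norm (x' t))\<^sup>2 \<le> (steer_bound * N\<^sup>2)\<^sup>2"
        by (intro power_mono bd) (auto simp: b_def)
      then show "norm (x' t \<bullet> x' t) \<le> (steer_bound * N\<^sup>2)\<^sup>2" by (simp add: power2_norm_eq_inner)
    qed
    then show ?thesis by simp
  qed
  also have "(steer_bound * N\<^sup>2)\<^sup>2 * (b - a) = cost_const * N ^ 5"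
    by (simp add: b_def cost_const_def power2_eq_square eval_nat_numeral)
  finally have E: "energy x' 0 b \<le> energy x 0 a + cost_const * N ^ 5" by simp
  have "cost x \<le> cost x'" using opt adm' by (auto simp: optimal_def)
  also have "\<dots> = ennreal (energy x' 0 b / 2)"
    by (rule cost_finite_horizon[OF c'[OF order_refl]]) (use z in \<open>auto simp: b_def\<close>)
  also have "\<dots> \<le> ennreal ((energy x 0 a + cost_const * N ^ 5) / 2)"
    using E by (intro ennreal_leI) simp
  finally show ?thesis by (simp add: N_def)
qed

text \<open>The starting time \<open>a\<close> is free on purpose. \<open>a = 0\<close> bounds the
  extinction time by the initial state, a zero of the state shows that the trajectory stays at the
  origin, and the extinction time of another trajectory yields continuity.\<close>

lemma optimal_extinction:
  assumes adm: "admissible \<Omega> x0 y0 x y u" and opt: "optimal \<Omega> x0 y0 x y" and a: "0 \<le> a"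
    and t: "a + extinction_const * hnorm (x a) (y a) \<le> t"
  shows "x t = 0" "y t = 0"
proof -
  define N where "N s = hnorm (x s) (y s)" for s
  define c where "c = obs_const R"
  define k where "k = obs_time R"
  define C where "C = cost_const"
  have pos: "c > 0" "k > 0" "C > 0"
    using obs_pos[OF R_ge_1] cost_const_pos by (auto simp: c_def k_def C_def)
  have N0: "0 \<le> N s" for s by (simp add: N_def)
  note path = admissible_path[OF adm]
  have ub: "cost x \<le> ennreal ((energy x 0 s + C * N s ^ 5) / 2)" if "0 \<le> s" for s
    unfolding N_def C_def by (rule optimal_cost_bound[OF adm opt that])
  define m where "m = enn2real (cost x)"
  have fin: "cost x = ennreal m"
  proof -
    have "cost x < top" using ub[OF order_refl] ennreal_less_top le_less_trans by blast
    then show ?thesis by (simp add: m_def)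
  qed
  have m0: "0 \<le> m" by (simp add: m_def)
  have Cx: "continuous_on {0..s} x" for s by (rule admissible_continuous(2)[OF adm order_refl])
  \<comment> \<open>Twice the cost remaining after \<open>s\<close>, written as a difference so that
    no integral over an unbounded interval occurs.\<close>
  define V where "V s = 2 * m - energy x 0 s" for s
  have V0: "0 \<le> V s" for s
    using cost_ge[OF Cx[of s]] m0 by (simp add: fin V_def)
  have VC: "V s \<le> C * N s ^ 5" if "0 \<le> s" for s
  proof -
    have "0 \<le> (energy x 0 s + C * N s ^ 5) / 2"
      using pos N0[of s] by (intro divide_nonneg_pos add_nonneg_nonneg energy_nonneg mult_nonneg_nonneg) auto
    then have "m \<le> (energy x 0 s + C * N s ^ 5) / 2"
      using ub[OF that] by (simp add: fin)
    then show ?thesis by (simp add: V_def)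
  qed
  have Vdiff: "V s - V s' = energy x s s'" if "0 \<le> s" "s \<le> s'" for s s'
    using integral_split_interval[OF energy_integrable[OF Cx] that] by (simp add: V_def)
  have Vmono: "V s' \<le> V s" if "0 \<le> s" "s \<le> s'" for s s'
    using Vdiff[OF that] energy_nonneg[of s s' x] by simp
  have Vdrop: "c * N s ^ 5 \<le> V s - V (s + k * N s)" if "0 \<le> s" for s
  proof -
    have "s \<le> s + k * N s" using pos N0 by simp
    then show ?thesis
      using observability[OF path R_ge_1 that, of "s + k * N s"]
      by (simp add: Vdiff[OF that] c_def k_def N_def)
  qed
  have cN: "c * N s ^ 5 \<le> V s" if "0 \<le> s" for s using Vdrop[OF that] V0[of "s + k * N s"] by simp
  \<comment> \<open>Because \<open>N s <= W s\<close>, a lap of length \<open>k * W s\<close>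
    contains the observation window of length \<open>k * N s\<close>. The decay can therefore be
    stated for \<open>W\<close>, which is monotone while \<open>N\<close> need not be.\<close>
  define W where "W s = root 5 (V s / c)" for s
  have NW: "N s \<le> W s" if "0 \<le> s" for s
  proof -
    have "N s = root 5 (N s ^ 5)" using N0 by (simp add: real_root_power_cancel)
    also have "\<dots> \<le> W s" unfolding W_def using cN[OF that] pos by (simp add: field_simps)
    finally show ?thesis .
  qed
  have "W t = 0"
  proof (rule geometric_extinction[where a=a and W=W and k=k and \<rho>=decay])
    show "0 \<le> W s" for s using V0[of s] pos by (simp add: W_def)
    show "W s' \<le> W s" if "a \<le> s" "s \<le> s'" for s s'
      using Vmono[of s s'] that a pos by (simp add: W_def divide_right_mono)
    show "W (s + k * W s) \<le> decay * W s" if "a \<le> s" for s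
    proof -
      have s: "0 \<le> s" using that a by simp
      have "V (s + k * W s) \<le> V (s + k * N s)"
        using NW[OF s] pos s N0[of s] by (intro Vmono) auto
      also have "\<dots> \<le> V s - c * N s ^ 5" using Vdrop[OF s] by simp
      also have "\<dots> \<le> V s - c * (V s / C)"
        using VC[OF s] pos by (simp add: field_simps)
      also have "\<dots> = (1 - c / C) * V s" by (simp add: algebra_simps)
      also have "\<dots> \<le> max 0 (1 - c / C) * V s" using V0 by (intro mult_right_mono) auto
      finally have "V (s + k * W s) / c \<le> max 0 (1 - c / C) * (V s / c)"
        using pos by (simp add: divide_right_mono)
      then have "W (s + k * W s) \<le> root 5 (max 0 (1 - c / C) * (V s / c))"
        unfolding W_def[of "s + k * W s"] by simp
      also have "\<dots> = decay * W s"
        by (simp only: real_root_mult W_def decay_def c_def C_def)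
      finally show ?thesis .
    qed
    have "W a \<le> root 5 (C / c) * N a"
    proof -
      have "W a \<le> root 5 (C / c * N a ^ 5)"
        unfolding W_def using VC[OF a] pos by (simp add: field_simps)
      also have "\<dots> = root 5 (C / c) * N a"
        unfolding real_root_mult by (simp add: real_root_power_cancel N0)
      finally show ?thesis .
    qed
    then have "k * W a / (1 - decay) \<le> k * (root 5 (C / c) * N a) / (1 - decay)"
      using pos decay_bounds by (intro divide_right_mono mult_left_mono) auto
    also have "\<dots> = extinction_const * N a" by (simp add: extinction_const_def k_def C_def c_def)
    finally show "a + k * W a / (1 - decay) \<le> t" using t by (simp add: N_def)
  qed (use pos decay_bounds in auto)
  have "0 \<le> extinction_const * N a" using extinction_const_pos N0[of a] by simp
  then have t0: "0 \<le> t" using t a by (simp add: N_def)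
  have "V t = 0" using \<open>W t = 0\<close> pos by (simp add: W_def)
  then have "N t ^ 5 \<le> 0" using cN[OF t0] pos by (simp add: mult_le_0_iff)
  then have "N t = 0" using N0[of t] by (metis le_less not_le zero_less_power)
  then show "x t = 0" "y t = 0" by (simp_all add: N_def)
qed

subsection \<open>Variational inequality and uniqueness\<close>

text \<open>On the segment from \<open>x\<close> to \<open>x'\<close> the cost is quadratic in the
  parameter, and the integral is its linear coefficient up to a factor. Were it negative, a small
  step would improve on \<open>x\<close>. Extinction of both curves turns the costs into integrals
  over \<open>{0..b}\<close>.\<close>

lemma optimal_variational_inequality:
  assumes adm: "admissible \<Omega> x0 y0 x y u" and opt: "optimal \<Omega> x0 y0 x y"
    and adm': "admissible \<Omega> x0 y0 x' y' u'"
    and z: "\<And>t. t > b \<Longrightarrow> x t = 0" "\<And>t. t > b \<Longrightarrow> x' t = 0"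
  shows "0 \<le> integral {0..b} (\<lambda>t. x t \<bullet> (x' t - x t))"
proof (rule ccontr)
  define I where "I = integral {0..b} (\<lambda>t. x t \<bullet> (x' t - x t))"
  define D where "D = energy (\<lambda>t. x' t - x t) 0 b"
  assume "\<not> 0 \<le> integral {0..b} (\<lambda>t. x t \<bullet> (x' t - x t))"
  then have I: "I < 0" by (simp add: I_def)
  have D: "D \<ge> 0" by (simp add: D_def energy_nonneg)
  \<comment> \<open>The step satisfies \<open>l * D < - I\<close>, hence
    \<open>2 * I + l * D < 0\<close>; the \<open>+ 1\<close> prevents a zero denominator.\<close>
  define l where "l = min 1 (- I / (D + 1))"
  have l: "0 < l" "l \<le> 1" using I D by (auto simp: l_def divide_neg_pos)
  have "l \<le> - I / (D + 1)" by (simp add: l_def)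
  then have l3: "l * (D + 1) \<le> - I" using D by (subst (asm) pos_le_divide_eq) auto
  define xl where "xl t = (1 - l) *\<^sub>R x t + l *\<^sub>R x' t" for t
  note adml = admissible_convex[OF adm adm' less_imp_le[OF l(1)] l(2), folded xl_def[abs_def]]
  note c = admissible_continuous(2)[OF adm order_refl, of b]
    and c' = admissible_continuous(2)[OF adm' order_refl, of b]
    and cl = admissible_continuous(2)[OF adml order_refl, of b, folded xl_def[abs_def]]
  have "((\<lambda>t. x t \<bullet> x t + (2 * l) * (x t \<bullet> (x' t - x t)) + l\<^sup>2 * ((x' t - x t) \<bullet> (x' t - x t)))
     has_integral (energy x 0 b + (2 * l) * I + l\<^sup>2 * D)) {0..b}"
    unfolding I_def D_def
    by (intro has_integral_add has_integral_mult_right integrable_integral integrable_continuous_real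
        continuous_intros c c')
  also have "(\<lambda>t. x t \<bullet> x t + (2 * l) * (x t \<bullet> (x' t - x t)) + l\<^sup>2 * ((x' t - x t) \<bullet> (x' t - x t)))
    = (\<lambda>t. xl t \<bullet> xl t)"
  proof
    fix t
    have "xl t = x t + l *\<^sub>R (x' t - x t)" by (simp add: xl_def algebra_simps)
    then show "x t \<bullet> x t + (2 * l) * (x t \<bullet> (x' t - x t)) + l\<^sup>2 * ((x' t - x t) \<bullet> (x' t - x t)) = xl t \<bullet> xl t"
      by (simp add: inner_add_left inner_add_right inner_commute power2_eq_square distrib_left
         del: inner_diff_left inner_diff_right)
  qed
  finally have E: "energy xl 0 b = energy x 0 b + (2 * l) * I + l\<^sup>2 * D" by (rule integral_unique)
  have "cost x \<le> cost xl" using opt adml unfolding optimal_def xl_def[abs_def] by blast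
  moreover have "cost x = ennreal (energy x 0 b / 2)"
    by (rule cost_finite_horizon[OF c z(1)])
  moreover have "cost xl = ennreal (energy xl 0 b / 2)"
    by (rule cost_finite_horizon[OF cl]) (simp add: xl_def z)
  ultimately have "energy x 0 b \<le> energy xl 0 b"
    using energy_nonneg[of 0 b xl] by simp
  then have "0 \<le> l * (2 * I + l * D)" by (simp add: E power2_eq_square algebra_simps)
  then have "0 \<le> 2 * I + l * D" using l(1) by (simp add: zero_le_mult_iff)
  then show False using l(1) l3 I by (simp add: algebra_simps)
qed

text \<open>Observability applied to the difference, whose velocity has Lipschitz constant
  \<open>R + R\<close>. The observation window may extend beyond \<open>b\<close>, but the
  difference vanishes there, so the integral can be cut at \<open>b\<close>.\<close>

lemma path_difference_bound:
  assumes adm: "admissible \<Omega> x0 y0 x y u" and adm': "admissible \<Omega> x0' y0' x' y' u'"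
    and z: "\<And>t. t > b \<Longrightarrow> x t = 0" "\<And>t. t > b \<Longrightarrow> x' t = 0" and t: "0 \<le> t"
  shows "obs_const (R + R) * hnorm (x t - x' t) (y t - y' t) ^ 5 \<le> energy (\<lambda>t. x t - x' t) t b"
proof -
  note path = lip_deriv_path_diff[OF admissible_path[OF adm] admissible_path[OF adm']]
  define d where "d = max b (t + obs_time (R + R) * hnorm (x t - x' t) (y t - y' t))"
  have "obs_const (R + R) * hnorm (x t - x' t) (y t - y' t) ^ 5 \<le> energy (\<lambda>t. x t - x' t) t d"
    by (rule observability[OF path _ t]) (use R_ge_1 in \<open>auto simp: d_def\<close>)
  also have "\<dots> = energy (\<lambda>t. x t - x' t) t b"
  proof (rule integral_spike_set; rule negligible_subset[OF negligible_empty])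
    have "x s - x' s = 0" if "s > b" for s using z[OF that] by simp
    then show "{s \<in> {t..d} - {t..b}. (x s - x' s) \<bullet> (x s - x' s) \<noteq> 0} \<subseteq> {}" by force
  qed (auto simp: d_def)
  finally show ?thesis .
qed

lemma path_difference_bound_0:
  assumes adm: "admissible \<Omega> x0 y0 x y u" and adm': "admissible \<Omega> x0' y0' x' y' u'"
    and z: "\<And>t. t > b \<Longrightarrow> x t = 0" "\<And>t. t > b \<Longrightarrow> x' t = 0" and t: "0 \<le> t"
  shows "obs_const (R + R) * hnorm (x t - x' t) (y t - y' t) ^ 5 \<le> energy (\<lambda>t. x t - x' t) 0 b"
proof -
  note path = lip_deriv_path_diff[OF admissible_path[OF adm] admissible_path[OF adm']]
  have "energy (\<lambda>t. x t - x' t) t b \<le> energy (\<lambda>t. x t - x' t) 0 b"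
    by (intro integral_subset_le energy_integrable lip_deriv_path_continuous(2)[OF path]) (use t in auto)
  moreover have "obs_const (R + R) * hnorm (x t - x' t) (y t - y' t) ^ 5 \<le> energy (\<lambda>t. x t - x' t) t b"
    by (rule path_difference_bound[OF adm adm' z t])
  ultimately show ?thesis by simp
qed

lemma obs_const_2R_pos: "0 < obs_const (R + R)"
  using obs_pos(2)[of "R + R"] R_ge_1 by simp

lemma optimal_vanishes:
  assumes "admissible \<Omega> x0 y0 x y u" "optimal \<Omega> x0 y0 x y" "extinction_const * hnorm x0 y0 \<le> t"
  shows "x t = 0" "y t = 0"
  using optimal_extinction[OF assms(1,2) order_refl, of t] assms(3) admissible_init[OF assms(1)] by auto

text \<open>Testing each optimal trajectory against the other and adding the two inequalities shows
  that the integral of \<open>|x - x'|^2\<close> is at most 0.\<close>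

lemma optimal_unique:
  assumes opt: "optimal \<Omega> x0 y0 x y" and opt': "optimal \<Omega> x0 y0 x' y'" and t: "0 \<le> t"
  shows "x t = x' t" "y t = y' t"
proof -
  obtain u u' where adm: "admissible \<Omega> x0 y0 x y u" and adm': "admissible \<Omega> x0 y0 x' y' u'"
    using opt opt' by (auto simp: optimal_def)
  define b where "b = extinction_const * hnorm x0 y0"
  have z: "\<And>t. t > b \<Longrightarrow> x t = 0" "\<And>t. t > b \<Longrightarrow> x' t = 0"
    using optimal_vanishes[OF adm opt] optimal_vanishes[OF adm' opt'] by (auto simp: b_def)
  note c = admissible_continuous(2)[OF adm order_refl, of b]
    and c' = admissible_continuous(2)[OF adm' order_refl, of b]
  have i1: "0 \<le> integral {0..b} (\<lambda>t. x t \<bullet> (x' t - x t))"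
    by (rule optimal_variational_inequality[OF adm opt adm' z])
  have i2: "0 \<le> integral {0..b} (\<lambda>t. x' t \<bullet> (x t - x' t))"
    by (rule optimal_variational_inequality[OF adm' opt' adm z(2,1)])
  have "((\<lambda>t. - (x t \<bullet> (x' t - x t) + x' t \<bullet> (x t - x' t))) has_integral
      - (integral {0..b} (\<lambda>t. x t \<bullet> (x' t - x t)) + integral {0..b} (\<lambda>t. x' t \<bullet> (x t - x' t)))) {0..b}"
    by (intro has_integral_neg has_integral_add integrable_integral integrable_continuous_real
        continuous_intros c c')
  also have "(\<lambda>t. - (x t \<bullet> (x' t - x t) + x' t \<bullet> (x t - x' t))) = (\<lambda>t. (x t - x' t) \<bullet> (x t - x' t))"
    by (simp add: fun_eq_iff inner_diff_left inner_diff_right inner_commute)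
  finally have "energy (\<lambda>t. x t - x' t) 0 b \<le> 0"
    using i1 i2 by (auto dest!: integral_unique)
  then have "obs_const (R + R) * hnorm (x t - x' t) (y t - y' t) ^ 5 \<le> 0"
    using order_trans[OF path_difference_bound_0[OF adm adm' z t]] by simp
  then have "hnorm (x t - x' t) (y t - y' t) = 0"
    using obs_const_2R_pos hnorm_nonneg[of "x t - x' t" "y t - y' t"]
    by (metis le_less mult_pos_pos not_le zero_less_power)
  then show "x t = x' t" "y t = y' t" by simp_all
qed

end

subsection \<open>Existence of optimal processes\<close>

text \<open>Elements of nearly minimal \<open>L\<^sup>2\<close> norm in a decreasing sequence of convex sets form, by the
  parallelogram law, a Cauchy sequence in \<open>L\<^sup>2\<close>. This replaces weak compactness.\<close>

lemma nested_convex_AE_convergent: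
  fixes K :: "nat \<Rightarrow> ('a \<Rightarrow> 'b::euclidean_space) set"
  assumes fin: "finite_measure M" and ne: "\<And>n. K n \<noteq> {}"
    and dec: "\<And>m n. m \<le> n \<Longrightarrow> K n \<subseteq> K m"
    and mid: "\<And>n f g. f \<in> K n \<Longrightarrow> g \<in> K n \<Longrightarrow> (\<lambda>t. (1/2) *\<^sub>R f t + (1/2) *\<^sub>R g t) \<in> K n"
    and meas: "\<And>f. f \<in> K 0 \<Longrightarrow> f \<in> borel_measurable M"
    and bd: "\<And>f t. f \<in> K 0 \<Longrightarrow> t \<in> space M \<Longrightarrow> norm (f t) \<le> R"
  obtains f where "\<And>n. f n \<in> K n" "AE t in M. convergent (\<lambda>n. f n t)"
proof -
  interpret finite_measure M by (rule fin)
  define \<mu> where "\<mu> = measure M (space M)"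
  define Q where "Q f = (\<integral>t. f t \<bullet> f t \<partial>M)" for f :: "'a \<Rightarrow> 'b"
  have K0: "f \<in> K 0" if "f \<in> K n" for f n using dec[of 0 n] that by auto
  have sq: "norm (f t \<bullet> f t) \<le> R\<^sup>2" if "f \<in> K 0" "t \<in> space M" for f t
    using power_mono[OF bd[OF that] norm_ge_zero, of 2] by (simp add: power2_norm_eq_inner)
  have int: "integrable M (\<lambda>t. f t \<bullet> f t)" if "f \<in> K 0" for f
    by (rule integrable_const_bound[where B="R\<^sup>2"])
       (use sq[OF that] meas[OF that] in \<open>auto intro!: AE_I2\<close>)
  have Q0: "0 \<le> Q f" for f unfolding Q_def by (rule Bochner_Integration.integral_nonneg) simp
  have QB: "Q f \<le> R\<^sup>2 * \<mu>" if "f \<in> K 0" for f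
  proof -
    have "Q f \<le> (\<integral>t. R\<^sup>2 \<partial>M)"
      unfolding Q_def by (rule integral_mono[OF int[OF that]]) (use sq[OF that] in auto)
    then show ?thesis by (simp add: \<mu>_def mult.commute)
  qed
  define d where "d n = (INF f\<in>K n. Q f)" for n
  have bb: "bdd_below (Q ` K n)" for n using Q0 by (auto intro!: bdd_belowI)
  have dQ: "d n \<le> Q f" if "f \<in> K n" for f n
    unfolding d_def by (rule cINF_lower[OF bb that])
  have dB: "d n \<le> R\<^sup>2 * \<mu>" for n
  proof -
    obtain f where "f \<in> K n" using ne[of n] by auto
    then show ?thesis using dQ QB[OF K0] by (meson order_trans)
  qed
  \<comment> \<open>The infima \<open>d n\<close> increase to \<open>D\<close>. Next,
    \<open>f k\<close> is taken within \<open>4^-k\<close> of the infimum at a level whose infimum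
    is within \<open>4^-k\<close> of \<open>D\<close>; the rate leaves room for a factor
    \<open>2^k\<close> lost in passing from mean squares to means.\<close>
  define D where "D = (SUP n. d n)"
  have ba: "bdd_above (range d)" using dB by (auto intro!: bdd_aboveI)
  have dD: "d n \<le> D" for n unfolding D_def by (rule cSUP_upper[OF UNIV_I ba])
  have dmono: "d m \<le> d n" if "m \<le> n" for m n
    unfolding d_def by (rule cINF_superset_mono[OF ne bb dec[OF that]]) simp
  have "\<exists>n f. k \<le> n \<and> D - 1 / 4 ^ k < d n \<and> f \<in> K n \<and> Q f < d n + 1 / 4 ^ k" for k
  proof -
    have "D - 1 / 4 ^ k < D" by simp
    then obtain n where n: "D - 1 / 4 ^ k < d n"
      unfolding D_def using less_cSUP_iff[OF UNIV_not_empty ba] by blast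
    have "(INF f\<in>K (max k n). Q f) < d (max k n) + 1 / 4 ^ k" by (simp add: d_def)
    then obtain f where "f \<in> K (max k n)" "Q f < d (max k n) + 1 / 4 ^ k"
      using cINF_less_iff[OF ne bb] by blast
    moreover have "D - 1 / 4 ^ k < d (max k n)" using n dmono[of n "max k n"] by simp
    ultimately show ?thesis by (intro exI[of _ "max k n"] exI[of _ f]) auto
  qed
  then obtain N f where kN: "\<And>k. k \<le> N k" and dN: "\<And>k. D - 1 / 4 ^ k < d (N k)"
    and fK: "\<And>k. f k \<in> K (N k)" and Qf: "\<And>k. Q (f k) < d (N k) + 1 / 4 ^ k"
    by metis
  have f0: "f k \<in> K 0" for k by (rule K0[OF fK])
  note [measurable] = meas[OF f0]
  define v where "v k t = f (Suc k) t - f k t" for k t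
  have vint: "integrable M (\<lambda>t. v k t \<bullet> v k t) \<and> (\<integral>t. v k t \<bullet> v k t \<partial>M) \<le> 8 / 4 ^ k" for k
  proof -
    \<comment> \<open>Both functions and their midpoint \<open>g\<close> lie in \<open>K n\<close>,
      so \<open>Q g >= d n\<close>. With \<open>e = 4^-k\<close>, the parallelogram law bounds the
      mean square of \<open>v k\<close> by
      \<open>2 (D + e) + 2 (D + e) - 4 (D - e) = 8 e\<close>.\<close>
    define n where "n = min (N k) (N (Suc k))"
    define g where "g t = (1/2) *\<^sub>R f k t + (1/2) *\<^sub>R f (Suc k) t" for t
    have "f k \<in> K n" "f (Suc k) \<in> K n"
      using fK[of k] fK[of "Suc k"] dec[of n "N k"] dec[of n "N (Suc k)"] by (auto simp: n_def)
    then have gK: "g \<in> K n" unfolding g_def[abs_def] by (rule mid)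
    have "1 / 4 ^ Suc k \<le> (1 / 4 ^ k :: real)" by (simp add: field_simps)
    then have "D - 1 / 4 ^ k < d n" "Q (f (Suc k)) < D + 1 / 4 ^ k" "Q (f k) < D + 1 / 4 ^ k"
      using dN[of k] dN[of "Suc k"] Qf[of k] Qf[of "Suc k"] dD[of "N k"] dD[of "N (Suc k)"]
      by (auto simp: n_def min_def simp del: power_Suc)
    then have le: "2 * Q (f (Suc k)) + 2 * Q (f k) - 4 * Q g \<le> 8 * (1 / 4 ^ k)"
      using dQ[OF gK] by linarith
    have eq: "v k t \<bullet> v k t = 2 * (f (Suc k) t \<bullet> f (Suc k) t) + 2 * (f k t \<bullet> f k t) - 4 * (g t \<bullet> g t)" for t
      by (simp add: v_def g_def inner_diff_left inner_diff_right inner_add_left inner_add_right inner_commute field_simps)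
    have "integrable M (\<lambda>t. 2 * (f (Suc k) t \<bullet> f (Suc k) t) + 2 * (f k t \<bullet> f k t) - 4 * (g t \<bullet> g t))"
      by (intro Bochner_Integration.integrable_add Bochner_Integration.integrable_diff
           integrable_mult_right int f0 K0[OF gK])
    moreover have "(\<integral>t. 2 * (f (Suc k) t \<bullet> f (Suc k) t) + 2 * (f k t \<bullet> f k t) - 4 * (g t \<bullet> g t) \<partial>M)
        = 2 * Q (f (Suc k)) + 2 * Q (f k) - 4 * Q g"
      using int[OF f0] int[OF K0[OF gK]] by (simp add: Q_def)
    ultimately show ?thesis using le by (simp add: eq)
  qed
  have vnorm: "(\<integral>\<^sup>+ t. ennreal (norm (v k t)) \<partial>M) \<le> ennreal ((8 + \<mu>) * (1 / 2) ^ k)" for k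
  proof -
    have i: "integrable M (\<lambda>t. 2 ^ k * (v k t \<bullet> v k t) + 1 / 2 ^ k)"
      using vint[of k] by (intro Bochner_Integration.integrable_add integrable_mult_right) auto
    \<comment> \<open>Either \<open>|v| <= 2^-k\<close> or \<open>|v| <= 2^k * |v|^2\<close>. The
      means of \<open>|v k|\<close> are thus of order \<open>2^-k\<close>, so the telescoping series
      converges almost everywhere.\<close>
    have p: "norm (v k t) \<le> 2 ^ k * (v k t \<bullet> v k t) + 1 / 2 ^ k" for t
    proof (cases "norm (v k t) \<le> 1 / 2 ^ k")
      case True then show ?thesis by (simp add: add_increasing)
    next
      case False
      then have "1 * norm (v k t) \<le> (2 ^ k * norm (v k t)) * norm (v k t)"
        by (intro mult_right_mono) (auto simp: field_simps)
      then have "norm (v k t) \<le> 2 ^ k * (v k t \<bullet> v k t)"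
        by (simp add: dot_square_norm power2_eq_square)
      moreover have "(0::real) \<le> 1 / 2 ^ k" by simp
      ultimately show ?thesis by linarith
    qed
    have "(\<integral>\<^sup>+ t. ennreal (norm (v k t)) \<partial>M) \<le> (\<integral>\<^sup>+ t. ennreal (2 ^ k * (v k t \<bullet> v k t) + 1 / 2 ^ k) \<partial>M)"
      by (intro nn_integral_mono ennreal_leI p)
    also have "\<dots> = ennreal (\<integral>t. 2 ^ k * (v k t \<bullet> v k t) + 1 / 2 ^ k \<partial>M)"
      by (rule nn_integral_eq_integral[OF i]) (auto intro!: AE_I2 add_nonneg_nonneg)
    also have "(\<integral>t. 2 ^ k * (v k t \<bullet> v k t) + 1 / 2 ^ k \<partial>M) = 2 ^ k * (\<integral>t. v k t \<bullet> v k t \<partial>M) + \<mu> * (1 / 2 ^ k)"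
      using vint[of k] by (simp add: \<mu>_def)
    also have "\<dots> \<le> 2 ^ k * (8 / 4 ^ k) + \<mu> * (1 / 2 ^ k)"
      using vint[of k] by (intro add_right_mono mult_left_mono) auto
    also have "(4::real) ^ k = 2 ^ k * 2 ^ k" by (simp flip: power_mult_distrib)
    also have "2 ^ k * (8 / (2 ^ k * 2 ^ k)) + \<mu> * (1 / 2 ^ k) = (8 + \<mu>) * (1 / 2) ^ k"
      by (simp add: power_divide field_simps)
    finally show ?thesis by (simp add: ennreal_leI)
  qed
  have vm [measurable]: "(\<lambda>t. v k t) \<in> borel_measurable M" for k
    unfolding v_def by measurable
  have "(\<integral>\<^sup>+ t. (\<Sum>k. ennreal (norm (v k t))) \<partial>M) = (\<Sum>k. \<integral>\<^sup>+ t. ennreal (norm (v k t)) \<partial>M)"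
    by (rule nn_integral_suminf) measurable
  also have "\<dots> \<le> (\<Sum>k. ennreal ((8 + \<mu>) * (1 / 2) ^ k))"
    by (intro suminf_le vnorm) auto
  also have "\<dots> = ennreal (\<Sum>k. (8 + \<mu>) * (1 / 2) ^ k)"
    by (rule suminf_ennreal2) (auto intro!: summable_mult summable_geometric simp: \<mu>_def)
  also have "\<dots> < \<infinity>" by simp
  finally have "(\<integral>\<^sup>+ t. (\<Sum>k. ennreal (norm (v k t))) \<partial>M) \<noteq> \<infinity>" by simp
  then have "AE t in M. (\<Sum>k. ennreal (norm (v k t))) \<noteq> \<infinity>"
    by (intro nn_integral_PInf_AE) measurable
  then have "AE t in M. convergent (\<lambda>n. f n t)"
  proof (rule eventually_mono)
    fix t assume "(\<Sum>k. ennreal (norm (v k t))) \<noteq> \<infinity>"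
    then have "summable (\<lambda>k. norm (v k t))"
      by (intro summable_suminf_not_top) (auto simp: infinity_ennreal_def)
    then have "summable (\<lambda>k. v k t)" by (rule summable_norm_cancel)
    then have "convergent (\<lambda>n. f 0 t + (\<Sum>k<n. v k t))"
      unfolding summable_iff_convergent by (intro convergent_add convergent_const)
    also have "(\<lambda>n. f 0 t + (\<Sum>k<n. v k t)) = (\<lambda>n. f n t)"
      by (simp add: v_def sum_lessThan_telescope[of "\<lambda>k. f k t"])
    finally show "convergent (\<lambda>n. f n t)" .
  qed
  moreover have "f n \<in> K n" for n using fK dec[OF kN] by blast
  ultimately show ?thesis by (rule that[rotated])
qed

section \<open>Convexity and lower semicontinuity of the cost\<close>

lemma cost_integrand_measurable:
  fixes x :: "real \<Rightarrow> U"
  assumes "continuous_on {0..} x"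
  shows "(\<lambda>t. ennreal (x t \<bullet> x t / 2) * indicator {0..} t) \<in> borel_measurable lborel"
proof -
  have "(\<lambda>t. indicator {0..} t *\<^sub>R (x t \<bullet> x t / 2)) \<in> borel_measurable borel"
    by (intro borel_measurable_continuous_on_indicator continuous_intros assms) auto
  then have "(\<lambda>t. ennreal (indicator {0..} t *\<^sub>R (x t \<bullet> x t / 2))) \<in> borel_measurable lborel" by simp
  also have "(\<lambda>t. ennreal (indicator {0..} t *\<^sub>R (x t \<bullet> x t / 2))) = (\<lambda>t. ennreal (x t \<bullet> x t / 2) * indicator {0..} t)"
    by (auto simp: indicator_def fun_eq_iff)
  finally show ?thesis .
qed

lemma cost_midpoint:
  fixes x x' :: "real \<Rightarrow> U"
  assumes c: "continuous_on {0..} x" "continuous_on {0..} x'" and m: "cost x \<le> m" "cost x' \<le> m"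
  shows "cost (\<lambda>t. (1/2) *\<^sub>R x t + (1/2) *\<^sub>R x' t) \<le> m"
proof -
  have p: "(((1/2) *\<^sub>R v + (1/2) *\<^sub>R w) \<bullet> ((1/2) *\<^sub>R v + (1/2) *\<^sub>R w)) / 2
       \<le> 1/2 * (v \<bullet> v / 2) + 1/2 * (w \<bullet> w / 2)" for v w :: U
  proof -
    have "0 \<le> (v - w) \<bullet> (v - w)" by simp
    then show ?thesis by (simp add: inner_diff_left inner_diff_right inner_add_left inner_add_right inner_commute)
  qed
  have "cost (\<lambda>t. (1/2) *\<^sub>R x t + (1/2) *\<^sub>R x' t)
    \<le> (\<integral>\<^sup>+ t. ennreal (1/2) * (ennreal (x t \<bullet> x t / 2) * indicator {0..} t)
          + ennreal (1/2) * (ennreal (x' t \<bullet> x' t / 2) * indicator {0..} t) \<partial>lborel)"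
    unfolding cost_def
  proof (rule nn_integral_mono)
    fix t
    have "ennreal ((((1/2) *\<^sub>R x t + (1/2) *\<^sub>R x' t) \<bullet> ((1/2) *\<^sub>R x t + (1/2) *\<^sub>R x' t)) / 2)
      \<le> ennreal (1/2 * (x t \<bullet> x t / 2) + 1/2 * (x' t \<bullet> x' t / 2))"
      by (rule ennreal_leI[OF p])
    also have "\<dots> = ennreal (1/2) * ennreal (x t \<bullet> x t / 2) + ennreal (1/2) * ennreal (x' t \<bullet> x' t / 2)"
    proof -
      have "ennreal (1/2 * z) = ennreal (1/2) * ennreal z" if "0 \<le> z" for z
        by (rule ennreal_mult) (use that in auto)
      then have "ennreal (1/2 * (x t \<bullet> x t / 2)) = ennreal (1/2) * ennreal (x t \<bullet> x t / 2)"
        "ennreal (1/2 * (x' t \<bullet> x' t / 2)) = ennreal (1/2) * ennreal (x' t \<bullet> x' t / 2)"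
        by (auto simp del: times_divide_eq_left times_divide_eq_right)
      moreover have "0 \<le> 1/2 * (x t \<bullet> x t / 2)" "0 \<le> 1/2 * (x' t \<bullet> x' t / 2)" by simp_all
      ultimately show ?thesis by (simp only: ennreal_plus)
    qed
    finally show "ennreal (((1/2) *\<^sub>R x t + (1/2) *\<^sub>R x' t) \<bullet> ((1/2) *\<^sub>R x t + (1/2) *\<^sub>R x' t) / 2) * indicator {0..} t
       \<le> ennreal (1/2) * (ennreal (x t \<bullet> x t / 2) * indicator {0..} t)
          + ennreal (1/2) * (ennreal (x' t \<bullet> x' t / 2) * indicator {0..} t)"
    proof (cases "t \<in> {0..}")
      case False
      then have "indicator {0..} t = (0::ennreal)" by simp
      then show ?thesis by (simp only: mult_zero_right zero_le)
    qed (simp only: indicator_simps mult_1_right)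
  qed
  also have "\<dots> = ennreal (1/2) * cost x + ennreal (1/2) * cost x'"
    unfolding cost_def using cost_integrand_measurable[OF c(1)] cost_integrand_measurable[OF c(2)]
    by (subst nn_integral_add) (auto simp only: nn_integral_cmult intro!: borel_measurable_times_ennreal borel_measurable_const)
  also have "\<dots> \<le> ennreal (1/2) * m + ennreal (1/2) * m"
    by (intro add_mono mult_left_mono m) auto
  also have "\<dots> = (ennreal (1/2) + ennreal (1/2)) * m" by (simp only: distrib_right)
  also have "ennreal (1/2) + ennreal (1/2) = 1" by (subst ennreal_plus[symmetric]) auto
  finally show ?thesis by simp
qed

lemma cost_Fatou:
  fixes X :: "nat \<Rightarrow> real \<Rightarrow> U"
  assumes c: "\<And>n. continuous_on {0..} (X n)"
    and lim: "\<And>t. 0 \<le> t \<Longrightarrow> (\<lambda>n. X n t) \<longlonglongrightarrow> x t"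
    and m: "\<And>n. cost (X n) \<le> a n" "a \<longlonglongrightarrow> m"
  shows "cost x \<le> m"
proof -
  have "cost x = (\<integral>\<^sup>+ t. liminf (\<lambda>n. ennreal (X n t \<bullet> X n t / 2) * indicator {0..} t) \<partial>lborel)"
    unfolding cost_def
  proof (rule nn_integral_cong)
    fix t :: real
    have "(\<lambda>n. ennreal (X n t \<bullet> X n t / 2) * indicator {0..} t) \<longlonglongrightarrow> ennreal (x t \<bullet> x t / 2) * indicator {0..} t"
    proof (cases "0 \<le> t")
      case True
      then have "(\<lambda>n. ennreal (X n t \<bullet> X n t / 2)) \<longlonglongrightarrow> ennreal (x t \<bullet> x t / 2)"
        by (intro tendsto_ennrealI tendsto_intros lim) auto
      then show ?thesis using True by simp
    qed simp
    from lim_imp_Liminf[OF _ this]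
    show "ennreal (x t \<bullet> x t / 2) * indicator {0..} t = liminf (\<lambda>n. ennreal (X n t \<bullet> X n t / 2) * indicator {0..} t)"
      by simp
  qed
  also have "\<dots> \<le> liminf (\<lambda>n. cost (X n))"
    unfolding cost_def by (intro nn_integral_liminf cost_integrand_measurable c)
  also have "\<dots> \<le> liminf a" by (intro Liminf_mono always_eventually allI m)
  also have "\<dots> = m" by (intro lim_imp_Liminf m) simp
  finally show ?thesis .
qed

section \<open>Null sets and dominated convergence on the half-line\<close>

lemma AE_lebesgue_on_negligible:
  assumes "AE t in lebesgue_on {0::real..}. P t"
  obtains Z where "negligible Z" "\<And>t. 0 \<le> t \<Longrightarrow> t \<notin> Z \<Longrightarrow> P t"
proof -
  have "AE t in lebesgue. t \<in> {0..} \<longrightarrow> P t"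
    using assms by (subst (asm) AE_restrict_space_iff) auto
  then obtain Z where "{t \<in> space lebesgue. \<not> (t \<in> {0..} \<longrightarrow> P t)} \<subseteq> Z"
    "emeasure lebesgue Z = 0" "Z \<in> sets lebesgue"
    by (rule AE_E)
  then show thesis
    by (intro that[of Z]) (auto simp: negligible_iff_null_sets intro!: null_setsI)
qed

lemma negligible_AE_lebesgue_on:
  assumes "negligible {t. 0 \<le> t \<and> \<not> P t}"
  shows "AE t in lebesgue_on {0::real..}. P t"
proof -
  have "AE t in lebesgue. t \<in> {0..} \<longrightarrow> P t"
    by (rule AE_I'[of "{t. 0 \<le> t \<and> \<not> P t}"]) (use assms in \<open>auto simp: negligible_iff_null_sets\<close>)
  then show ?thesis by (subst AE_restrict_space_iff) auto
qed

lemma dominated_convergence_negligible: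
  fixes f :: "nat \<Rightarrow> real \<Rightarrow> 'a::euclidean_space"
  assumes Z: "negligible Z" and f: "\<And>k. f k integrable_on S" and h: "h integrable_on S"
    and le: "\<And>k t. t \<in> S \<Longrightarrow> norm (f k t) \<le> h t"
    and conv: "\<And>t. t \<in> S - Z \<Longrightarrow> (\<lambda>k. f k t) \<longlonglongrightarrow> g t"
  shows "(\<lambda>k. integral S (f k)) \<longlonglongrightarrow> integral S g"
proof -
  define f' where "f' k t = (if t \<in> Z then 0 else f k t)" for k t
  define g' where "g' t = (if t \<in> Z then 0 else g t)" for t
  have "(\<lambda>k. integral S (f' k)) \<longlonglongrightarrow> integral S g'"
  proof (rule dominated_convergence(2)[OF _ h])
    show "f' k integrable_on S" for k
      by (rule integrable_spike[OF f[of k] Z]) (auto simp: f'_def)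
    show "norm (f' k t) \<le> h t" if "t \<in> S" for k t
      using le[OF that, of k] order_trans[OF norm_ge_zero le[OF that, of k]] by (auto simp: f'_def)
    show "(\<lambda>k. f' k t) \<longlonglongrightarrow> g' t" if "t \<in> S" for t
      using conv[of t] that by (cases "t \<in> Z") (auto simp: f'_def g'_def)
  qed
  moreover have "integral S (f' k) = integral S (f k)" for k
    by (rule integral_spike[OF Z]) (auto simp: f'_def)
  moreover have "integral S g' = integral S g"
    by (rule integral_spike[OF Z]) (auto simp: g'_def)
  ultimately show ?thesis by simp
qed

context control_set
begin

lemma admissible_exists:
  obtains x y u where "admissible \<Omega> x0 y0 x y u" "cost x < top"
proof -
  define y where "y t = y0 + integral {0..t} (\<lambda>_. 0::U)" for t :: real
  define x where "x t = x0 + integral {0..t} y" for t :: real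
  have adm: "admissible \<Omega> x0 y0 x y (\<lambda>_. 0)"
    unfolding admissible_def x_def y_def using zero_in by auto
  obtain x' y' u' where adm': "admissible \<Omega> x0 y0 x' y' u'"
    and z: "\<And>t. 0 + steer_time * hnorm (x 0) (y 0) \<le> t \<Longrightarrow> x' t = 0 \<and> y' t = 0"
    by (rule steer[OF adm order_refl]) (rule that)
  have "cost x' = ennreal (energy x' 0 (0 + steer_time * hnorm (x 0) (y 0)) / 2)"
    by (rule cost_finite_horizon[OF admissible_continuous(2)[OF adm' order_refl]]) (use z in auto)
  then show ?thesis using that[OF adm'] by simp
qed

text \<open>Controls of nearly minimal cost form decreasing sets closed under midpoints, from which
  a sequence converging almost everywhere is selected. Dominated convergence, used twice, carries
  the limit to velocities and positions, and Fatou's lemma bounds the limiting cost.\<close>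

lemma optimal_exists:
  obtains x y u where "admissible \<Omega> x0 y0 x y u" "optimal \<Omega> x0 y0 x y"
proof -
  define A where "A = {(x, y, u). admissible \<Omega> x0 y0 x y u}"
  define m where "m = (INF p\<in>A. cost (fst p))"
  have mle: "m \<le> cost x" if "admissible \<Omega> x0 y0 x y u" for x y u
    unfolding m_def using that by (intro INF_lower2[of "(x, y, u)"]) (auto simp: A_def)
  have mfin: "m \<noteq> \<infinity>"
  proof -
    obtain x y u where "admissible \<Omega> x0 y0 x y u" "cost x < top" by (rule admissible_exists)
    then show ?thesis using mle le_less_trans by fastforce
  qed
  define c where "c n = m + ennreal (1 / real (Suc n))" for n
  define K where "K n = {u. \<exists>x y. admissible \<Omega> x0 y0 x y u \<and> cost x \<le> c n}" for n
  \<comment> \<open>A strictly positive integrable weight replaces Lebesgue measure on the half-line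
    by a finite measure with the same null sets. Bounded controls are square integrable for
    it.\<close>
  obtain h where h: "h \<in> borel_measurable (lebesgue_on {0::real..})" "integral\<^sup>N (lebesgue_on {0..}) h \<noteq> \<infinity>"
    and hpos: "\<And>t. t \<in> space (lebesgue_on {0..}) \<Longrightarrow> 0 < h t"
  proof -
    interpret sigma_finite_measure "lebesgue_on {0::real..}"
    proof (standard, intro exI conjI ballI)
      let ?A = "range (\<lambda>n. {0..real n})"
      show "countable ?A" "?A \<subseteq> sets (lebesgue_on {0..})"
        by (auto simp: sets_restrict_space_iff)
      show "\<Union>?A = space (lebesgue_on {0..})"
        using real_arch_simple by auto
      show "emeasure (lebesgue_on {0..}) a \<noteq> \<infinity>" if "a \<in> ?A" for a
        using that by (auto simp: emeasure_restrict_space)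
    qed
    show thesis using that Ex_finite_integrable_function by blast
  qed
  define M where "M = density (lebesgue_on {0..}) h"
  have fin: "finite_measure M"
  proof
    have "emeasure M (space M) = integral\<^sup>N (lebesgue_on {0..}) h"
      unfolding M_def using h by (subst emeasure_density) (auto intro!: nn_integral_cong simp: indicator_def)
    then show "emeasure M (space M) \<noteq> \<infinity>" using h by simp
  qed
  obtain f where fK: "\<And>n. f n \<in> K n" and conv: "AE t in M. convergent (\<lambda>n. f n t)"
  proof (rule nested_convex_AE_convergent[OF fin, of K R])
    show "K n \<noteq> {}" for n
    proof -
      obtain p where "p \<in> A" "cost (fst p) < m + ennreal (1 / real (Suc n))"
        using INF_approx_ennreal[OF _ m_def mfin, of "1 / real (Suc n)"] by auto
      moreover obtain x y u where "p = (x, y, u)" by (cases p)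
      ultimately have "admissible \<Omega> x0 y0 x y u" "cost x \<le> c n"
        unfolding c_def A_def by (auto intro: less_imp_le simp del: of_nat_Suc)
      then show ?thesis unfolding K_def by blast
    qed
    show "K n \<subseteq> K k" if "k \<le> n" for k n
    proof -
      have "c n \<le> c k"
        unfolding c_def using that by (intro add_left_mono ennreal_leI) (auto simp: field_simps)
      then show ?thesis unfolding K_def using order_trans by blast
    qed
    show "(\<lambda>t. (1/2) *\<^sub>R f t + (1/2) *\<^sub>R g t) \<in> K n" if fg: "f \<in> K n" "g \<in> K n" for n f g
    proof -
      obtain x y x' y' where 1: "admissible \<Omega> x0 y0 x y f" "cost x \<le> c n"
        and 2: "admissible \<Omega> x0 y0 x' y' g" "cost x' \<le> c n"
        using fg by (auto simp: K_def)
      have "cost (\<lambda>t. (1/2) *\<^sub>R x t + (1/2) *\<^sub>R x' t) \<le> c n"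
        by (rule cost_midpoint[OF admissible_continuous(1)[OF 1(1)] admissible_continuous(1)[OF 2(1)] 1(2) 2(2)]) auto
      then show ?thesis using admissible_convex[OF 1(1) 2(1), of "1/2"] unfolding K_def by auto
    qed
    show "f \<in> borel_measurable M" "t \<in> space M \<Longrightarrow> norm (f t) \<le> R" if "f \<in> K 0" for f t
      using that admissible_bound(2) by (auto simp: K_def M_def admissible_def)
  qed (rule that)
  obtain X Y where adm: "\<And>n. admissible \<Omega> x0 y0 (X n) (Y n) (f n)" and cX: "\<And>n. cost (X n) \<le> c n"
    using fK unfolding K_def by simp metis
  have "AE t in lebesgue_on {0..}. convergent (\<lambda>n. f n t)"
    using conv h(1) unfolding M_def by (subst (asm) AE_density) (auto elim!: eventually_elim2[OF _ AE_I2] dest: hpos)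
  then obtain Z where Z: "negligible Z" and fc: "\<And>t. 0 \<le> t \<Longrightarrow> t \<notin> Z \<Longrightarrow> convergent (\<lambda>n. f n t)"
    by (rule AE_lebesgue_on_negligible) (rule that)
  define g where "g t = lim (\<lambda>n. f n t)" for t
  \<comment> \<open>Replacing the limit by 0 wherever it leaves the control set gives admissible
    values at every time. At points of convergence the limit belongs to the closed set and is
    kept.\<close>
  define u where "u t = (if g t \<in> \<Omega> then g t else 0)" for t
  define y where "y t = y0 + integral {0..t} u" for t
  define x where "x t = x0 + integral {0..t} y" for t
  have "admissible \<Omega> x0 y0 x y u"
    unfolding admissible_def
  proof (intro conjI allI impI)
    have fm [measurable]: "f n \<in> borel_measurable (lebesgue_on {0..})" for n
      using adm[of n] by (simp add: admissible_def)
    have [measurable]: "g \<in> borel_measurable (lebesgue_on {0..})"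
      unfolding g_def[abs_def] by (rule borel_measurable_lim_metric[OF fm])
    have [measurable]: "\<Omega> \<in> sets borel" by (rule borel_closed[OF closed])
    show "u \<in> borel_measurable (lebesgue_on {0..})" unfolding u_def[abs_def] by measurable
  qed (auto simp: u_def x_def y_def zero_in)
  have fu: "(\<lambda>n. f n t) \<longlonglongrightarrow> u t" if "0 \<le> t" "t \<notin> Z" for t
  proof -
    have l: "(\<lambda>n. f n t) \<longlonglongrightarrow> g t" using fc[OF that] by (simp add: g_def convergent_LIMSEQ_iff)
    then have "g t \<in> \<Omega>"
      by (rule closed_sequentially[OF closed, rotated]) (use admissible_bound(1)[OF adm that(1)] in auto)
    then show ?thesis using l by (simp add: u_def)
  qed
  have Yy: "(\<lambda>n. Y n t) \<longlonglongrightarrow> y t" if "0 \<le> t" for t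
  proof -
    have "(\<lambda>n. integral {0..t} (f n)) \<longlonglongrightarrow> integral {0..t} u"
      by (rule dominated_convergence_negligible[OF Z, where h="\<lambda>_. R"])
         (use fu admissible_integrable[OF adm order_refl] admissible_bound(2)[OF adm] in auto)
    then show ?thesis
      using adm that by (simp add: y_def admissible_def tendsto_add)
  qed
  have Xx: "(\<lambda>n. X n t) \<longlonglongrightarrow> x t" if "0 \<le> t" for t
  proof -
    have "(\<lambda>n. integral {0..t} (Y n)) \<longlonglongrightarrow> integral {0..t} y"
    proof (rule dominated_convergence(2)[where h="\<lambda>s. norm y0 + R * s"])
      show "Y k integrable_on {0..t}" for k
        by (intro integrable_continuous_real admissible_continuous(4)[OF adm order_refl])
      show "(\<lambda>s. norm y0 + R * s) integrable_on {0..t}"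
        by (intro integrable_continuous_real continuous_intros)
      show "norm (Y k s) \<le> norm y0 + R * s" if "s \<in> {0..t}" for k s
      proof -
        have "norm (Y k s - Y k 0) \<le> R * \<bar>s - 0\<bar>"
          by (rule lip_deriv_path_lipschitz[OF admissible_path[OF adm[of k]]]) (use that in auto)
        then show ?thesis
          using norm_triangle_sub[of "Y k s" "Y k 0"] that admissible_init(2)[OF adm] by simp
      qed
    qed (use Yy in auto)
    then show ?thesis
      using adm that by (simp add: x_def admissible_def tendsto_add)
  qed
  have "c \<longlonglongrightarrow> m + ennreal 0"
    unfolding c_def using LIMSEQ_inverse_real_of_nat
    by (intro tendsto_add tendsto_const tendsto_ennrealI) (simp add: inverse_eq_divide)
  then have "cost x \<le> m"
    by (intro cost_Fatou[of X x c] Xx cX admissible_continuous(1)[OF adm]) auto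
  then have "optimal \<Omega> x0 y0 x y"
    unfolding optimal_def using \<open>admissible \<Omega> x0 y0 x y u\<close> mle order_trans by blast
  then show ?thesis using that \<open>admissible \<Omega> x0 y0 x y u\<close> by blast
qed

end

subsection \<open>The adjoint function\<close>

lemma integral_le_negligible:
  fixes f g :: "real \<Rightarrow> real"
  assumes Z: "negligible Z" and f: "f integrable_on S" and g: "g integrable_on S"
    and le: "\<And>t. t \<in> S - Z \<Longrightarrow> f t \<le> g t"
  shows "integral S f \<le> integral S g"
proof -
  define f' where "f' t = (if t \<in> Z then g t else f t)" for t
  have "integral S f = integral S f'" by (rule integral_spike[OF Z]) (auto simp: f'_def)
  also have "\<dots> \<le> integral S g"
  proof (rule integral_le[OF _ g])
    show "f' integrable_on S" by (rule integrable_spike[OF f Z]) (auto simp: f'_def)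
  qed (use le in \<open>auto simp: f'_def\<close>)
  finally show ?thesis .
qed

lemma has_integral_0_nonneg_negligible:
  fixes g :: "real \<Rightarrow> real"
  assumes "(g has_integral 0) S" "\<And>t. t \<in> S \<Longrightarrow> 0 \<le> g t"
  shows "negligible {t \<in> S. g t \<noteq> 0}"
proof -
  define h where "h t = (if t \<in> S then g t else 0)" for t
  have "(h has_integral 0) UNIV"
    unfolding h_def[abs_def] using assms(1) by (simp add: has_integral_restrict_UNIV)
  moreover have "0 \<le> h t" for t using assms(2) by (auto simp: h_def)
  ultimately have h: "h \<in> borel_measurable lebesgue" "(\<integral>\<^sup>+ t. h t \<partial>lebesgue) = 0"
    using has_integral_iff_nn_integral_lebesgue[of h 0] by auto
  then have "AE t in lebesgue. ennreal (h t) = 0"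
    by (subst (asm) nn_integral_0_iff_AE) auto
  then obtain Z where "{t \<in> space lebesgue. \<not> (ennreal (h t) = 0)} \<subseteq> Z" "emeasure lebesgue Z = 0" "Z \<in> sets lebesgue"
    by (rule AE_E)
  then have Z: "negligible Z" "\<And>t. t \<notin> Z \<Longrightarrow> ennreal (h t) = 0"
    by (auto simp: negligible_iff_null_sets intro!: null_setsI)
  have "{t \<in> S. g t \<noteq> 0} \<subseteq> Z"
  proof clarify
    fix t assume t: "t \<in> S" "g t \<noteq> 0"
    then have "0 < h t" using assms(2)[of t] by (simp add: h_def)
    then show "t \<in> Z" using Z(2)[of t] by (auto simp: ennreal_eq_0_iff)
  qed
  with Z(1) show ?thesis by (rule negligible_subset)
qed

text \<open>For \<open>t > T\<close> the left-hand side is an integral over the empty set, and the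
  right-hand side vanishes because \<open>g\<close> does beyond \<open>T\<close>.\<close>

lemma tail_integral:
  fixes g :: "real \<Rightarrow> 'a::euclidean_space"
  assumes g: "\<And>a b. 0 \<le> a \<Longrightarrow> g integrable_on {a..b}" and z: "\<forall>t>T. g t = 0"
    and T: "0 \<le> T" and t: "0 \<le> t"
  shows "integral {t..T} g = integral {0..T} g - integral {0..t} g"
proof (cases "t \<le> T")
  case True then show ?thesis using integral_split_interval[OF g t] by simp
next
  case False
  have "integral {T..t} g = integral {T..t} (\<lambda>_. 0)"
    by (rule integral_spike[of "{T}"]) (use z in auto)
  then show ?thesis using False integral_split_interval[OF g T, of t] by simp
qed

text \<open>\<open>co_phi\<close> and \<open>co_psi\<close> solve the adjoint equations backwards
  from zero values at \<open>T\<close>. For \<open>t > T\<close> the interval is empty, so they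
  continue by 0.\<close>

definition co_phi :: "real \<Rightarrow> (real \<Rightarrow> 'a::euclidean_space) \<Rightarrow> real \<Rightarrow> 'a" where
  "co_phi T x t = - integral {t..T} x"

definition co_psi :: "real \<Rightarrow> (real \<Rightarrow> 'a::euclidean_space) \<Rightarrow> real \<Rightarrow> 'a" where
  "co_psi T x t = integral {t..T} (co_phi T x)"

lemma integrable_on_continuous_atLeast:
  fixes g :: "real \<Rightarrow> 'a::euclidean_space"
  assumes "continuous_on {0..} g" "0 \<le> a"
  shows "g integrable_on {a..b}"
  by (intro integrable_continuous_real continuous_on_subset[OF assms(1)]) (use assms(2) in auto)

lemma adjoint_system:
  fixes x :: "real \<Rightarrow> 'a::euclidean_space"
  assumes x: "continuous_on {0..} x"
    and phi: "\<And>t. 0 \<le> t \<Longrightarrow> \<phi> t = \<phi> 0 + integral {0..t} x"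
    and psi: "\<And>t. 0 \<le> t \<Longrightarrow> \<psi> t = \<psi> 0 - integral {0..t} \<phi>"
  shows "\<And>t. 0 \<le> t \<Longrightarrow> (\<phi> has_vector_derivative x t) (at t within {0..})"
    and "\<And>t. 0 \<le> t \<Longrightarrow> (\<psi> has_vector_derivative - \<phi> t) (at t within {0..})"
    and "continuous_on {0..} \<phi>" "continuous_on {0..} \<psi>"
proof -
  show 1: "(\<phi> has_vector_derivative x t) (at t within {0..})" if "0 \<le> t" for t
    by (rule indefinite_integral_has_vector_derivative[OF x phi that])
  then show c: "continuous_on {0..} \<phi>"
    by (meson atLeast_iff continuous_on_vector_derivative)
  show 2: "(\<psi> has_vector_derivative - \<phi> t) (at t within {0..})" if "0 \<le> t" for t
  proof (rule indefinite_integral_has_vector_derivative[OF _ _ that])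
    show "continuous_on {0..} (\<lambda>t. - \<phi> t)" by (intro continuous_intros c)
    fix t :: real assume "0 \<le> t"
    from psi[OF this] show "\<psi> t = \<psi> 0 + integral {0..t} (\<lambda>t. - \<phi> t)"
      by (subst integral_neg) (rule trans, assumption, rule diff_conv_add_uminus)
  qed
  then show "continuous_on {0..} \<psi>"
    by (meson atLeast_iff continuous_on_vector_derivative)
qed

lemma co_phi_psi:
  fixes x :: "real \<Rightarrow> 'a::euclidean_space"
  assumes x: "continuous_on {0..} x" and z: "\<forall>t>T. x t = 0" and T: "0 \<le> T"
  shows "\<And>t. 0 \<le> t \<Longrightarrow> co_phi T x t = co_phi T x 0 + integral {0..t} x"
    and "\<And>t. 0 \<le> t \<Longrightarrow> co_psi T x t = co_psi T x 0 - integral {0..t} (co_phi T x)"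
    and "\<And>t. T \<le> t \<Longrightarrow> co_phi T x t = 0 \<and> co_psi T x t = 0"
proof -
  show 1: "co_phi T x t = co_phi T x 0 + integral {0..t} x" if "0 \<le> t" for t
    using tail_integral[OF integrable_on_continuous_atLeast[OF x] z T that] by (simp add: co_phi_def)
  show 3: "co_phi T x t = 0 \<and> co_psi T x t = 0" if "T \<le> t" for t
    using that by (cases "t = T") (auto simp: co_phi_def co_psi_def)
  have "(co_phi T x has_vector_derivative x t) (at t within {0..})" if "0 \<le> t" for t
    by (rule indefinite_integral_has_vector_derivative[OF x 1 that])
  then have c: "continuous_on {0..} (co_phi T x)"
    by (meson atLeast_iff continuous_on_vector_derivative)
  show "co_psi T x t = co_psi T x 0 - integral {0..t} (co_phi T x)" if "0 \<le> t" for t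
    using tail_integral[OF integrable_on_continuous_atLeast[OF c] _ T that] 3 by (simp add: co_psi_def)
qed

lemma adjoint_eqs:
  assumes "adjoint \<Omega> x u \<phi> \<psi>" "0 \<le> s"
  shows "\<phi> s = \<phi> 0 + integral {0..s} x" "\<psi> s = \<psi> 0 - integral {0..s} \<phi>"
  using assms unfolding adjoint_def by blast+

lemma adjoint_regular:
  assumes "continuous_on {0..} x" "adjoint \<Omega> x u \<phi> \<psi>"
  shows "\<And>t. 0 \<le> t \<Longrightarrow> (\<phi> has_vector_derivative x t) (at t within {0..})"
    and "\<And>t. 0 \<le> t \<Longrightarrow> (\<psi> has_vector_derivative - \<phi> t) (at t within {0..})"
    and "continuous_on {0..} \<phi>" "continuous_on {0..} \<psi>"
  using adjoint_system[OF assms(1) adjoint_eqs[OF assms(2)]] by blast+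

context control_set
begin

lemma inner_control_integrable:
  assumes adm: "admissible \<Omega> x0 y0 x y u" and psi: "continuous_on {0..} \<psi>" and a: "0 \<le> a"
  shows "(\<lambda>t. \<psi> t \<bullet> u t) integrable_on {a..b}"
proof -
  have c: "continuous_on {a..b} \<psi>" using a by (intro continuous_on_subset[OF psi]) auto
  then have "compact (\<psi> ` {a..b})" by (intro compact_continuous_image) auto
  then obtain L where L: "L > 0" "\<And>t. t \<in> {a..b} \<Longrightarrow> norm (\<psi> t) \<le> L"
    by (metis bounded_pos compact_imp_bounded imageI)
  show ?thesis
  proof (rule bounded_measurable_integrable_on)
    show "(\<lambda>t. \<psi> t \<bullet> u t) \<in> borel_measurable (lebesgue_on {a..b})"
      by (intro borel_measurable_inner admissible_measurable[OF adm a]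
          continuous_imp_measurable_on_sets_lebesgue c) auto
    fix t assume t: "t \<in> {a..b}"
    have "\<bar>\<psi> t \<bullet> u t\<bar> \<le> norm (\<psi> t) * norm (u t)" by (rule Cauchy_Schwarz_ineq2)
    also have "\<dots> \<le> L * R"
      using L t a admissible_bound(2)[OF adm, of t] by (intro mult_mono) auto
    finally show "norm (\<psi> t \<bullet> u t) \<le> L * R" by simp
  qed
qed

lemma admissible_pairing:
  assumes 1: "admissible \<Omega> x0 y0 x y u" and 2: "admissible \<Omega> x0' y0' x' y' u'"
    and ab: "0 \<le> a" "a \<le> b"
    and psi: "\<And>t. 0 \<le> t \<Longrightarrow> (\<psi> has_vector_derivative - \<phi> t) (at t within {0..})"
    and phi: "\<And>t. 0 \<le> t \<Longrightarrow> (\<phi> has_vector_derivative z t) (at t within {0..})"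
    and z: "continuous_on {0..} z"
  shows "integral {a..b} (\<lambda>t. z t \<bullet> (x t - x' t)) + integral {a..b} (\<lambda>t. \<psi> t \<bullet> (u t - u' t))
       = (\<phi> b \<bullet> (x b - x' b) + \<psi> b \<bullet> (y b - y' b)) - (\<phi> a \<bullet> (x a - x' a) + \<psi> a \<bullet> (y a - y' a))"
proof (rule adjoint_pairing[OF ab(2), where R="R + R"])
  note within = has_vector_derivative_within_subset[where S="{0..}" and T="{a..b}"]
  show "(\<lambda>t. u t - u' t) \<in> borel_measurable (lebesgue_on {a..b})"
    by (intro borel_measurable_diff admissible_measurable[OF 1] admissible_measurable[OF 2] ab)
  show "norm (u t - u' t) \<le> R + R" if "t \<in> {a..b}" for t
    using that ab admissible_bound(2)[OF 1, of t] admissible_bound(2)[OF 2, of t]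
    by (intro order_trans[OF norm_triangle_ineq4] add_mono) auto
  show "y t - y' t = y a - y' a + integral {a..t} (\<lambda>t. u t - u' t)" if "t \<in> {a..b}" for t
    using that ab admissible_increment[OF 1, of a t] admissible_increment[OF 2, of a t]
      admissible_integrable[OF 1 ab(1), of t] admissible_integrable[OF 2 ab(1), of t]
    by (simp add: Henstock_Kurzweil_Integration.integral_diff)
  show "((\<lambda>t. x t - x' t) has_vector_derivative y t - y' t) (at t within {a..b})" if "t \<in> {a..b}" for t
    using lip_deriv_path_diff[OF admissible_path[OF 1] admissible_path[OF 2]] that ab
    unfolding lip_deriv_path_def by (intro within) auto
  show "(\<psi> has_vector_derivative - \<phi> t) (at t within {a..b})"
    "(\<phi> has_vector_derivative z t) (at t within {a..b})" if "t \<in> {a..b}" for t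
    using that ab by (auto intro!: within[OF psi] within[OF phi])
  show "continuous_on {a..b} z" by (rule continuous_on_subset[OF z]) (use ab in auto)
qed

text \<open>Needle-type variation: replace the control by \<open>v\<close> wherever \<open>v\<close> beats it before time \<open>T\<close>, and
  steer to the origin afterwards. Since \<open>\<psi>\<close> vanishes after \<open>T\<close>, the steering does not contribute to
  the first variation.\<close>

lemma maximum_condition_pointwise:
  assumes adm: "admissible \<Omega> x0 y0 x y u" and opt: "optimal \<Omega> x0 y0 x y"
    and z: "\<And>t. T \<le> t \<Longrightarrow> x t = 0" and T: "0 \<le> T" and v: "v \<in> \<Omega>"
  shows "negligible {t. 0 \<le> t \<and> co_psi T x t \<bullet> u t < co_psi T x t \<bullet> v}"
proof -
  define \<phi> where "\<phi> = co_phi T x"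
  define \<psi> where "\<psi> = co_psi T x"
  note cx = admissible_continuous(1)[OF adm order_refl]
  have z': "\<forall>t>T. x t = 0" using z by auto
  note sys = co_phi_psi[OF cx z' T, folded \<phi>_def \<psi>_def]
  note der = adjoint_system[OF cx sys(1,2)]
  define w where "w t = (if t < T \<and> \<psi> t \<bullet> u t < \<psi> t \<bullet> v then v else u t)" for t
  define y1 where "y1 t = y0 + integral {0..t} w" for t
  define x1 where "x1 t = x0 + integral {0..t} y1" for t
  have adm1: "admissible \<Omega> x0 y0 x1 y1 w"
    unfolding admissible_def
  proof (intro conjI allI impI)
    have [measurable]: "u \<in> borel_measurable (lebesgue_on {0..})" using adm by (simp add: admissible_def)
    have [measurable]: "\<psi> \<in> borel_measurable (lebesgue_on {0..})"
      by (intro continuous_imp_measurable_on_sets_lebesgue der) auto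
    note measurable_ident_lebesgue_on[measurable]
    show "w \<in> borel_measurable (lebesgue_on {0..})" unfolding w_def[abs_def] by measurable
    show "w t \<in> \<Omega>" if "t \<ge> 0" for t using that v admissible_bound(1)[OF adm] by (simp add: w_def)
  qed (simp_all add: x1_def y1_def)
  obtain x' y' u' where adm': "admissible \<Omega> x0 y0 x' y' u'"
    and uw: "\<And>t. 0 \<le> t \<Longrightarrow> t < T \<Longrightarrow> u' t = w t"
    and z1: "\<And>t. T + steer_time * hnorm (x1 T) (y1 T) \<le> t \<Longrightarrow> x' t = 0 \<and> y' t = 0"
    by (rule steer[OF adm1 T]) (rule that, assumption+)
  define b where "b = T + steer_time * hnorm (x1 T) (y1 T)"
  have b: "T \<le> b" using steer_time_ge_1 by (simp add: b_def)
  have "0 \<le> integral {0..b} (\<lambda>t. x t \<bullet> (x' t - x t))"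
    by (rule optimal_variational_inequality[OF adm opt adm']) (use z z1 b in \<open>auto simp: b_def\<close>)
  \<comment> \<open>The boundary terms vanish: both processes start from the same state, and
    \<open>\<phi>\<close>, \<open>\<psi>\<close> are zero at \<open>b >= T\<close>. The variational
    inequality for positions thereby becomes an upper bound for the control term, whose integrand is
    nonnegative by the choice of \<open>w\<close>.\<close>
  moreover have "integral {0..b} (\<lambda>t. x t \<bullet> (x' t - x t)) + integral {0..b} (\<lambda>t. \<psi> t \<bullet> (u' t - u t)) = 0"
    using admissible_pairing[OF adm' adm order_refl order_trans[OF T b] der(2,1) cx] sys(3)[OF b]
      admissible_init[OF adm] admissible_init[OF adm'] by simp
  ultimately have le: "integral {0..b} (\<lambda>t. \<psi> t \<bullet> (u' t - u t)) \<le> 0" by simp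
  have nn: "0 \<le> \<psi> t \<bullet> (u' t - u t)" if "t \<in> {0..b}" for t
    using that uw[of t] sys(3)[of t] by (cases "t < T") (auto simp: w_def inner_diff_right)
  have int: "(\<lambda>t. \<psi> t \<bullet> (u' t - u t)) integrable_on {0..b}"
    unfolding inner_diff_right
    by (intro Henstock_Kurzweil_Integration.integrable_diff inner_control_integrable[OF adm' der(4)]
        inner_control_integrable[OF adm der(4)] order_refl)
  have "integral {0..b} (\<lambda>t. \<psi> t \<bullet> (u' t - u t)) = 0"
    by (rule antisym[OF le Henstock_Kurzweil_Integration.integral_nonneg[OF int nn]])
  then have "((\<lambda>t. \<psi> t \<bullet> (u' t - u t)) has_integral 0) {0..b}"
    using integrable_integral[OF int] by simp
  then have "negligible {t \<in> {0..b}. \<psi> t \<bullet> (u' t - u t) \<noteq> 0}"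
    by (rule has_integral_0_nonneg_negligible) (rule nn)
  moreover have "{t. 0 \<le> t \<and> \<psi> t \<bullet> u t < \<psi> t \<bullet> v} \<subseteq> {t \<in> {0..b}. \<psi> t \<bullet> (u' t - u t) \<noteq> 0}"
  proof
    fix t assume t: "t \<in> {t. 0 \<le> t \<and> \<psi> t \<bullet> u t < \<psi> t \<bullet> v}"
    then have "t < T" using sys(3)[of t] by (cases "t < T") auto
    then show "t \<in> {t \<in> {0..b}. \<psi> t \<bullet> (u' t - u t) \<noteq> 0}"
      using t uw[of t] b by (auto simp: w_def inner_diff_right)
  qed
  ultimately show ?thesis unfolding \<psi>_def by (rule negligible_subset)
qed

text \<open>The exceptional null set of the pointwise condition depends on \<open>v\<close>. A
  countable dense subset of the control set yields a single null set, and the condition extends to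
  the closure because half-spaces are closed.\<close>

lemma adjoint_exists:
  assumes adm: "admissible \<Omega> x0 y0 x y u" and opt: "optimal \<Omega> x0 y0 x y"
    and z: "\<And>t. T \<le> t \<Longrightarrow> x t = 0" and T: "0 \<le> T"
  shows "adjoint \<Omega> x u (co_phi T x) (co_psi T x)"
proof -
  have z': "\<forall>t>T. x t = 0" using z by auto
  note sys = co_phi_psi[OF admissible_continuous(1)[OF adm order_refl] z' T]
  obtain D where D: "countable D" "D \<subseteq> \<Omega>" "\<Omega> \<subseteq> closure D" by (rule separable)
  have "negligible (\<Union>v\<in>D. {t. 0 \<le> t \<and> co_psi T x t \<bullet> u t < co_psi T x t \<bullet> v})"
    using maximum_condition_pointwise[OF adm opt z T] D by (intro negligible_countable_Union) auto
  then have "negligible {t. 0 \<le> t \<and> \<not> (\<forall>v\<in>\<Omega>. co_psi T x t \<bullet> v \<le> co_psi T x t \<bullet> u t)}"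
  proof (rule negligible_subset, intro subsetI)
    fix t assume t: "t \<in> {t. 0 \<le> t \<and> \<not> (\<forall>v\<in>\<Omega>. co_psi T x t \<bullet> v \<le> co_psi T x t \<bullet> u t)}"
    show "t \<in> (\<Union>v\<in>D. {t. 0 \<le> t \<and> co_psi T x t \<bullet> u t < co_psi T x t \<bullet> v})"
    proof (rule ccontr)
      assume "\<not> ?thesis"
      then have "D \<subseteq> {v. co_psi T x t \<bullet> v \<le> co_psi T x t \<bullet> u t}" using t by auto
      then have "closure D \<subseteq> {v. co_psi T x t \<bullet> v \<le> co_psi T x t \<bullet> u t}"
        by (rule closure_minimal) (rule closed_halfspace_le)
      then show False using t D(3) by auto
    qed
  qed
  then have "AE t in lebesgue_on {0..}. \<forall>v\<in>\<Omega>. co_psi T x t \<bullet> v \<le> co_psi T x t \<bullet> u t"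
    by (rule negligible_AE_lebesgue_on)
  with sys(1,2) show ?thesis unfolding adjoint_def by blast
qed

text \<open>After time \<open>T\<close> the maximum condition forces \<open>\<langle>\<psi>, u\<rangle> \<ge> r |\<psi>|\<close>, while the integral of
  \<open>\<langle>\<psi>, u\<rangle>\<close> vanishes because the velocity does.\<close>

lemma adjoint_vanishes:
  assumes adm: "admissible \<Omega> x0 y0 x y u" and adj: "adjoint \<Omega> x u \<phi> \<psi>"
    and z: "\<And>t. T \<le> t \<Longrightarrow> x t = 0" "\<And>t. T \<le> t \<Longrightarrow> y t = 0" and T: "0 \<le> T" and t: "T \<le> t"
  shows "\<phi> t = 0" "\<psi> t = 0"
proof -
  note cx = admissible_continuous(1)[OF adm order_refl]
  note eqs = adjoint_eqs[OF adj]
  note der = adjoint_regular[OF cx adj]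
  obtain Z where Z: "negligible Z"
    and max: "\<And>s. 0 \<le> s \<Longrightarrow> s \<notin> Z \<Longrightarrow> \<forall>v\<in>\<Omega>. \<psi> s \<bullet> v \<le> \<psi> s \<bullet> u s"
  proof (rule AE_lebesgue_on_negligible)
    show "AE s in lebesgue_on {0..}. \<forall>v\<in>\<Omega>. \<psi> s \<bullet> v \<le> \<psi> s \<bullet> u s" using adj by (simp add: adjoint_def)
  qed (rule that)
  have psi0: "\<psi> s = 0" if s: "T \<le> s" for s
  proof -
    \<comment> \<open>Positive length of \<open>{T..c}\<close> allows a vanishing integral of a
      continuous nonnegative function to be turned into vanishing at every point, also at
      \<open>s = T\<close>.\<close>
    define c where "c = s + 1"
    have Tc: "0 \<le> c" "T < c" using s T by (auto simp: c_def)
    have cpsi: "continuous_on {T..c} \<psi>" by (rule continuous_on_subset[OF der(4)]) (use T in auto)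
    have "integral {T..c} (\<lambda>s. \<psi> s \<bullet> u s) = \<psi> c \<bullet> y c - \<psi> T \<bullet> y T + integral {T..c} (\<lambda>s. \<phi> s \<bullet> y s)"
    proof (rule integration_by_parts_indefinite[where R=R])
      show "u \<in> borel_measurable (lebesgue_on {T..c})" by (rule admissible_measurable[OF adm T])
      show "y s = y T + integral {T..s} u" if "s \<in> {T..c}" for s
        using that by (intro admissible_increment[OF adm T]) auto
      show "(\<psi> has_vector_derivative - \<phi> s) (at s within {T..c})" if "s \<in> {T..c}" for s
        using that T by (intro has_vector_derivative_within_subset[OF der(2)]) auto
      show "continuous_on {T..c} \<phi>" by (rule continuous_on_subset[OF der(3)]) (use T in auto)
    qed (use Tc T admissible_bound(2)[OF adm] in auto)
    also have "integral {T..c} (\<lambda>s. \<phi> s \<bullet> y s) = integral {T..c} (\<lambda>s. 0)"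
      by (rule Henstock_Kurzweil_Integration.integral_cong) (use z in auto)
    finally have 0: "integral {T..c} (\<lambda>s. \<psi> s \<bullet> u s) = 0" using z Tc by simp
    have ci: "continuous_on {T..c} (\<lambda>s. r * norm (\<psi> s))" by (intro continuous_intros cpsi)
    have "integral {T..c} (\<lambda>s. r * norm (\<psi> s)) \<le> integral {T..c} (\<lambda>s. \<psi> s \<bullet> u s)"
    proof (rule integral_le_negligible[OF Z])
      show "(\<lambda>s. r * norm (\<psi> s)) integrable_on {T..c}" by (rule integrable_continuous_real[OF ci])
      show "(\<lambda>s. \<psi> s \<bullet> u s) integrable_on {T..c}" by (rule inner_control_integrable[OF adm der(4) T])
      fix s assume "s \<in> {T..c} - Z"
      then have m: "\<forall>v\<in>\<Omega>. \<psi> s \<bullet> v \<le> \<psi> s \<bullet> u s" using max T by auto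
      \<comment> \<open>The point of the ball of radius \<open>r\<close> in the direction of
        \<open>\<psi> s\<close>; when \<open>\<psi> s = 0\<close> it is the zero vector.\<close>
      define v where "v = (r / norm (\<psi> s)) *\<^sub>R \<psi> s"
      have "norm v \<le> r" using r_pos by (simp add: v_def)
      then have "v \<in> \<Omega>" using ball by auto
      moreover have "\<psi> s \<bullet> v = r * norm (\<psi> s)"
        by (cases "\<psi> s = 0") (auto simp: v_def dot_square_norm power2_eq_square)
      ultimately show "r * norm (\<psi> s) \<le> \<psi> s \<bullet> u s" using m by metis
    qed
    moreover have "0 \<le> integral {T..c} (\<lambda>s. r * norm (\<psi> s))"
      by (rule Henstock_Kurzweil_Integration.integral_nonneg[OF integrable_continuous_real[OF ci]]) (use r_pos in simp)
    ultimately have "integral {T..c} (\<lambda>s. r * norm (\<psi> s)) = 0" using 0 by simp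
    with integrable_integral[OF integrable_continuous_real[OF ci]]
    have "((\<lambda>s. r * norm (\<psi> s)) has_integral 0) (cbox T c)"
      by (simp only: cbox_interval)
    then have "r * norm (\<psi> s) = 0"
      by (rule has_integral_0_cbox_imp_0[rotated 2]) (use ci r_pos Tc s in \<open>auto simp: c_def\<close>)
    then show ?thesis using r_pos by simp
  qed
  then show "\<psi> t = 0" using t by blast
  \<comment> \<open>As \<open>x\<close> vanishes after \<open>T\<close>, \<open>\<phi>\<close> is
    constant there; \<open>\<psi>\<close> being zero at both \<open>t\<close> and
    \<open>t + 1\<close> then forces this constant to be 0.\<close>
  have const: "\<phi> s = \<phi> t" if "t \<le> s" for s
  proof -
    have "\<phi> s - \<phi> t = integral {t..s} x"
      using eqs(1)[of s] eqs(1)[of t] that t T integral_split_interval[OF integrable_on_continuous_atLeast[OF cx], of 0 t s] by simp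
    also have "\<dots> = integral {t..s} (\<lambda>_. 0)"
      by (rule Henstock_Kurzweil_Integration.integral_cong) (use z t in auto)
    finally show ?thesis by simp
  qed
  have "\<psi> t - \<psi> (t + 1) = integral {0..t+1} \<phi> - integral {0..t} \<phi>"
    using eqs(2)[of t] eqs(2)[of "t+1"] t T by simp
  also have "\<dots> = integral {t..t+1} \<phi>"
    using t T by (intro integral_split_interval integrable_on_continuous_atLeast[OF der(3)]) auto
  also have "\<dots> = integral {t..t+1} (\<lambda>_. \<phi> t)"
    by (intro Henstock_Kurzweil_Integration.integral_cong const) auto
  finally show "\<phi> t = 0" using psi0[of t] psi0[of "t+1"] t by simp
qed

lemma adjoint_unique:
  assumes adm: "admissible \<Omega> x0 y0 x y u" and adj: "adjoint \<Omega> x u \<phi> \<psi>"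
    and z: "\<And>t. T \<le> t \<Longrightarrow> x t = 0" "\<And>t. T \<le> t \<Longrightarrow> y t = 0" and T: "0 \<le> T" and t: "0 \<le> t"
  shows "\<phi> t = co_phi T x t" "\<psi> t = co_psi T x t"
proof -
  note cx = admissible_continuous(1)[OF adm order_refl]
  have z': "\<forall>t>T. x t = 0" using z by auto
  note sys = co_phi_psi[OF cx z' T]
  note eqs = adjoint_eqs[OF adj]
  have 1: "\<phi> s = co_phi T x s" if "0 \<le> s" for s
  proof -
    have "\<phi> 0 = - integral {0..T} x"
      using eqs(1)[OF T] adjoint_vanishes(1)[OF adm adj z T, of T] by (simp add: eq_neg_iff_add_eq_0)
    moreover have "co_phi T x 0 = - integral {0..T} x" by (simp add: co_phi_def)
    ultimately show ?thesis using eqs(1)[OF that] sys(1)[OF that] by simp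
  qed
  then show "\<phi> t = co_phi T x t" using t by simp
  have int: "integral {0..s} \<phi> = integral {0..s} (co_phi T x)" for s
    by (rule Henstock_Kurzweil_Integration.integral_cong) (use 1 in auto)
  have "\<psi> 0 = integral {0..T} (co_phi T x)"
    using eqs(2)[OF T] adjoint_vanishes(2)[OF adm adj z T, of T] by (simp add: int)
  moreover have "co_psi T x 0 = integral {0..T} (co_phi T x)" by (simp add: co_psi_def)
  ultimately show "\<psi> t = co_psi T x t"
    using eqs(2)[OF t] sys(2)[OF t] by (simp add: int)
qed

end

subsection \<open>Extremals\<close>

text \<open>Cauchy-Schwarz, obtained by integrating the square of \<open>|x|\<close> minus its mean
  \<open>S / b\<close>.\<close>

lemma integral_norm_squared_le:
  fixes x :: "real \<Rightarrow> 'a::euclidean_space"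
  assumes x: "continuous_on {0..b} x" and b: "0 \<le> b"
  shows "(integral {0..b} (\<lambda>t. norm (x t)))\<^sup>2 \<le> b * energy x 0 b"
proof (cases "b = 0")
  case False
  then have b: "0 < b" using b by simp
  define S where "S = integral {0..b} (\<lambda>t. norm (x t))"
  have "((\<lambda>t. x t \<bullet> x t - (2 * (S / b)) * norm (x t) + (S / b)\<^sup>2) has_integral
      (energy x 0 b - (2 * (S / b)) * S + (S / b)\<^sup>2 * b)) {0..b}"
    unfolding S_def
    by (intro has_integral_add has_integral_diff has_integral_mult_right integrable_integral
        integrable_continuous_real continuous_intros x)
       (use has_integral_const_real[of "(integral {0..b} (\<lambda>t. norm (x t)) / b)\<^sup>2" 0 b] b in \<open>simp add: mult.commute\<close>)
  moreover have "0 \<le> x t \<bullet> x t - (2 * (S / b)) * norm (x t) + (S / b)\<^sup>2" for t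
  proof -
    have "0 \<le> (norm (x t) - S / b)\<^sup>2" by simp
    also have "\<dots> = x t \<bullet> x t - (2 * (S / b)) * norm (x t) + (S / b)\<^sup>2"
      by (simp add: power2_diff power2_norm_eq_inner algebra_simps)
    finally show ?thesis .
  qed
  ultimately have "0 \<le> energy x 0 b - (2 * (S / b)) * S + (S / b)\<^sup>2 * b"
    by (rule has_integral_nonneg)
  also have "\<dots> = energy x 0 b - S\<^sup>2 / b" using b by (simp add: power2_eq_square field_simps)
  finally show ?thesis using b by (simp add: S_def field_simps)
qed simp

context control_set
begin

text \<open>\<open>T\<close> is some time from which everything is zero, not necessarily the first.
  Two extremals can then be compared on a common horizon.\<close>

definition extremal where
  "extremal x0 y0 x y \<phi> \<psi> T \<longleftrightarrow> 0 \<le> T \<and>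
     (\<exists>u. admissible \<Omega> x0 y0 x y u \<and> adjoint \<Omega> x u \<phi> \<psi>) \<and>
     (\<forall>t\<ge>T. x t = 0 \<and> y t = 0 \<and> \<phi> t = 0 \<and> \<psi> t = 0)"

lemma extremal_mono:
  "extremal x0 y0 x y \<phi> \<psi> T \<Longrightarrow> T \<le> T' \<Longrightarrow> extremal x0 y0 x y \<phi> \<psi> T'"
  unfolding extremal_def by (meson order_trans)

lemma extremal_trivial: "0 \<le> T \<Longrightarrow> extremal 0 0 (\<lambda>_. 0) (\<lambda>_. 0) (\<lambda>_. 0) (\<lambda>_. 0) T"
  unfolding extremal_def admissible_def adjoint_def
  by (auto intro!: exI[of _ "\<lambda>_. 0"] zero_in)

lemma extremal_init:
  assumes "extremal x0 y0 x y \<phi> \<psi> T"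
  shows "x 0 = x0" "y 0 = y0"
  using assms admissible_init unfolding extremal_def by blast+

lemma extremal_path:
  assumes "extremal x0 y0 x y \<phi> \<psi> T"
  shows "lip_deriv_path R x y"
  using assms admissible_path unfolding extremal_def by blast

text \<open>Monotonicity of the extremal field: the maximum condition makes
  \<open>\<langle>\<delta>\<psi>, \<delta>u\<rangle>\<close> nonnegative.\<close>

lemma extremal_monotone:
  assumes 1: "extremal x0 y0 x y \<phi> \<psi> b" and 2: "extremal x0' y0' x' y' \<phi>' \<psi>' b"
    and a: "0 \<le> a" "a \<le> b"
  shows "energy (\<lambda>t. x t - x' t) a b
      \<le> - ((\<phi> a - \<phi>' a) \<bullet> (x a - x' a) + (\<psi> a - \<psi>' a) \<bullet> (y a - y' a))"
proof -
  obtain u where adm: "admissible \<Omega> x0 y0 x y u" and adj: "adjoint \<Omega> x u \<phi> \<psi>"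
    using 1 by (auto simp: extremal_def)
  obtain u' where adm': "admissible \<Omega> x0' y0' x' y' u'" and adj': "adjoint \<Omega> x' u' \<phi>' \<psi>'"
    using 2 by (auto simp: extremal_def)
  note eqs = adjoint_eqs[OF adj]
  note eqs' = adjoint_eqs[OF adj']
  note cx = admissible_continuous(1)[OF adm order_refl] and cx' = admissible_continuous(1)[OF adm' order_refl]
  note der = adjoint_regular[OF cx adj] and der' = adjoint_regular[OF cx' adj']
  have c\<psi>: "continuous_on {0..} (\<lambda>t. \<psi> t - \<psi>' t)" by (intro continuous_intros der der')
  have "integral {a..b} (\<lambda>t. (x t - x' t) \<bullet> (x t - x' t)) + integral {a..b} (\<lambda>t. (\<psi> t - \<psi>' t) \<bullet> (u t - u' t))
      = ((\<phi> b - \<phi>' b) \<bullet> (x b - x' b) + (\<psi> b - \<psi>' b) \<bullet> (y b - y' b))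
      - ((\<phi> a - \<phi>' a) \<bullet> (x a - x' a) + (\<psi> a - \<psi>' a) \<bullet> (y a - y' a))"
  proof (rule admissible_pairing[OF adm adm' a])
    fix t :: real assume t: "0 \<le> t"
    show "((\<lambda>t. \<psi> t - \<psi>' t) has_vector_derivative - (\<phi> t - \<phi>' t)) (at t within {0..})"
      using has_vector_derivative_diff[OF der(2)[OF t] der'(2)[OF t]] by simp
    show "((\<lambda>t. \<phi> t - \<phi>' t) has_vector_derivative x t - x' t) (at t within {0..})"
      by (rule has_vector_derivative_diff[OF der(1)[OF t] der'(1)[OF t]])
  qed (intro continuous_intros cx cx')
  moreover have "\<phi> b = 0 \<and> \<psi> b = 0" "\<phi>' b = 0 \<and> \<psi>' b = 0" using 1 2 by (auto simp: extremal_def)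
  moreover have "0 \<le> integral {a..b} (\<lambda>t. (\<psi> t - \<psi>' t) \<bullet> (u t - u' t))"
  proof -
    have "AE t in lebesgue_on {0..}. (\<forall>v\<in>\<Omega>. \<psi> t \<bullet> v \<le> \<psi> t \<bullet> u t) \<and> (\<forall>v\<in>\<Omega>. \<psi>' t \<bullet> v \<le> \<psi>' t \<bullet> u' t)"
      using adj adj' unfolding adjoint_def by (intro AE_conjI) blast+
    then obtain Z where Z: "negligible Z" and
      max: "\<And>t. 0 \<le> t \<Longrightarrow> t \<notin> Z \<Longrightarrow> (\<forall>v\<in>\<Omega>. \<psi> t \<bullet> v \<le> \<psi> t \<bullet> u t) \<and> (\<forall>v\<in>\<Omega>. \<psi>' t \<bullet> v \<le> \<psi>' t \<bullet> u' t)"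
      by (rule AE_lebesgue_on_negligible) (rule that)
    have "integral {a..b} (\<lambda>t. 0) \<le> integral {a..b} (\<lambda>t. (\<psi> t - \<psi>' t) \<bullet> (u t - u' t))"
    proof (rule integral_le_negligible[OF Z])
      show "(\<lambda>t. (\<psi> t - \<psi>' t) \<bullet> (u t - u' t)) integrable_on {a..b}"
        unfolding inner_diff_right
        by (intro Henstock_Kurzweil_Integration.integrable_diff inner_control_integrable[OF adm c\<psi> a(1)]
            inner_control_integrable[OF adm' c\<psi> a(1)])
      fix t assume "t \<in> {a..b} - Z"
      then have t: "0 \<le> t" "t \<notin> Z" using a by auto
      then have "\<psi> t \<bullet> u' t \<le> \<psi> t \<bullet> u t" "\<psi>' t \<bullet> u t \<le> \<psi>' t \<bullet> u' t"
        using max[OF t] admissible_bound(1)[OF adm t(1)] admissible_bound(1)[OF adm' t(1)] by auto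
      then show "0 \<le> (\<psi> t - \<psi>' t) \<bullet> (u t - u' t)" by (simp add: inner_diff_left inner_diff_right)
    qed (rule integrable_continuous_real[OF continuous_on_const])
    then show ?thesis by simp
  qed
  ultimately show ?thesis by simp
qed

lemma extremal_state_bound:
  assumes 1: "extremal x0 y0 x y \<phi> \<psi> b" and 2: "extremal x0' y0' x' y' \<phi>' \<psi>' b" and t: "0 \<le> t"
  shows "obs_const (R + R) * hnorm (x t - x' t) (y t - y' t) ^ 5 \<le> energy (\<lambda>t. x t - x' t) t b"
    and "obs_const (R + R) * hnorm (x t - x' t) (y t - y' t) ^ 5 \<le> energy (\<lambda>t. x t - x' t) 0 b"
proof -
  obtain u u' where adm: "admissible \<Omega> x0 y0 x y u" and adm': "admissible \<Omega> x0' y0' x' y' u'"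
    using 1 2 by (auto simp: extremal_def)
  have z: "x s = 0" "x' s = 0" if "s > b" for s using 1 2 that by (auto simp: extremal_def)
  show "obs_const (R + R) * hnorm (x t - x' t) (y t - y' t) ^ 5 \<le> energy (\<lambda>t. x t - x' t) t b"
    by (rule path_difference_bound[OF adm adm' z t])
  show "obs_const (R + R) * hnorm (x t - x' t) (y t - y' t) ^ 5 \<le> energy (\<lambda>t. x t - x' t) 0 b"
    by (rule path_difference_bound_0[OF adm adm' z t])
qed

lemma extremal_energy_le:
  assumes 1: "extremal x0 y0 x y \<phi> \<psi> b" and 2: "extremal x0' y0' x' y' \<phi>' \<psi>' b"
  shows "energy (\<lambda>t. x t - x' t) 0 b
    \<le> dist (\<phi> 0, \<psi> 0) (\<phi>' 0, \<psi>' 0) * dist (x0, y0) (x0', y0')"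
proof -
  have b: "0 \<le> b" using 1 by (simp add: extremal_def)
  have "energy (\<lambda>t. x t - x' t) 0 b \<le> - ((\<phi> 0 - \<phi>' 0, \<psi> 0 - \<psi>' 0) \<bullet> (x0 - x0', y0 - y0'))"
    using extremal_monotone[OF 1 2 order_refl b] extremal_init[OF 1] extremal_init[OF 2] by simp
  also have "\<dots> \<le> \<bar>(\<phi> 0 - \<phi>' 0, \<psi> 0 - \<psi>' 0) \<bullet> (x0 - x0', y0 - y0')\<bar>" by simp
  also have "\<dots> \<le> norm (\<phi> 0 - \<phi>' 0, \<psi> 0 - \<psi>' 0) * norm (x0 - x0', y0 - y0')"
    by (rule Cauchy_Schwarz_ineq2)
  finally show ?thesis by (simp add: dist_norm)
qed

text \<open>Backward integration gives \<open>P <= (1 + b) * S\<close>, while Cauchy-Schwarz and the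
  energy bound give \<open>S^2 <= b * P * Q\<close>. Hence
  \<open>P^2 <= (1 + b)^2 * b * P * Q\<close>, and one factor \<open>P\<close> cancels. The data
  enter the constant only through the horizon.\<close>

lemma extremal_lipschitz:
  assumes 1: "extremal x0 y0 x y \<phi> \<psi> b" and 2: "extremal x0' y0' x' y' \<phi>' \<psi>' b"
  shows "dist (\<phi> 0, \<psi> 0) (\<phi>' 0, \<psi>' 0) \<le> (1 + b)\<^sup>2 * b * dist (x0, y0) (x0', y0')"
proof -
  define P where "P = dist (\<phi> 0, \<psi> 0) (\<phi>' 0, \<psi>' 0)"
  define Q where "Q = dist (x0, y0) (x0', y0')"
  define S where "S = integral {0..b} (\<lambda>t. norm (x t - x' t))"
  have b: "0 \<le> b" using 1 by (simp add: extremal_def)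
  obtain u where adm: "admissible \<Omega> x0 y0 x y u" and adj: "adjoint \<Omega> x u \<phi> \<psi>"
    using 1 by (auto simp: extremal_def)
  obtain u' where adm': "admissible \<Omega> x0' y0' x' y' u'" and adj': "adjoint \<Omega> x' u' \<phi>' \<psi>'"
    using 2 by (auto simp: extremal_def)
  note eqs = adjoint_eqs[OF adj]
  note eqs' = adjoint_eqs[OF adj']
  note cx = admissible_continuous(1)[OF adm order_refl] and cx' = admissible_continuous(1)[OF adm' order_refl]
  note der = adjoint_regular[OF cx adj] and der' = adjoint_regular[OF cx' adj']
  have end0: "\<phi> b = 0" "\<psi> b = 0" "\<phi>' b = 0" "\<psi>' b = 0" using 1 2 by (auto simp: extremal_def)
  have cd: "continuous_on {0..} (\<lambda>t. x t - x' t)" by (intro continuous_intros cx cx')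
  have cn: "(\<lambda>t. norm (x t - x' t)) integrable_on {a..b}" if "0 \<le> a" for a
    by (rule integrable_on_continuous_atLeast) (use that cd in \<open>auto intro!: continuous_intros\<close>)
  have ix: "x integrable_on {a..c}" "x' integrable_on {a..c}" "\<phi> integrable_on {a..c}" "\<phi>' integrable_on {a..c}"
    if "0 \<le> a" for a c
    using that cx cx' der(3) der'(3) by (auto intro: integrable_on_continuous_atLeast)
  have \<phi>S: "norm (\<phi> t - \<phi>' t) \<le> S" if t: "t \<in> {0..b}" for t
  proof -
    have t': "0 \<le> t" "t \<le> b" using t by auto
    have "\<phi> b - \<phi> t = integral {0..b} x - integral {0..t} x"
      using eqs(1)[OF b] eqs(1)[OF t'(1)] by simp
    also have "\<dots> = integral {t..b} x" by (rule integral_split_interval[OF ix(1)[OF order_refl] t'])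
    finally have A: "\<phi> t = - integral {t..b} x" using end0 by (metis add.inverse_inverse diff_0)
    have "\<phi>' b - \<phi>' t = integral {0..b} x' - integral {0..t} x'"
      using eqs'(1)[OF b] eqs'(1)[OF t'(1)] by simp
    also have "\<dots> = integral {t..b} x'" by (rule integral_split_interval[OF ix(2)[OF order_refl] t'])
    finally have B: "\<phi>' t = - integral {t..b} x'" using end0 by (metis add.inverse_inverse diff_0)
    have "\<phi> t - \<phi>' t = - integral {t..b} (\<lambda>s. x s - x' s)"
      by (simp add: A B Henstock_Kurzweil_Integration.integral_diff ix t')
    then have "norm (\<phi> t - \<phi>' t) = norm (integral {t..b} (\<lambda>s. x s - x' s))" by simp
    also have "\<dots> \<le> integral {t..b} (\<lambda>s. norm (x s - x' s))"
      by (rule Henstock_Kurzweil_Integration.integral_norm_bound_integral)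
         (use t' cn in \<open>auto intro!: Henstock_Kurzweil_Integration.integrable_diff ix\<close>)
    also have "\<dots> \<le> S" unfolding S_def by (rule integral_subset_le) (use t' cn in auto)
    finally show ?thesis .
  qed
  have \<psi>S: "norm (\<psi> 0 - \<psi>' 0) \<le> S * b"
  proof -
    have "\<psi> 0 = integral {0..b} \<phi>" "\<psi>' 0 = integral {0..b} \<phi>'"
      using eqs(2)[OF b] eqs'(2)[OF b] end0 by simp_all
    then have "\<psi> 0 - \<psi>' 0 = integral {0..b} (\<lambda>t. \<phi> t - \<phi>' t)"
      by (simp add: Henstock_Kurzweil_Integration.integral_diff ix)
    also have "norm \<dots> \<le> S * (b - 0)"
      by (rule norm_integral_le_const) (use b \<phi>S ix in \<open>auto intro!: Henstock_Kurzweil_Integration.integrable_diff\<close>)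
    finally show ?thesis by simp
  qed
  have P: "P \<le> (1 + b) * S"
  proof -
    have "P = norm (\<phi> 0 - \<phi>' 0, \<psi> 0 - \<psi>' 0)" by (simp add: P_def dist_norm)
    also have "\<dots> \<le> norm (\<phi> 0 - \<phi>' 0) + norm (\<psi> 0 - \<psi>' 0)" by (rule norm_Pair_le)
    also have "\<dots> \<le> S + S * b" using \<phi>S[of 0] \<psi>S b by (intro add_mono) auto
    finally show ?thesis by (simp add: algebra_simps)
  qed
  have "S\<^sup>2 \<le> b * energy (\<lambda>t. x t - x' t) 0 b"
    unfolding S_def by (intro integral_norm_squared_le b continuous_on_subset[OF cd]) auto
  also have "\<dots> \<le> b * (P * Q)"
    using extremal_energy_le[OF 1 2] b by (intro mult_left_mono) (auto simp: P_def Q_def)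
  finally have S: "S\<^sup>2 \<le> b * (P * Q)" .
  have "P * P \<le> ((1 + b) * S)\<^sup>2"
    using P by (metis P_def power2_eq_square power_mono zero_le_dist)
  also have "\<dots> \<le> (1 + b)\<^sup>2 * (b * (P * Q))" using S by (simp add: power_mult_distrib mult_left_mono)
  finally have "P * P \<le> P * ((1 + b)\<^sup>2 * b * Q)" by (simp add: mult_ac)
  then have "P \<le> (1 + b)\<^sup>2 * b * Q" if "P > 0" using that by simp
  moreover have "0 \<le> (1 + b)\<^sup>2 * b * Q" using b by (simp add: Q_def)
  ultimately show ?thesis using zero_le_dist[of "(\<phi> 0, \<psi> 0)" "(\<phi>' 0, \<psi>' 0)"]
    unfolding P_def Q_def by linarith
qed

section \<open>Two-sided comparison of initial state, initial adjoint and extinction time\<close>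

lemma extremal_backward_bound:
  assumes ex: "extremal x0 y0 x y \<phi> \<psi> T" and t: "0 \<le> t" "t \<le> T"
  shows "norm (y t) \<le> R * (T - t)" "norm (x t) \<le> 2 * R * (T - t)\<^sup>2"
proof -
  have z: "x T = 0" "y T = 0" and T: "0 \<le> T" using ex by (auto simp: extremal_def)
  note path = extremal_path[OF ex]
  have "norm (y T - y t) \<le> R * \<bar>T - t\<bar>" by (rule lip_deriv_path_lipschitz[OF path t(1) T])
  then show y: "norm (y t) \<le> R * (T - t)" using z t by simp
  have "norm (x T - x t - (T - t) *\<^sub>R y t) \<le> R * (T - t)\<^sup>2" by (rule lip_deriv_path_taylor[OF path t])
  then have *: "norm (x t + (T - t) *\<^sub>R y t) \<le> R * (T - t)\<^sup>2"
    using z norm_minus_cancel[of "x t + (T - t) *\<^sub>R y t"] by simp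
  have "norm (x t) = norm ((x t + (T - t) *\<^sub>R y t) - (T - t) *\<^sub>R y t)" by simp
  also have "\<dots> \<le> R * (T - t)\<^sup>2 + norm ((T - t) *\<^sub>R y t)"
    using * by (intro order_trans[OF norm_triangle_ineq4] add_right_mono)
  also have "norm ((T - t) *\<^sub>R y t) \<le> (T - t) * (R * (T - t))"
    using y t by (auto intro: mult_left_mono)
  finally show "norm (x t) \<le> 2 * R * (T - t)\<^sup>2" by (simp add: power2_eq_square algebra_simps)
qed

lemma extremal_hnorm_le:
  assumes ex: "extremal x0 y0 x y \<phi> \<psi> T"
  shows "hnorm x0 y0 \<le> 2 * R * T"
proof -
  have T: "0 \<le> T" using ex by (simp add: extremal_def)
  have RT: "0 \<le> R * T" using R_ge_1 T by simp
  have y: "norm y0 \<le> R * T" and x: "norm x0 \<le> 2 * R * T\<^sup>2"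
    using extremal_backward_bound[OF ex order_refl T] extremal_init[OF ex] by auto
  have "2 * R * T\<^sup>2 \<le> (2 * R) * (2 * R * T\<^sup>2)" using R_ge_1 mult_right_mono[of 1 "2 * R" "2 * R * T\<^sup>2"] by simp
  then have "norm x0 \<le> (2 * R * T)\<^sup>2" using x by (simp add: power2_eq_square mult_ac)
  then have "sqrt (norm x0) \<le> 2 * R * T" using RT by (intro real_le_lsqrt) auto
  then show ?thesis using y RT by (simp add: hnorm_def)
qed

text \<open>The counterpart of \<open>hnorm\<close> for the adjoint pair, whose entries have weights
  3 and 4.\<close>

definition adjoint_hnorm :: "U \<Rightarrow> U \<Rightarrow> real" where
  "adjoint_hnorm \<phi> \<psi> = max (root 3 (norm \<phi>)) (root 4 (norm \<psi>))"

lemma extremal_adjoint_le: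
  assumes ex: "extremal x0 y0 x y \<phi> \<psi> T"
  shows "adjoint_hnorm (\<phi> 0) (\<psi> 0) \<le> 2 * R * T"
proof -
  have T: "0 \<le> T" and z: "\<phi> T = 0" "\<psi> T = 0" using ex by (auto simp: extremal_def)
  obtain u where adm: "admissible \<Omega> x0 y0 x y u" and adj: "adjoint \<Omega> x u \<phi> \<psi>"
    using ex by (auto simp: extremal_def)
  note eqs = adjoint_eqs[OF adj]
  note cx = admissible_continuous(1)[OF adm order_refl]
  note der = adjoint_regular[OF cx adj]
  have bx: "norm (x t) \<le> 2 * R * T\<^sup>2" if "t \<in> {0..T}" for t
  proof -
    have "norm (x t) \<le> 2 * R * (T - t)\<^sup>2" using extremal_backward_bound(2)[OF ex, of t] that by auto
    also have "\<dots> \<le> 2 * R * T\<^sup>2" using that R_ge_1 by (intro mult_left_mono power_mono) auto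
    finally show ?thesis .
  qed
  have b\<phi>: "norm (\<phi> t) \<le> 2 * R * T ^ 3" if t: "t \<in> {0..T}" for t
  proof -
    have t': "0 \<le> t" "t \<le> T" using t by auto
    have "\<phi> T - \<phi> t = integral {0..T} x - integral {0..t} x"
      using eqs(1)[OF T] eqs(1)[OF t'(1)] by simp
    also have "\<dots> = integral {t..T} x"
      by (rule integral_split_interval[OF integrable_on_continuous_atLeast[OF cx order_refl] t'])
    finally have "norm (\<phi> t) = norm (integral {t..T} x)" using z by (metis diff_0 norm_minus_cancel)
    also have "\<dots> \<le> 2 * R * T\<^sup>2 * (T - t)"
      by (rule norm_integral_le_const) (use t' bx cx in \<open>auto intro: integrable_on_continuous_atLeast\<close>)
    also have "\<dots> \<le> 2 * R * T\<^sup>2 * T" using t' R_ge_1 by (intro mult_left_mono) auto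
    finally show ?thesis by (simp add: power2_eq_square power3_eq_cube)
  qed
  have "\<psi> 0 = integral {0..T} \<phi>" using eqs(2)[OF T] z by simp
  then have "norm (\<psi> 0) \<le> 2 * R * T ^ 3 * (T - 0)"
    using norm_integral_le_const[OF integrable_on_continuous_atLeast[OF der(3) order_refl] T b\<phi>] by simp
  then have \<psi>: "norm (\<psi> 0) \<le> 2 * R * T ^ 4" by (simp add: eval_nat_numeral mult_ac)
  \<comment> \<open>Since \<open>2 * R >= 1\<close>, the constant may be put under the power, so
    that the cube and fourth roots both give \<open>2 * R * T\<close>.\<close>
  have le: "2 * R * T ^ n \<le> (2 * R * T) ^ n" if "n > 0" for n
  proof -
    have "(2 * R) ^ 1 \<le> (2 * R) ^ n" using that R_ge_1 by (intro power_increasing) auto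
    then show ?thesis using T by (simp add: power_mult_distrib mult_right_mono)
  qed
  have RT: "0 \<le> 2 * R * T" using T R_ge_1 by simp
  have "root 3 (norm (\<phi> 0)) \<le> root 3 ((2 * R * T) ^ 3)"
    using order_trans[OF b\<phi>[of 0] le[of 3]] T by simp
  moreover have "root 4 (norm (\<psi> 0)) \<le> root 4 ((2 * R * T) ^ 4)"
    using order_trans[OF \<psi> le[of 4]] by simp
  ultimately show ?thesis using RT by (simp add: adjoint_hnorm_def real_root_power_cancel)
qed

text \<open>In the next proof, \<open>k >= 1\<close> gives \<open>P <= N\<close> from
  \<open>k * P < N\<close>, and \<open>c * k >= 2\<close> produces the contradiction.\<close>

definition adjoint_const :: real where "adjoint_const = max 1 (2 / obs_const (R + R))"

text \<open>Against the zero extremal, monotonicity and observability give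
  \<open>c * N^5 <= P^3 * N^2 + P^4 * N\<close>, all terms of weight 5. If \<open>P\<close> were
  small compared with \<open>N\<close>, the right-hand side would be at most
  \<open>2 * P * N^4\<close>, too small.\<close>

lemma extremal_adjoint_ge:
  assumes ex: "extremal x0 y0 x y \<phi> \<psi> T"
  shows "hnorm x0 y0 \<le> adjoint_const * adjoint_hnorm (\<phi> 0) (\<psi> 0)"
proof (rule ccontr)
  define N where "N = hnorm x0 y0"
  define P where "P = adjoint_hnorm (\<phi> 0) (\<psi> 0)"
  define k where "k = adjoint_const"
  define c where "c = obs_const (R + R)"
  have c: "c > 0" using obs_const_2R_pos by (simp add: c_def)
  have k: "k \<ge> 1" "2 \<le> c * k" using c by (auto simp: k_def c_def adjoint_const_def max_def field_simps)
  assume "\<not> hnorm x0 y0 \<le> adjoint_const * adjoint_hnorm (\<phi> 0) (\<psi> 0)"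
  then have kP: "k * P < N" by (simp add: N_def P_def k_def)
  have P0: "0 \<le> P" by (simp add: P_def adjoint_hnorm_def max_def)
  then have N: "N > 0" using kP k by (meson le_less_trans mult_nonneg_nonneg order_trans zero_le_one)
  have T: "0 \<le> T" using ex by (simp add: extremal_def)
  have \<phi>P: "norm (\<phi> 0) \<le> P ^ 3"
  proof -
    have "norm (\<phi> 0) = root 3 (norm (\<phi> 0)) ^ 3" by simp
    also have "\<dots> \<le> P ^ 3" by (intro power_mono) (auto simp: P_def adjoint_hnorm_def)
    finally show ?thesis .
  qed
  have \<psi>P: "norm (\<psi> 0) \<le> P ^ 4"
  proof -
    have "norm (\<psi> 0) = root 4 (norm (\<psi> 0)) ^ 4" by simp
    also have "\<dots> \<le> P ^ 4" by (intro power_mono) (auto simp: P_def adjoint_hnorm_def)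
    finally show ?thesis .
  qed
  note triv = extremal_trivial[OF T]
  have "c * N ^ 5 \<le> energy (\<lambda>t. x t - 0) 0 T"
    using extremal_state_bound(2)[OF ex triv order_refl] extremal_init[OF ex] by (simp add: c_def N_def)
  also have "\<dots> \<le> - (\<phi> 0 \<bullet> x0 + \<psi> 0 \<bullet> y0)"
    using extremal_monotone[OF ex triv order_refl T] extremal_init[OF ex] by simp
  also have "\<dots> \<le> \<bar>\<phi> 0 \<bullet> x0\<bar> + \<bar>\<psi> 0 \<bullet> y0\<bar>" by linarith
  also have "\<dots> \<le> norm (\<phi> 0) * norm x0 + norm (\<psi> 0) * norm y0"
    by (intro add_mono Cauchy_Schwarz_ineq2)
  also have "\<dots> \<le> P ^ 3 * N\<^sup>2 + P ^ 4 * N"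
    using P0 \<phi>P \<psi>P by (intro add_mono mult_mono) (auto simp: N_def norm_le_hnorm)
  finally have main: "c * N ^ 5 \<le> P ^ 3 * N\<^sup>2 + P ^ 4 * N" .
  have PN: "P \<le> N" using mult_right_mono[OF k(1) P0] kP by simp
  have "P ^ 3 * N\<^sup>2 \<le> P * N ^ 4"
  proof -
    have "P ^ 3 * N\<^sup>2 = P * (P\<^sup>2 * N\<^sup>2)" by (simp add: power2_eq_square power3_eq_cube)
    also have "\<dots> \<le> P * (N\<^sup>2 * N\<^sup>2)" using P0 PN by (intro mult_left_mono mult_right_mono power_mono) auto
    finally show ?thesis by (simp add: power2_eq_square eval_nat_numeral)
  qed
  moreover have "P ^ 4 * N \<le> P * N ^ 4"
  proof -
    have "P ^ 4 * N = P * (P ^ 3 * N)" by (simp add: eval_nat_numeral)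
    also have "\<dots> \<le> P * (N ^ 3 * N)" using P0 PN N by (intro mult_left_mono mult_right_mono power_mono) auto
    finally show ?thesis by (simp add: eval_nat_numeral)
  qed
  ultimately have "N ^ 4 * (c * N) \<le> N ^ 4 * (2 * P)" using main by (simp add: eval_nat_numeral algebra_simps)
  then have "c * N \<le> 2 * P" using N by simp
  also have "\<dots> \<le> c * k * P" using k P0 by (intro mult_right_mono)
  also have "\<dots> < c * N" using kP c by (simp add: mult.assoc)
  finally show False by simp
qed

end

subsection \<open>The optimal synthesis\<close>

lemma hnorm_le_norm: "hnorm x y \<le> 1 + norm (x, y)"
proof -
  have "sqrt (norm x) \<le> 1 + norm x"
    by (rule real_le_lsqrt) (auto simp: power2_eq_square algebra_simps)
  also have "\<dots> \<le> 1 + norm (x, y)" using norm_fst_le[of x y] by simp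
  finally show ?thesis using norm_snd_le[of y x] by (simp add: hnorm_def)
qed

lemma norm_le_hnorm_Pair: "norm (x, y) \<le> (hnorm x y)\<^sup>2 + hnorm x y"
  using norm_Pair_le[of x y] norm_le_hnorm[of y x] norm_le_hnorm(2)[of x y] by linarith

text \<open>The range is open by invariance of domain. Coercivity confines the points mapped near a
  limit point to a ball, whose image is compact, so the range is also closed; connectedness makes it
  the whole space.\<close>

lemma bij_of_inj_coercive:
  fixes F :: "'a::euclidean_space \<Rightarrow> 'a"
  assumes c: "continuous_on UNIV F" and i: "inj F"
    and co: "\<And>B. \<exists>s. \<forall>q. norm (F q) \<le> B \<longrightarrow> norm q \<le> s"
  shows "bij F"
proof -
  have "open (range F)" by (rule invariance_of_domain[OF c open_UNIV i])
  moreover have "closed (range F)"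
  proof -
    have "p \<in> range F" if p: "p \<in> closure (range F)" for p
    proof -
      obtain s where s: "\<And>q. norm (F q) \<le> norm p + 1 \<Longrightarrow> norm q \<le> s" using co[of "norm p + 1"] by blast
      have "compact (F ` cball 0 s)"
        by (intro compact_continuous_image continuous_on_subset[OF c]) auto
      then have cl: "closed (F ` cball 0 s)" by (rule compact_imp_closed)
      have "p \<in> closure (F ` cball 0 s)"
        unfolding closure_approachable
      proof (intro allI impI)
        fix e :: real assume "0 < e"
        then have "\<exists>y\<in>range F. dist y p < min e 1"
          using p unfolding closure_approachable by (meson min_less_iff_conj zero_less_one)
        then obtain q where q: "dist (F q) p < e" "dist (F q) p < 1" by auto
        have "norm (F q) \<le> norm p + 1"
          using q(2) norm_triangle_sub[of "F q" p] by (simp add: dist_norm)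
        then have "F q \<in> F ` cball 0 s" using s by auto
        then show "\<exists>y\<in>F ` cball 0 s. dist y p < e" using q(1) by blast
      qed
      then show ?thesis using cl by (auto simp: closure_closed)
    qed
    then show ?thesis using closure_subset_eq by blast
  qed
  ultimately have "range F = UNIV" using clopen by blast
  then show ?thesis using i by (simp add: bij_def)
qed

context control_set
begin

text \<open>Everything asserted at a single initial state. The control is quantified over because
  the trajectory fixes it only almost everywhere. The last clause, a bound on the extinction time
  restarted at every \<open>a\<close>, carries the continuity of \<open>T\<close>.\<close>

definition synthesis where
  "synthesis x0 y0 x y \<phi> \<psi> T \<longleftrightarrow> optimal \<Omega> x0 y0 x y \<and> extremal x0 y0 x y \<phi> \<psi> T \<and>
     (\<forall>u. admissible \<Omega> x0 y0 x y u \<longrightarrow> adjoint \<Omega> x u \<phi> \<psi> \<and>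
        (\<forall>\<phi>' \<psi>'. adjoint \<Omega> x u \<phi>' \<psi>' \<longrightarrow> (\<forall>t\<ge>0. \<phi>' t = \<phi> t \<and> \<psi>' t = \<psi> t))) \<and>
     (\<forall>t. 0 \<le> t \<and> t < T \<longrightarrow> (x t, y t) \<noteq> (0, 0) \<and> (\<phi> t, \<psi> t) \<noteq> (0, 0)) \<and>
     (\<forall>a\<ge>0. T \<le> a + extinction_const * hnorm (x a) (y a))"

lemma hnorm_pow_le_0:
  assumes "obs_const (R + R) * hnorm v w ^ 5 \<le> 0"
  shows "v = 0" "w = 0"
proof -
  have "hnorm v w = 0"
    using assms obs_const_2R_pos hnorm_nonneg[of v w]
    by (metis le_less mult_pos_pos not_le zero_less_power)
  then show "v = 0" "w = 0" by simp_all
qed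

lemma synthesis_exists: "\<exists>x y \<phi> \<psi> T. synthesis x0 y0 x y \<phi> \<psi> T"
proof -
  obtain x y u where adm: "admissible \<Omega> x0 y0 x y u" and opt: "optimal \<Omega> x0 y0 x y"
    by (rule optimal_exists)
  define S where "S = {t. 0 \<le> t \<and> x t = 0 \<and> y t = 0}"
  define T where "T = Inf S"
  have inS: "a + extinction_const * hnorm (x a) (y a) \<in> S" if "0 \<le> a" for a
  proof -
    have "0 \<le> extinction_const * hnorm (x a) (y a)" using extinction_const_pos by simp
    then show ?thesis using optimal_extinction[OF adm opt that order_refl] that by (simp add: S_def)
  qed
  have "closed {t \<in> {0..}. x t = 0}" "closed {t \<in> {0..}. y t = 0}"
    by (intro continuous_closed_preimage_constant admissible_continuous[OF adm] closed_atLeast order_refl)+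
  then have "closed ({t \<in> {0..}. x t = 0} \<inter> {t \<in> {0..}. y t = 0})" by (rule closed_Int)
  also have "{t \<in> {0..}. x t = 0} \<inter> {t \<in> {0..}. y t = 0} = S" by (auto simp: S_def)
  finally have clS: "closed S" .
  have bb: "bdd_below S" by (auto simp: S_def intro!: bdd_belowI[of _ 0])
  have TS: "T \<in> S" unfolding T_def using inS[OF order_refl] by (intro closed_contains_Inf bb clS) auto
  have Tle: "T \<le> t" if "t \<in> S" for t unfolding T_def by (rule cInf_lower[OF that bb])
  have T: "0 \<le> T" using TS by (simp add: S_def)
  \<comment> \<open>The infimum is attained, so the state at \<open>T\<close> is zero; the
    extinction bound restarted at \<open>T\<close> then takes effect at once.\<close>
  have z: "x t = 0" "y t = 0" if "T \<le> t" for t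
    using optimal_extinction[OF adm opt T, of t] TS that by (simp_all add: S_def hnorm_def)
  define \<phi> where "\<phi> = co_phi T x"
  define \<psi> where "\<psi> = co_psi T x"
  have adj: "adjoint \<Omega> x u' \<phi> \<psi>" if "admissible \<Omega> x0 y0 x y u'" for u'
    unfolding \<phi>_def \<psi>_def by (rule adjoint_exists[OF that opt z(1) T])
  have uni: "\<phi>' t = \<phi> t \<and> \<psi>' t = \<psi> t"
    if "admissible \<Omega> x0 y0 x y u'" "adjoint \<Omega> x u' \<phi>' \<psi>'" "0 \<le> t" for u' \<phi>' \<psi>' t
    using adjoint_unique[OF that(1,2) z T that(3)] by (simp add: \<phi>_def \<psi>_def)
  have "\<forall>t>T. x t = 0" using z by auto
  from co_phi_psi(3)[OF admissible_continuous(1)[OF adm order_refl] this T]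
  have ex: "extremal x0 y0 x y \<phi> \<psi> T"
    unfolding extremal_def using T z adm adj[OF adm] by (auto simp: \<phi>_def \<psi>_def)
  have nz: "(x t, y t) \<noteq> (0, 0)" if "0 \<le> t" "t < T" for t
    using Tle[of t] that by (auto simp: S_def)
  \<comment> \<open>Monotonicity against the zero extremal, started at \<open>t\<close>: a zero
    adjoint leaves no energy on \<open>{t..T}\<close>, and observability makes the state at
    \<open>t\<close> zero.\<close>
  have "(\<phi> t, \<psi> t) \<noteq> (0, 0)" if t: "0 \<le> t" "t < T" for t
  proof
    assume "(\<phi> t, \<psi> t) = (0, 0)"
    then have "energy (\<lambda>t. x t - 0) t T \<le> 0"
      using extremal_monotone[OF ex extremal_trivial[OF T] t(1) less_imp_le[OF t(2)]] by simp
    then have "obs_const (R + R) * hnorm (x t - 0) (y t - 0) ^ 5 \<le> 0"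
      using extremal_state_bound(1)[OF ex extremal_trivial[OF T] t(1)] by (rule order_trans[rotated])
    then show False using hnorm_pow_le_0 nz[OF t] by fastforce
  qed
  then have "synthesis x0 y0 x y \<phi> \<psi> T"
    unfolding synthesis_def using opt ex adj uni nz Tle[OF inS] by blast
  then show ?thesis by blast
qed

lemma synthesis_time_le:
  assumes "synthesis x0 y0 x y \<phi> \<psi> T"
  shows "T \<le> extinction_const * hnorm x0 y0"
proof -
  have "T \<le> 0 + extinction_const * hnorm (x 0) (y 0)" "extremal x0 y0 x y \<phi> \<psi> T"
    using assms unfolding synthesis_def by blast+
  then show ?thesis using extremal_init by fastforce
qed

text \<open>At time \<open>T\<close> the first trajectory is extinct, so the state of the second
  equals the difference, whose fifth power is controlled by the squared distance of the data.
  Restarting the extinction bound at \<open>T\<close> bounds the remaining life, with local Hoelder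
  exponent 2/5.\<close>

lemma synthesis_time_diff:
  assumes 1: "synthesis x0 y0 x y \<phi> \<psi> T" and 2: "synthesis x0' y0' x' y' \<phi>' \<psi>' T'"
    and b: "T \<le> b" "T' \<le> b"
  shows "T' - T \<le> extinction_const *
     root 5 ((1 + b)\<^sup>2 * b / obs_const (R + R) * (dist (x0, y0) (x0', y0'))\<^sup>2)"
proof -
  have ex: "extremal x0 y0 x y \<phi> \<psi> T" "extremal x0' y0' x' y' \<phi>' \<psi>' T'"
    using 1 2 by (auto simp: synthesis_def)
  note e1 = extremal_mono[OF ex(1) b(1)] and e2 = extremal_mono[OF ex(2) b(2)]
  have T: "0 \<le> T" and z: "x T = 0" "y T = 0" using ex(1) by (auto simp: extremal_def)
  define c where "c = obs_const (R + R)"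
  define Q where "Q = dist (x0, y0) (x0', y0')"
  define N where "N = hnorm (x' T) (y' T)"
  have c: "c > 0" using obs_const_2R_pos by (simp add: c_def)
  have "c * N ^ 5 \<le> energy (\<lambda>t. x t - x' t) 0 b"
    using extremal_state_bound(2)[OF e1 e2 T] by (simp add: z c_def N_def hnorm_def)
  also have "\<dots> \<le> dist (\<phi> 0, \<psi> 0) (\<phi>' 0, \<psi>' 0) * Q" unfolding Q_def by (rule extremal_energy_le[OF e1 e2])
  also have "\<dots> \<le> (1 + b)\<^sup>2 * b * Q * Q"
    unfolding Q_def by (intro mult_right_mono extremal_lipschitz[OF e1 e2]) auto
  finally have "N ^ 5 \<le> (1 + b)\<^sup>2 * b / c * Q\<^sup>2" using c by (simp add: field_simps power2_eq_square)
  then have "root 5 (N ^ 5) \<le> root 5 ((1 + b)\<^sup>2 * b / c * Q\<^sup>2)" by simp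
  then have "N \<le> root 5 ((1 + b)\<^sup>2 * b / c * Q\<^sup>2)"
    by (simp add: real_root_power_cancel N_def)
  then have "extinction_const * N \<le> extinction_const * root 5 ((1 + b)\<^sup>2 * b / c * Q\<^sup>2)"
    using extinction_const_pos by (intro mult_left_mono) auto
  moreover have "T' \<le> T + extinction_const * N" using 2 T unfolding synthesis_def N_def by blast
  ultimately show ?thesis by (simp add: c_def Q_def)
qed

section \<open>Dependence on the initial state\<close>

context
  fixes X Y \<Phi> \<Psi> :: "U \<Rightarrow> U \<Rightarrow> real \<Rightarrow> U" and T :: "U \<Rightarrow> U \<Rightarrow> real"
  assumes syn: "\<And>x0 y0. synthesis x0 y0 (X x0 y0) (Y x0 y0) (\<Phi> x0 y0) (\<Psi> x0 y0) (T x0 y0)"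
begin

text \<open>Provides one horizon for the whole unit ball around \<open>q\<close>, which makes the
  constants of the comparison estimates locally uniform.\<close>

lemma time_bound:
  assumes "dist q' q < 1"
  shows "T (fst q') (snd q') \<le> extinction_const * (2 + norm q)"
proof -
  have "hnorm (fst q') (snd q') \<le> 1 + norm q'" using hnorm_le_norm[of "fst q'" "snd q'"] by simp
  also have "norm q' \<le> norm q + 1" using assms norm_triangle_sub[of q' q] by (simp add: dist_norm)
  finally have "extinction_const * hnorm (fst q') (snd q') \<le> extinction_const * (2 + norm q)"
    using extinction_const_pos by (intro mult_left_mono) auto
  then show ?thesis using synthesis_time_le[OF syn] by (rule order_trans[rotated])
qed

lemma time_continuous: "continuous_on UNIV (\<lambda>q. T (fst q) (snd q))"
proof (rule continuous_at_imp_continuous_on, rule ballI)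
  fix q :: "U \<times> U"
  define b where "b = extinction_const * (2 + norm q)"
  define g where "g q' = extinction_const * root 5 ((1 + b)\<^sup>2 * b / obs_const (R + R) * (dist q' q)\<^sup>2)" for q'
  have le: "norm (T (fst q') (snd q') - T (fst q) (snd q)) \<le> g q'" if "dist q' q < 1" for q'
  proof -
    have b: "T (fst q') (snd q') \<le> b" "T (fst q) (snd q) \<le> b"
      using time_bound[OF that] time_bound[of q q] by (simp_all add: b_def)
    show ?thesis
      using synthesis_time_diff[OF syn[of "fst q'" "snd q'"] syn[of "fst q" "snd q"] b]
        synthesis_time_diff[OF syn[of "fst q" "snd q"] syn[of "fst q'" "snd q'"] b(2,1)]
      by (simp add: g_def dist_commute)
  qed
  have "(g \<longlongrightarrow> extinction_const * root 5 ((1 + b)\<^sup>2 * b / obs_const (R + R) * (dist q q)\<^sup>2)) (at q)"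
    unfolding g_def[abs_def] by (intro tendsto_intros)
  then have "(g \<longlongrightarrow> 0) (at q)" by simp
  then have "((\<lambda>q'. T (fst q') (snd q') - T (fst q) (snd q)) \<longlongrightarrow> 0) (at q)"
    by (rule Lim_null_comparison[rotated]) (use le in \<open>auto simp: eventually_at intro!: exI[of _ 1]\<close>)
  then show "isCont (\<lambda>q. T (fst q) (snd q)) q" by (simp add: isCont_def LIM_zero_iff)
qed

lemma adjoint_map_lipschitz: "locally_lipschitz (\<lambda>q. (\<Phi> (fst q) (snd q) 0, \<Psi> (fst q) (snd q) 0))"
  unfolding locally_lipschitz_def
proof
  fix q :: "U \<times> U"
  define b where "b = extinction_const * (2 + norm q)"
  have b0: "0 \<le> b" using extinction_const_pos by (simp add: b_def)
  have "((1 + b)\<^sup>2 * b)-lipschitz_on (ball q 1) (\<lambda>q. (\<Phi> (fst q) (snd q) 0, \<Psi> (fst q) (snd q) 0))"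
  proof (rule lipschitz_onI)
    fix p p' assume "p \<in> ball q 1" "p' \<in> ball q 1"
    then have d: "dist p q < 1" "dist p' q < 1" by (simp_all add: dist_commute)
    have "extremal (fst p) (snd p) (X (fst p) (snd p)) (Y (fst p) (snd p)) (\<Phi> (fst p) (snd p)) (\<Psi> (fst p) (snd p)) b"
      if "dist p q < 1" for p
      using syn[of "fst p" "snd p"] extremal_mono[OF _ time_bound[OF that]]
      unfolding synthesis_def b_def by blast
    from extremal_lipschitz[OF this[OF d(1)] this[OF d(2)]]
    show "dist (\<Phi> (fst p) (snd p) 0, \<Psi> (fst p) (snd p) 0) (\<Phi> (fst p') (snd p') 0, \<Psi> (fst p') (snd p') 0)
        \<le> (1 + b)\<^sup>2 * b * dist p p'" by simp
  qed (use b0 in simp)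
  then show "\<exists>r>0. \<exists>L. L-lipschitz_on (ball q r) (\<lambda>q. (\<Phi> (fst q) (snd q) 0, \<Psi> (fst q) (snd q) 0))"
    using zero_less_one by blast
qed

lemma adjoint_map_bij: "bij (\<lambda>q. (\<Phi> (fst q) (snd q) 0, \<Psi> (fst q) (snd q) 0))"
proof (rule bij_of_inj_coercive)
  have ex: "extremal x0 y0 (X x0 y0) (Y x0 y0) (\<Phi> x0 y0) (\<Psi> x0 y0) (T x0 y0)" for x0 y0
    using syn unfolding synthesis_def by blast
  show "continuous_on UNIV (\<lambda>q. (\<Phi> (fst q) (snd q) 0, \<Psi> (fst q) (snd q) 0))"
  proof (rule continuous_at_imp_continuous_on, rule ballI)
    fix q :: "U \<times> U"
    obtain r L where r: "0 < r" and "L-lipschitz_on (ball q r) (\<lambda>q. (\<Phi> (fst q) (snd q) 0, \<Psi> (fst q) (snd q) 0))"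
      using adjoint_map_lipschitz unfolding locally_lipschitz_def by blast
    then have "continuous_on (ball q r) (\<lambda>q. (\<Phi> (fst q) (snd q) 0, \<Psi> (fst q) (snd q) 0))"
      by (intro lipschitz_on_continuous_on)
    then show "isCont (\<lambda>q. (\<Phi> (fst q) (snd q) 0, \<Psi> (fst q) (snd q) 0)) q"
      using r by (simp add: continuous_on_eq_continuous_at)
  qed
  show "inj (\<lambda>q. (\<Phi> (fst q) (snd q) 0, \<Psi> (fst q) (snd q) 0))"
  proof (rule injI)
    fix p q :: "U \<times> U"
    assume eq: "(\<Phi> (fst p) (snd p) 0, \<Psi> (fst p) (snd p) 0) = (\<Phi> (fst q) (snd q) 0, \<Psi> (fst q) (snd q) 0)"
    define b where "b = max (T (fst p) (snd p)) (T (fst q) (snd q))"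
    have e: "extremal (fst p) (snd p) (X (fst p) (snd p)) (Y (fst p) (snd p)) (\<Phi> (fst p) (snd p)) (\<Psi> (fst p) (snd p)) b"
      "extremal (fst q) (snd q) (X (fst q) (snd q)) (Y (fst q) (snd q)) (\<Phi> (fst q) (snd q)) (\<Psi> (fst q) (snd q)) b"
      by (rule extremal_mono[OF ex]; simp add: b_def)+
    have "obs_const (R + R) * hnorm (fst p - fst q) (snd p - snd q) ^ 5 \<le> 0"
      using order_trans[OF extremal_state_bound(2)[OF e order_refl] extremal_energy_le[OF e]] eq
        extremal_init[OF e(1)] extremal_init[OF e(2)] by simp
    from hnorm_pow_le_0[OF this] show "p = q" by (simp add: prod_eq_iff)
  qed
  show "\<exists>s. \<forall>q. norm (\<Phi> (fst q) (snd q) 0, \<Psi> (fst q) (snd q) 0) \<le> B \<longrightarrow> norm q \<le> s" for B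
  proof (intro exI allI impI)
    fix q :: "U \<times> U"
    define k where "k = adjoint_const * (1 + B)"
    assume B: "norm (\<Phi> (fst q) (snd q) 0, \<Psi> (fst q) (snd q) 0) \<le> B"
    \<comment> \<open>Coercivity passes from the ordinary norm of the adjoint pair to the weighted
      one, where the lower estimate is available, and back again for the state.\<close>
    have root_le: "root n a \<le> 1 + a" if "0 \<le> a" "0 < n" for n and a :: real
    proof -
      have "a \<le> (1 + a) ^ 1" by simp
      also have "\<dots> \<le> (1 + a) ^ n" using that by (intro power_increasing) auto
      finally have "root n a \<le> root n ((1 + a) ^ n)" using that by simp
      then show ?thesis using that by (simp add: real_root_power_cancel)
    qed
    have "adjoint_hnorm (\<Phi> (fst q) (snd q) 0) (\<Psi> (fst q) (snd q) 0) \<le> 1 + B"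
      using root_le[of "norm (\<Phi> (fst q) (snd q) 0)" 3] root_le[of "norm (\<Psi> (fst q) (snd q) 0)" 4] B
        norm_fst_le[of "\<Phi> (fst q) (snd q) 0" "\<Psi> (fst q) (snd q) 0"]
        norm_snd_le[of "\<Psi> (fst q) (snd q) 0" "\<Phi> (fst q) (snd q) 0"]
      by (simp add: adjoint_hnorm_def)
    then have "adjoint_const * adjoint_hnorm (\<Phi> (fst q) (snd q) 0) (\<Psi> (fst q) (snd q) 0) \<le> k"
      unfolding k_def by (intro mult_left_mono) (auto simp: adjoint_const_def)
    then have "hnorm (fst q) (snd q) \<le> k" using extremal_adjoint_ge[OF ex] by (rule order_trans[rotated])
    moreover from this have "(hnorm (fst q) (snd q))\<^sup>2 \<le> k\<^sup>2" by (intro power_mono) auto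
    ultimately show "norm q \<le> (adjoint_const * (1 + B))\<^sup>2 + adjoint_const * (1 + B)"
      using norm_le_hnorm_Pair[of "fst q" "snd q"] unfolding k_def by simp
  qed
qed

end

end

theorem theorem1:
  fixes \<Omega> :: "U set"
  assumes "convex \<Omega>" and "compact \<Omega>" and "0 \<in> interior \<Omega>"
  shows "\<exists>(X :: U \<Rightarrow> U \<Rightarrow> real \<Rightarrow> U) (Y :: U \<Rightarrow> U \<Rightarrow> real \<Rightarrow> U)
            (\<Phi> :: U \<Rightarrow> U \<Rightarrow> real \<Rightarrow> U) (\<Psi> :: U \<Rightarrow> U \<Rightarrow> real \<Rightarrow> U) (T :: U \<Rightarrow> U \<Rightarrow> real).
     \<comment> \<open>part 1\<close>
     (\<forall>x0 y0.
        optimal \<Omega> x0 y0 (X x0 y0) (Y x0 y0) \<and>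
        (\<forall>x y. optimal \<Omega> x0 y0 x y \<longrightarrow> (\<forall>t\<ge>0. x t = X x0 y0 t \<and> y t = Y x0 y0 t)) \<and>
        (\<forall>u. admissible \<Omega> x0 y0 (X x0 y0) (Y x0 y0) u \<longrightarrow>
             adjoint \<Omega> (X x0 y0) u (\<Phi> x0 y0) (\<Psi> x0 y0) \<and>
             (\<forall>\<phi> \<psi>. adjoint \<Omega> (X x0 y0) u \<phi> \<psi> \<longrightarrow>
                 (\<forall>t\<ge>0. \<phi> t = \<Phi> x0 y0 t \<and> \<psi> t = \<Psi> x0 y0 t)))) \<and>
     \<comment> \<open>part 2\<close>
     (\<forall>x0 y0. T x0 y0 \<ge> 0 \<and>
        (\<forall>t\<ge>T x0 y0. X x0 y0 t = 0 \<and> Y x0 y0 t = 0 \<and> \<Phi> x0 y0 t = 0 \<and> \<Psi> x0 y0 t = 0) \<and>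
        (\<forall>t. 0 \<le> t \<and> t < T x0 y0 \<longrightarrow>
            (X x0 y0 t, Y x0 y0 t) \<noteq> (0, 0) \<and> (\<Phi> x0 y0 t, \<Psi> x0 y0 t) \<noteq> (0, 0))) \<and>
     continuous_on UNIV (\<lambda>q::U \<times> U. T (fst q) (snd q)) \<and>
     (\<exists>C1 C2. C1 > 0 \<and> C2 > 0 \<and> (\<forall>x0 y0.
        C1 * max (sqrt (norm x0)) (norm y0) \<le> T x0 y0 \<and>
        T x0 y0 \<le> C2 * max (sqrt (norm x0)) (norm y0))) \<and>
     \<comment> \<open>part 3\<close>
     locally_lipschitz (\<lambda>q::U \<times> U. (\<Phi> (fst q) (snd q) 0, \<Psi> (fst q) (snd q) 0)) \<and>
     bij (\<lambda>q::U \<times> U. (\<Phi> (fst q) (snd q) 0, \<Psi> (fst q) (snd q) 0)) \<and>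
     (\<exists>C3 C4. C3 > 0 \<and> C4 > 0 \<and> (\<forall>x0 y0.
        C3 * max (sqrt (norm x0)) (norm y0)
          \<le> max (root 3 (norm (\<Phi> x0 y0 0))) (root 4 (norm (\<Psi> x0 y0 0))) \<and>
        max (root 3 (norm (\<Phi> x0 y0 0))) (root 4 (norm (\<Psi> x0 y0 0)))
          \<le> C4 * max (sqrt (norm x0)) (norm y0)))"
proof -
  obtain r where r: "0 < r" "cball 0 r \<subseteq> \<Omega>"
    using assms(3) by (auto simp: mem_interior_cball)
  obtain B where B: "\<And>v. v \<in> \<Omega> \<Longrightarrow> norm v \<le> B"
    using compact_imp_bounded[OF assms(2)] by (auto simp: bounded_iff)
  interpret control_set \<Omega> r "max 1 B"
    by unfold_locales (use assms r B in \<open>auto simp: compact_imp_closed le_max_iff_disj\<close>)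
  have "\<forall>p. \<exists>z. synthesis (fst p) (snd p) (fst z) (fst (snd z)) (fst (snd (snd z)))
      (fst (snd (snd (snd z)))) (snd (snd (snd (snd z))))"
    \<comment> \<open>One choice over pairs followed by projections guarantees that the five
      functions belong to the same synthesis at each initial state.\<close>
    using synthesis_exists by (metis fst_conv snd_conv)
  from choice[OF this] obtain F where F: "\<And>p. synthesis (fst p) (snd p) (fst (F p)) (fst (snd (F p)))
      (fst (snd (snd (F p)))) (fst (snd (snd (snd (F p))))) (snd (snd (snd (snd (F p)))))"
    by blast
  define X where "X x0 y0 = fst (F (x0, y0))" for x0 y0
  define Y where "Y x0 y0 = fst (snd (F (x0, y0)))" for x0 y0
  define \<Phi> where "\<Phi> x0 y0 = fst (snd (snd (F (x0, y0))))" for x0 y0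
  define \<Psi> where "\<Psi> x0 y0 = fst (snd (snd (snd (F (x0, y0)))))" for x0 y0
  define T where "T x0 y0 = snd (snd (snd (snd (F (x0, y0)))))" for x0 y0
  have syn: "synthesis x0 y0 (X x0 y0) (Y x0 y0) (\<Phi> x0 y0) (\<Psi> x0 y0) (T x0 y0)" for x0 y0
    using F[of "(x0, y0)"] by (simp add: X_def Y_def \<Phi>_def \<Psi>_def T_def)
  have ex: "extremal x0 y0 (X x0 y0) (Y x0 y0) (\<Phi> x0 y0) (\<Psi> x0 y0) (T x0 y0)" for x0 y0
    using syn unfolding synthesis_def by blast
  define R where "R = max 1 B"
  have R: "1 \<le> R" by (simp add: R_def)
  show ?thesis
  proof (rule exI[of _ X], rule exI[of _ Y], rule exI[of _ \<Phi>], rule exI[of _ \<Psi>], rule exI[of _ T],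
      intro conjI allI)
    fix x0 y0
    show opt: "optimal \<Omega> x0 y0 (X x0 y0) (Y x0 y0)" using syn unfolding synthesis_def by blast
    show "optimal \<Omega> x0 y0 x y \<longrightarrow> (\<forall>t\<ge>0. x t = X x0 y0 t \<and> y t = Y x0 y0 t)" for x y
      using optimal_unique[OF _ opt] by blast
    show "admissible \<Omega> x0 y0 (X x0 y0) (Y x0 y0) u \<longrightarrow>
             adjoint \<Omega> (X x0 y0) u (\<Phi> x0 y0) (\<Psi> x0 y0) \<and>
             (\<forall>\<phi> \<psi>. adjoint \<Omega> (X x0 y0) u \<phi> \<psi> \<longrightarrow>
                 (\<forall>t\<ge>0. \<phi> t = \<Phi> x0 y0 t \<and> \<psi> t = \<Psi> x0 y0 t))" for u
      using syn unfolding synthesis_def by blast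
    show "0 \<le> T x0 y0" using ex unfolding extremal_def by blast
    show "T x0 y0 \<le> t \<longrightarrow> X x0 y0 t = 0 \<and> Y x0 y0 t = 0 \<and> \<Phi> x0 y0 t = 0 \<and> \<Psi> x0 y0 t = 0" for t
      using ex unfolding extremal_def by blast
    show "0 \<le> t \<and> t < T x0 y0 \<longrightarrow>
            (X x0 y0 t, Y x0 y0 t) \<noteq> (0, 0) \<and> (\<Phi> x0 y0 t, \<Psi> x0 y0 t) \<noteq> (0, 0)" for t
      using syn unfolding synthesis_def by blast
  next
    show "continuous_on UNIV (\<lambda>q::U \<times> U. T (fst q) (snd q))" by (rule time_continuous[OF syn])
    show "locally_lipschitz (\<lambda>q::U \<times> U. (\<Phi> (fst q) (snd q) 0, \<Psi> (fst q) (snd q) 0))"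
      by (rule adjoint_map_lipschitz[OF syn])
    show "bij (\<lambda>q::U \<times> U. (\<Phi> (fst q) (snd q) 0, \<Psi> (fst q) (snd q) 0))"
      by (rule adjoint_map_bij[OF syn])
    have "1 / (2 * R) * hnorm x0 y0 \<le> T x0 y0 \<and> T x0 y0 \<le> extinction_const * hnorm x0 y0" for x0 y0
      using extremal_hnorm_le[OF ex, of x0 y0] synthesis_time_le[OF syn] R
      by (simp add: R_def field_simps)
    then show "\<exists>C1 C2. C1 > 0 \<and> C2 > 0 \<and> (\<forall>x0 y0.
        C1 * max (sqrt (norm x0)) (norm y0) \<le> T x0 y0 \<and>
        T x0 y0 \<le> C2 * max (sqrt (norm x0)) (norm y0))"
      unfolding hnorm_def using R extinction_const_pos
      by (intro exI[of _ "1 / (2 * R)"] exI[of _ extinction_const]) auto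
    have A: "0 < adjoint_const" by (simp add: adjoint_const_def)
    have "1 / adjoint_const * hnorm x0 y0 \<le> adjoint_hnorm (\<Phi> x0 y0 0) (\<Psi> x0 y0 0) \<and>
        adjoint_hnorm (\<Phi> x0 y0 0) (\<Psi> x0 y0 0) \<le> 2 * R * extinction_const * hnorm x0 y0" for x0 y0
    proof
      show "1 / adjoint_const * hnorm x0 y0 \<le> adjoint_hnorm (\<Phi> x0 y0 0) (\<Psi> x0 y0 0)"
        using extremal_adjoint_ge[OF ex, of x0 y0] A by (simp add: field_simps)
      have "adjoint_hnorm (\<Phi> x0 y0 0) (\<Psi> x0 y0 0) \<le> 2 * R * T x0 y0"
        using extremal_adjoint_le[OF ex] by (simp add: R_def)
      also have "\<dots> \<le> 2 * R * (extinction_const * hnorm x0 y0)"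
        using R by (intro mult_left_mono synthesis_time_le[OF syn]) auto
      finally show "adjoint_hnorm (\<Phi> x0 y0 0) (\<Psi> x0 y0 0) \<le> 2 * R * extinction_const * hnorm x0 y0" by simp
    qed
    then show "\<exists>C3 C4. C3 > 0 \<and> C4 > 0 \<and> (\<forall>x0 y0.
        C3 * max (sqrt (norm x0)) (norm y0)
          \<le> max (root 3 (norm (\<Phi> x0 y0 0))) (root 4 (norm (\<Psi> x0 y0 0))) \<and>
        max (root 3 (norm (\<Phi> x0 y0 0))) (root 4 (norm (\<Psi> x0 y0 0)))
          \<le> C4 * max (sqrt (norm x0)) (norm y0))"
      unfolding hnorm_def adjoint_hnorm_def using A R extinction_const_pos
      by (intro exI[of _ "1 / adjoint_const"] exI[of _ "2 * R * extinction_const"]) auto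
  qed
qed

end
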